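(* Let $-1<\alpha<0$, and let $\varphi$ and $\psi$ be nonconstant linear fractional self-maps of $\mathbb D$. Let $\tau$ be the Krein adjoint of $\psi$. Then, for every fixed $r>0$, $$\|C_\varphi C_\psi^*\|_{e,\mathcal D_\alpha}^2\asymp\limsup_{|z|\to1^-}\frac{\displaystyle\int_{D(z,r)\cap(\tau\circ\varphi)(\mathbb D)}N_{\tau\circ\varphi,\alpha}(w)\,dA(w)}{A_\alpha(D(z,r))}.$$
   Context: $\mathbb D$ is the open unit disk in $\mathbb C$ and $dA$ is the normalized area measure on $\mathbb D$. For $\alpha>-1$, $dA_\alpha(z)=(1+\alpha)(1-|z|^2)^\alpha\,dA(z)$ and $A_\alpha(E)=\int_E dA_\alpha$ for measurable $E\subset\mathbb D$. The weighted Dirichlet space $\mathcal D_\alpha$ is the Hilbert space of analytic functions $f$ on $\mathbb D$ with $\|f\|_{\mathcal D_\alpha}^2=|f(0)|^2+\int_{\mathbb D}|f'(z)|^2\,dA_\alpha(z)<\infty$, with the associated inner product. A nonconstant linear fractional self-map of $\mathbb D$ is a map $\psi(z)=\frac{az+b}{cz+d}$ with $ad-bc\neq0$ and $\psi(\mathbb D)\subset\mathbb D$. Its Krein adjoint is $\tau(z)=\frac{\overline a z-\overline c}{-\overline b z+\overline d}$, which is again a linear fractional self-map of $\mathbb D$. The composition operator is $C_\varphi f=f\circ\varphi$; for such $\varphi$ it is bounded on $\mathcal D_\alpha$. $C_\psi^*$ is the Hilbert space adjoint of $C_\psi$ on $\mathcal D_\alpha$. For an analytic self-map $\eta$ of $\mathbb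 D$, $N_{\eta,\alpha}(w)=\sum_{\eta(z)=w}(1-|z|^2)^\alpha$ is the generalized Nevanlinna counting function (preimages in $\mathbb D$ counted with multiplicity), with $N_{\eta,\alpha}(w)=0$ for $w\notin\eta(\mathbb D)$. For $z,w\in\mathbb D$, $\rho(z,w)=\left|\frac{z-w}{1-\overline z w}\right|$, $\beta(z,w)=\frac12\log\frac{1+\rho(z,w)}{1-\rho(z,w)}$, and $D(z,r)=\{w\in\mathbb D:\beta(z,w)<r\}$. For a bounded operator $T$ on a Hilbert space $\mathcal H$, the essential norm is $\|T\|_{e,\mathcal H}=\inf\{\|T-K\|:K\text{ compact on }\mathcal H\}$. $X\asymp Y$ means that there exist positive constants $c$ and $C$ (here independent of $z$; $\alpha,\varphi,\psi,r$ are fixed) such that $cY\le X\le CY$. *)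

theory Defs
  imports "HOL-Complex_Analysis.Complex_Analysis"
begin

abbreviation unit_disk :: "complex set" where
  "unit_disk \<equiv> ball 0 1"

definition disk_area :: "complex measure" where
  "disk_area = uniform_measure lebesgue unit_disk"

definition weighted_area :: "real \<Rightarrow> complex measure" where
  "weighted_area \<alpha> =
     density disk_area (\<lambda>z. ennreal ((1 + \<alpha>) * (1 - (cmod z)\<^sup>2) powr \<alpha>))"

text \<open>An analytic function on the disk is represented by its extension by \<open>0\<close> to all of
  \<open>\<complex>\<close>, so that equality in the space is equality of HOL functions.\<close>

definition dirichlet_space :: "real \<Rightarrow> (complex \<Rightarrow> complex) set" where
  "dirichlet_space \<alpha> =
     {f. f holomorphic_on unit_disk \<and> (\<forall>z. z \<notin> unit_disk \<longrightarrow> f z = 0) \<and>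
         set_integrable (weighted_area \<alpha>) unit_disk (\<lambda>z. (cmod (deriv f z))\<^sup>2)}"

definition dirichlet_inner ::
    "real \<Rightarrow> (complex \<Rightarrow> complex) \<Rightarrow> (complex \<Rightarrow> complex) \<Rightarrow> complex" where
  "dirichlet_inner \<alpha> f g =
     f 0 * cnj (g 0) + (LINT z:unit_disk|weighted_area \<alpha>. deriv f z * cnj (deriv g z))"

definition dirichlet_norm :: "real \<Rightarrow> (complex \<Rightarrow> complex) \<Rightarrow> real" where
  "dirichlet_norm \<alpha> f =
     sqrt ((cmod (f 0))\<^sup>2 + (LINT z:unit_disk|weighted_area \<alpha>. (cmod (deriv f z))\<^sup>2))"

text \<open>Operators are maps on functions; only their values on \<^const>\<open>dirichlet_space\<close> matter.\<close>

type_synonym fun_operator = "(complex \<Rightarrow> complex) \<Rightarrow> (complex \<Rightarrow> complex)"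

definition bounded_operator :: "real \<Rightarrow> fun_operator \<Rightarrow> bool" where
  "bounded_operator \<alpha> T \<longleftrightarrow>
     (\<forall>f\<in>dirichlet_space \<alpha>. T f \<in> dirichlet_space \<alpha>) \<and>
     (\<forall>f\<in>dirichlet_space \<alpha>. \<forall>g\<in>dirichlet_space \<alpha>. \<forall>a b.
        T (\<lambda>z. a * f z + b * g z) = (\<lambda>z. a * T f z + b * T g z)) \<and>
     (\<exists>B. \<forall>f\<in>dirichlet_space \<alpha>. dirichlet_norm \<alpha> (T f) \<le> B * dirichlet_norm \<alpha> f)"

definition operator_norm :: "real \<Rightarrow> fun_operator \<Rightarrow> real" where
  "operator_norm \<alpha> T =
     (SUP f\<in>{f \<in> dirichlet_space \<alpha>. dirichlet_norm \<alpha> f \<le> 1}. dirichlet_norm \<alpha> (T f))"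

definition compact_operator :: "real \<Rightarrow> fun_operator \<Rightarrow> bool" where
  "compact_operator \<alpha> K \<longleftrightarrow>
     bounded_operator \<alpha> K \<and>
     (\<forall>F :: nat \<Rightarrow> complex \<Rightarrow> complex.
        (\<forall>n. F n \<in> dirichlet_space \<alpha> \<and> dirichlet_norm \<alpha> (F n) \<le> 1) \<longrightarrow>
        (\<exists>g\<in>dirichlet_space \<alpha>. \<exists>s :: nat \<Rightarrow> nat. strict_mono s \<and>
           (\<lambda>n. dirichlet_norm \<alpha> (\<lambda>z. K (F (s n)) z - g z)) \<longlonglongrightarrow> 0))"

definition essential_norm :: "real \<Rightarrow> fun_operator \<Rightarrow> real" where
  "essential_norm \<alpha> T =
     (INF K\<in>{K. compact_operator \<alpha> K}. operator_norm \<alpha> (\<lambda>f z. T f z - K f z))"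

text \<open>For bounded \<open>T\<close> the element \<open>h\<close> exists by the Riesz representation theorem.\<close>

definition hilbert_adjoint :: "real \<Rightarrow> fun_operator \<Rightarrow> fun_operator" where
  "hilbert_adjoint \<alpha> T g =
     (THE h. h \<in> dirichlet_space \<alpha> \<and>
        (\<forall>f\<in>dirichlet_space \<alpha>. dirichlet_inner \<alpha> (T f) g = dirichlet_inner \<alpha> f h))"

definition composition_operator :: "(complex \<Rightarrow> complex) \<Rightarrow> fun_operator" where
  "composition_operator \<phi> f = (\<lambda>z. if z \<in> unit_disk then f (\<phi> z) else 0)"

definition linear_fractional ::
    "complex \<Rightarrow> complex \<Rightarrow> complex \<Rightarrow> complex \<Rightarrow> complex \<Rightarrow> complex" where
  "linear_fractional a b c d z = (a * z + b) / (c * z + d)"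

text \<open>The denominator condition excludes poles in the disk, where HOL division would return \<open>0\<close>.\<close>

definition nonconst_lf_self_map :: "complex \<Rightarrow> complex \<Rightarrow> complex \<Rightarrow> complex \<Rightarrow> bool" where
  "nonconst_lf_self_map a b c d \<longleftrightarrow>
     a * d - b * c \<noteq> 0 \<and> (\<forall>z\<in>unit_disk. c * z + d \<noteq> 0) \<and>
     linear_fractional a b c d ` unit_disk \<subseteq> unit_disk"

definition krein_adjoint ::
    "complex \<Rightarrow> complex \<Rightarrow> complex \<Rightarrow> complex \<Rightarrow> complex \<Rightarrow> complex" where
  "krein_adjoint a b c d = linear_fractional (cnj a) (- cnj c) (- cnj b) (cnj d)"

text \<open>\<open>zorder (\<lambda>u. \<eta> u - w) z\<close> is the multiplicity of \<open>z\<close> as a solution of \<open>\<eta> z = w\<close>, for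
  \<open>\<eta>\<close> nonconstant and analytic on the disk.\<close>

definition nevanlinna_counting :: "(complex \<Rightarrow> complex) \<Rightarrow> real \<Rightarrow> complex \<Rightarrow> ennreal" where
  "nevanlinna_counting \<eta> \<alpha> w =
     (\<Sum>\<^sub>\<infinity>z\<in>{z \<in> unit_disk. \<eta> z = w}.
        of_nat (nat (zorder (\<lambda>u. \<eta> u - w) z)) * ennreal ((1 - (cmod z)\<^sup>2) powr \<alpha>))"

definition pseudo_hyperbolic_dist :: "complex \<Rightarrow> complex \<Rightarrow> real" where
  "pseudo_hyperbolic_dist z w = cmod ((z - w) / (1 - cnj z * w))"

definition hyperbolic_dist :: "complex \<Rightarrow> complex \<Rightarrow> real" where
  "hyperbolic_dist z w =
     1 / 2 * ln ((1 + pseudo_hyperbolic_dist z w) / (1 - pseudo_hyperbolic_dist z w))"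

definition hyperbolic_disk :: "complex \<Rightarrow> real \<Rightarrow> complex set" where
  "hyperbolic_disk z r = {w \<in> unit_disk. hyperbolic_dist z w < r}"

text \<open>The filter \<open>filtercomap cmod (at_left 1)\<close> expresses \<open>|z| \<rightarrow> 1\<^sup>-\<close>.\<close>

definition averaged_counting_limsup :: "(complex \<Rightarrow> complex) \<Rightarrow> real \<Rightarrow> real \<Rightarrow> ennreal" where
  "averaged_counting_limsup \<eta> \<alpha> r =
     Limsup (filtercomap cmod (at_left 1))
       (\<lambda>z. (\<integral>\<^sup>+w\<in>hyperbolic_disk z r \<inter> \<eta> ` unit_disk. nevanlinna_counting \<eta> \<alpha> w \<partial>disk_area) /
            emeasure (weighted_area \<alpha>) (hyperbolic_disk z r))"

end

theory Submission
  imports Defs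
begin

text \<open>
  All parameters are fixed, and the constants may depend on them. The two sides are therefore
  comparable as soon as the limsup is finite and both sides vanish in the same cases. The map
  \<open>\<eta> = \<tau> \<circ> \<phi>\<close> is again linear fractional, and there are two cases: either \<open>\<eta>\<close> maps the closed disk
  into the open disk, or \<open>|\<eta>(\<zeta>)| = 1\<close> for some \<open>\<zeta>\<close> on the circle. On the circle \<open>\<tau>\<close> inverts \<open>\<psi>\<close>
  (\<open>krein_adjoint_circle\<close>), so the second case means that \<open>\<phi>(\<zeta>) = \<psi>(\<omega>)\<close> for two points of the circle
  whose common image lies on the circle, or that \<open>1 - \<phi>(z) cnj (\<psi>(w))\<close> vanishes somewhere on the
  closed bidisk.

  This quantity governs the operator \<open>T = C\<^sub>\<phi> C\<^sub>\<psi>\<^sup>*\<close>. Evaluation of the derivative at \<open>w\<close> is represented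
  in the Dirichlet space by a function whose derivative is the weighted Bergman kernel
  \<open>(1 - z cnj w) powr -(\<alpha> + 2)\<close> (\<open>bergman_reproducing\<close>, \<open>inner_derivative_kernel\<close>). The adjoint maps
  such kernels to multiples of such kernels, so \<open>f \<mapsto> (T f)'\<close> is an integral operator acting on \<open>f'\<close>
  whose kernel is \<open>(1 - \<phi>(z) cnj (\<psi>(w))) powr -(\<alpha> + 2)\<close>, up to bounded factors and a term of rank
  one.

  If the denominator stays away from zero, the kernel is bounded. Bounded sequences that tend to
  zero pointwise have derivatives tending to zero in \<open>L\<^sup>1\<close>, so \<open>T\<close> is compact (\<open>product_compact\<close>) and
  its essential norm is zero. If the denominator vanishes at \<open>(\<zeta>, \<omega>)\<close>, then along the radii ending
  there the kernel is as large as the norms of the derivative kernels permit. These kernels tend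
  weakly to zero, so no compact operator can cancel this, and the essential norm is positive
  (\<open>essential_norm_pos\<close>).

  The averaged counting function is treated by the substitution \<open>w = \<eta>(u)\<close>
  (\<open>averaged_counting_integral\<close>). It is eventually zero if \<open>\<eta>\<close> stays inside the disk. If \<open>\<eta>\<close> touches
  the circle, it is bounded below along the image of a radius (\<open>averaged_counting_limsup_pos\<close>). It
  is always bounded above (\<open>averaged_counting_le\<close>): test the boundedness of \<open>C\<^sub>\<eta>\<close> on the kernel at \<open>z\<close>.

  The boundedness of composition operators for negative \<open>\<alpha>\<close> does not follow from a comparison of
  weights. It is obtained from the equivalent norm with one more derivative and the weight exponent
  \<open>\<alpha> + 2\<close> (\<open>bergman_energy_deriv\<close>, \<open>bergman_energy_compose_deriv_le\<close>), for which the Schwarz lemma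
  gives the right inequality.
\<close>

section \<open>Change of variables in the complex plane\<close>

text \<open>Integrability passes in both directions under the substitution, so the equality of finite
  integrals extends to nonnegative functions of infinite integral.\<close>

lemma nn_integral_change_of_variables_vec2:
  fixes g :: "real^2 \<Rightarrow> real^2" and f :: "real^2 \<Rightarrow> real"
  assumes S: "S \<in> sets borel"
    and der: "\<And>x. x \<in> S \<Longrightarrow> (g has_derivative g' x) (at x within S)"
    and inj: "inj_on g S"
    and nonneg: "\<And>x. 0 \<le> f x"
    and m1: "(\<lambda>x. indicator (g ` S) x * f x) \<in> borel_measurable borel"
    and m2: "(\<lambda>x. indicator S x * (\<bar>det (matrix (g' x))\<bar> * f (g x))) \<in> borel_measurable borel"
  shows "(\<integral>\<^sup>+x. ennreal (indicator (g ` S) x * f x) \<partial>lborel) =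
         (\<integral>\<^sup>+x. ennreal (indicator S x * (\<bar>det (matrix (g' x))\<bar> * f (g x))) \<partial>lborel)"
proof -
  let ?lift = "vec :: real \<Rightarrow> real^1"
  let ?D = "\<lambda>x. \<bar>det (matrix (g' x))\<bar> * f (g x)"
  have S': "S \<in> sets lebesgue" using S by auto
  have iff: "?D absolutely_integrable_on S \<and> integral S ?D = b \<longleftrightarrow>
             f absolutely_integrable_on (g ` S) \<and> integral (g ` S) f = b" for b
    using has_absolute_integral_change_of_variables[OF S' der inj, of "\<lambda>x. ?lift (f x)" "?lift b"]
    unfolding absolutely_integrable_on_1_iff integral_on_1_eq
    by (simp add: absolutely_integrable_on_1_iff integral_on_1_eq vec_eq_iff)
  have conv: "h absolutely_integrable_on T \<longleftrightarrow> (\<integral>\<^sup>+x. ennreal (indicator T x * h x) \<partial>lborel) < \<infinity>"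
    "h absolutely_integrable_on T \<Longrightarrow> (\<integral>\<^sup>+x. ennreal (indicator T x * h x) \<partial>lborel) = ennreal (integral T h)"
    if m: "(\<lambda>x. indicator T x * h x) \<in> borel_measurable borel" and h: "\<And>x. 0 \<le> h x"
    for h :: "real^2 \<Rightarrow> real" and T
  proof -
    have "(\<lambda>x. indicator T x * h x) \<in> borel_measurable lebesgue"
      using m measurable_completion[of _ lborel] by simp
    moreover have "(\<integral>\<^sup>+x. ennreal (norm (indicator T x * h x)) \<partial>lebesgue) =
        (\<integral>\<^sup>+x. ennreal (indicator T x * h x) \<partial>lborel)"
      unfolding nn_integral_completion using h by (intro nn_integral_cong) (auto simp: indicator_def)
    ultimately show "h absolutely_integrable_on T \<longleftrightarrow> (\<integral>\<^sup>+x. ennreal (indicator T x * h x) \<partial>lborel) < \<infinity>"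
      unfolding set_integrable_def integrable_iff_bounded by simp
    assume a: "h absolutely_integrable_on T"
    have "(\<integral>\<^sup>+x. ennreal (indicator T x * h x) \<partial>lborel) = (\<integral>\<^sup>+x. ennreal (indicator T x * h x) \<partial>lebesgue)"
      unfolding nn_integral_completion ..
    also have "\<dots> = ennreal (\<integral>x. indicator T x * h x \<partial>lebesgue)"
      using a h by (intro nn_integral_eq_integral) (auto simp: set_integrable_def)
    also have "\<dots> = ennreal (integral T h)"
      using set_lebesgue_integral_eq_integral(2)[OF a] by (simp add: set_lebesgue_integral_def)
    finally show "(\<integral>\<^sup>+x. ennreal (indicator T x * h x) \<partial>lborel) = ennreal (integral T h)" .
  qed
  have nD: "\<And>x. 0 \<le> ?D x" using nonneg by simp
  show ?thesis
  proof (cases "f absolutely_integrable_on (g ` S)")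
    case True
    then have "?D absolutely_integrable_on S" "integral S ?D = integral (g ` S) f" using iff by blast+
    then show ?thesis using conv(2)[OF m1 nonneg True] conv(2)[OF m2 nD] by simp
  next
    case False
    then have "\<not> ?D absolutely_integrable_on S" using iff by blast
    then show ?thesis using False conv(1)[OF m1 nonneg] conv(1)[OF m2 nD] by (simp add: not_less top_unique)
  qed
qed

text \<open>These coordinates identify the complex plane with \<open>real^2\<close>, where Jacobian determinants are at
  hand.\<close>

definition complex_to_vec :: "complex \<Rightarrow> real^2" where
  "complex_to_vec z = vector [Re z, Im z]"

definition vec_to_complex :: "real^2 \<Rightarrow> complex" where
  "vec_to_complex v = Complex (v $ 1) (v $ 2)"

lemma vec_to_complex_to_vec [simp]:
  "vec_to_complex (complex_to_vec z) = z" "complex_to_vec (vec_to_complex v) = v"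
  by (auto simp: vec_to_complex_def complex_to_vec_def complex_eq_iff vec_eq_iff forall_2)

lemma linear_vec_to_complex: "linear vec_to_complex"
  by (rule linearI) (auto simp: vec_to_complex_def complex_eq_iff)

lemma linear_complex_to_vec: "linear complex_to_vec"
  by (rule linearI) (auto simp: complex_to_vec_def vec_eq_iff forall_2)

lemma continuous_vec_to_complex: "continuous_on A vec_to_complex"
  using linear_vec_to_complex by (simp add: linear_continuous_on linear_linear)

lemma measurable_vec_to_complex [measurable]: "vec_to_complex \<in> borel_measurable borel"
  by (intro borel_measurable_continuous_onI continuous_vec_to_complex)

lemma lborel_complex_eq_distr: "lborel = distr lborel borel vec_to_complex"
proof (rule lborel_eqI)
  fix l u :: complex
  assume lu: "\<And>b. b \<in> Basis \<Longrightarrow> l \<bullet> b \<le> u \<bullet> b"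
  have le: "complex_to_vec l \<bullet> b \<le> complex_to_vec u \<bullet> b" if "b \<in> Basis" for b
    using lu[of 1] lu[of \<i>] that
    by (auto simp: Basis_vec_def complex_to_vec_def inner_axis UNIV_2 Basis_complex_def)
  have "vec_to_complex -` box l u = box (complex_to_vec l) (complex_to_vec u)"
    by (auto simp: in_box_complex_iff vec_to_complex_def complex_to_vec_def mem_box Basis_vec_def
        inner_axis UNIV_2)
  then have "emeasure (distr lborel borel vec_to_complex) (box l u) =
             emeasure lborel (box (complex_to_vec l) (complex_to_vec u))"
    by (subst emeasure_distr) auto
  also have "\<dots> = (\<Prod>b\<in>Basis. (complex_to_vec u - complex_to_vec l) \<bullet> b)"
    by (rule emeasure_lborel_box) (use le in auto)
  also have "(\<Prod>b\<in>Basis. (complex_to_vec u - complex_to_vec l) \<bullet> b) = (\<Prod>b\<in>Basis. (u - l) \<bullet> b)"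
  proof -
    have "axis 1 1 \<noteq> (axis 2 1 :: real^2)" by (simp add: axis_eq_axis)
    then show ?thesis
      by (simp add: Basis_vec_def UNIV_2 Basis_complex_def complex_to_vec_def inner_axis)
  qed
  finally show "emeasure (distr lborel borel vec_to_complex) (box l u) = (\<Prod>b\<in>Basis. (u - l) \<bullet> b)" .
qed simp

lemma nn_integral_lborel_complex:
  assumes [measurable]: "f \<in> borel_measurable borel"
  shows "(\<integral>\<^sup>+z. f z \<partial>lborel) = (\<integral>\<^sup>+v. f (vec_to_complex v) \<partial>lborel)"
  by (subst lborel_complex_eq_distr, subst nn_integral_distr) auto

text \<open>The Jacobian determinant of multiplication by \<open>g' z\<close> on the real plane is \<open>|g' z|\<^sup>2\<close>.\<close>

theorem nn_integral_change_of_variables_complex: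
  fixes g :: "complex \<Rightarrow> complex" and f :: "complex \<Rightarrow> real"
  assumes S: "S \<in> sets borel"
    and der: "\<And>z. z \<in> S \<Longrightarrow> (g has_field_derivative g' z) (at z)"
    and inj: "inj_on g S"
    and nonneg: "\<And>z. 0 \<le> f z"
    and m1: "(\<lambda>z. indicator (g ` S) z * f z) \<in> borel_measurable borel"
    and m2: "(\<lambda>z. indicator S z * ((cmod (g' z))\<^sup>2 * f (g z))) \<in> borel_measurable borel"
  shows "(\<integral>\<^sup>+z. ennreal (indicator (g ` S) z * f z) \<partial>lborel) =
         (\<integral>\<^sup>+z. ennreal (indicator S z * ((cmod (g' z))\<^sup>2 * f (g z))) \<partial>lborel)"
proof -
  let ?p = vec_to_complex and ?q = complex_to_vec
  let ?G = "\<lambda>v. ?q (g (?p v))"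
  let ?G' = "\<lambda>v w. ?q (g' (?p v) * ?p w)"
  let ?S = "?p -` S"
  have S': "?S \<in> sets borel" using measurable_sets_borel[OF measurable_vec_to_complex S] by simp
  have img: "?p x \<in> g ` S \<longleftrightarrow> x \<in> ?G ` ?S" for x
  proof
    assume "?p x \<in> g ` S"
    then obtain z where z: "z \<in> S" "?p x = g z" by blast
    then have e: "x = ?G (?q z)" by (metis vec_to_complex_to_vec)
    show "x \<in> ?G ` ?S" unfolding image_iff by (rule bexI[of _ "?q z"]) (use e z(1) in simp_all)
  qed auto
  have der': "(?G has_derivative ?G' x) (at x within ?S)" if "x \<in> ?S" for x
  proof -
    have p: "(?p has_derivative ?p) (at x within ?S)"
      using linear_vec_to_complex by (simp add: linear_imp_has_derivative)
    have "(g has_derivative (\<lambda>h. g' (?p x) * h)) (at (?p x))"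
      using der[of "?p x"] that by (simp add: has_field_derivative_def)
    from has_derivative_compose[OF p this]
    have "((\<lambda>v. g (?p v)) has_derivative (\<lambda>h. g' (?p x) * ?p h)) (at x within ?S)" .
    from linear_imp_has_derivative[OF linear_complex_to_vec] this show ?thesis
      by (rule has_derivative_compose[rotated])
  qed
  have det: "\<bar>det (matrix (?G' x))\<bar> = (cmod (g' (?p x)))\<^sup>2" for x
  proof -
    have "det (matrix (?G' x)) = (cmod (g' (?p x)))\<^sup>2"
      unfolding cmod_power2
      by (simp add: det_2 matrix_def complex_to_vec_def vec_to_complex_def axis_def power2_eq_square)
    then show ?thesis by simp
  qed
  have inj': "inj_on ?G ?S"
    using inj unfolding inj_on_def by (metis vec_to_complex_to_vec(1) vec_to_complex_to_vec(2) vimage_eq)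
  have "(\<integral>\<^sup>+z. ennreal (indicator (g ` S) z * f z) \<partial>lborel) =
        (\<integral>\<^sup>+v. ennreal (indicator (g ` S) (?p v) * f (?p v)) \<partial>lborel)"
    using m1 by (intro nn_integral_lborel_complex) auto
  also have "\<dots> = (\<integral>\<^sup>+v. ennreal (indicator (?G ` ?S) v * f (?p v)) \<partial>lborel)"
    by (intro nn_integral_cong) (auto simp: indicator_def img)
  also have "\<dots> = (\<integral>\<^sup>+v. ennreal (indicator ?S v * (\<bar>det (matrix (?G' v))\<bar> * f (?p (?G v)))) \<partial>lborel)"
  proof (rule nn_integral_change_of_variables_vec2[OF S' der' inj'])
    have "(\<lambda>x. indicator (?G ` ?S) x * f (?p x)) = (\<lambda>z. indicator (g ` S) z * f z) \<circ> ?p"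
      by (auto simp: indicator_def img fun_eq_iff)
    then show "(\<lambda>x. indicator (?G ` ?S) x * f (?p x)) \<in> borel_measurable borel"
      using measurable_comp[OF measurable_vec_to_complex m1] by simp
    have "(\<lambda>x. indicator ?S x * (\<bar>det (matrix (?G' x))\<bar> * f (?p (?G x)))) =
       (\<lambda>z. indicator S z * ((cmod (g' z))\<^sup>2 * f (g z))) \<circ> ?p"
      by (auto simp: indicator_def det fun_eq_iff)
    then show "(\<lambda>x. indicator ?S x * (\<bar>det (matrix (?G' x))\<bar> * f (?p (?G x)))) \<in> borel_measurable borel"
      using measurable_comp[OF measurable_vec_to_complex m2] by simp
  qed (use nonneg in auto)
  also have "\<dots> = (\<integral>\<^sup>+v. ennreal (indicator S (?p v) * ((cmod (g' (?p v)))\<^sup>2 * f (g (?p v)))) \<partial>lborel)"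
    by (intro nn_integral_cong) (auto simp: indicator_def det)
  also have "\<dots> = (\<integral>\<^sup>+z. ennreal (indicator S z * ((cmod (g' z))\<^sup>2 * f (g z))) \<partial>lborel)"
    using m2 by (intro nn_integral_lborel_complex[symmetric]) auto
  finally show ?thesis .
qed

section \<open>Weighted area and its moments\<close>

lemma emeasure_complex_ball: "0 \<le> R \<Longrightarrow> emeasure lborel (ball (z::complex) R) = ennreal (pi * R\<^sup>2)"
  by (simp add: emeasure_ball unit_ball_vol_2)

lemma sets_weighted_area [simp, measurable_cong]: "sets (weighted_area \<beta>) = sets lebesgue"
  and space_weighted_area [simp]: "space (weighted_area \<beta>) = UNIV"
  and sets_disk_area [simp, measurable_cong]: "sets disk_area = sets lebesgue"
  and space_disk_area [simp]: "space disk_area = UNIV"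
  by (simp_all add: weighted_area_def disk_area_def)

lemma borel_imp_measurable_weighted_area:
  assumes "f \<in> borel_measurable borel"
  shows "f \<in> borel_measurable (weighted_area \<beta>)" "f \<in> borel_measurable disk_area"
proof -
  have "f \<in> borel_measurable lborel" using assms by (simp only: measurable_lborel2)
  then have f: "f \<in> borel_measurable lebesgue" by (rule measurable_completion)
  show "f \<in> borel_measurable (weighted_area \<beta>)"
    by (subst measurable_cong_sets[OF sets_weighted_area refl]) (rule f)
  show "f \<in> borel_measurable disk_area"
    by (subst measurable_cong_sets[OF sets_disk_area refl]) (rule f)
qed

lemma measurable_disk_weight [measurable]:
  "(\<lambda>z. indicator unit_disk z * (1 - (cmod z)\<^sup>2) powr \<beta> :: real) \<in> borel_measurable borel"
  proof -
  have "(\<lambda>z::complex. (1 - (cmod z)\<^sup>2) powr \<beta>) \<in> borel_measurable borel" by measurable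
  then show ?thesis by (intro borel_measurable_times borel_measurable_indicator) auto
qed

lemma nn_integral_disk_area:
  assumes f: "f \<in> borel_measurable borel"
  shows "(\<integral>\<^sup>+z. f z \<partial>disk_area) = ennreal (1 / pi) * (\<integral>\<^sup>+z. f z * indicator unit_disk z \<partial>lborel)"
proof -
  have "(\<integral>\<^sup>+z. f z \<partial>disk_area) = (\<integral>\<^sup>+z. f z * indicator unit_disk z \<partial>lebesgue) / emeasure lebesgue unit_disk"
    unfolding disk_area_def using f by (intro nn_integral_uniform_measure) (auto simp: measurable_completion)
  also have "\<dots> = (\<integral>\<^sup>+z. f z * indicator unit_disk z \<partial>lborel) / ennreal pi"
    using emeasure_complex_ball[of 1 0] by (simp add: nn_integral_completion)
  also have "\<dots> = ennreal (1 / pi) * (\<integral>\<^sup>+z. f z * indicator unit_disk z \<partial>lborel)"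
    by (simp add: divide_ennreal_def inverse_ennreal mult.commute inverse_eq_divide)
  finally show ?thesis .
qed

lemma nn_integral_weighted_area:
  assumes f[measurable]: "f \<in> borel_measurable borel" and b: "-1 < \<beta>"
  shows "(\<integral>\<^sup>+z. f z \<partial>weighted_area \<beta>) =
     ennreal ((1 + \<beta>) / pi) * (\<integral>\<^sup>+z. ennreal (indicator unit_disk z * (1 - (cmod z)\<^sup>2) powr \<beta>) * f z \<partial>lborel)"
proof -
  have [measurable]: "(\<lambda>z. (1 - (cmod z)\<^sup>2) powr \<beta>) \<in> borel_measurable borel" by measurable
  have [measurable]: "f \<in> borel_measurable disk_area" by (rule borel_imp_measurable_weighted_area[OF f])
  have "(\<integral>\<^sup>+z. f z \<partial>weighted_area \<beta>) =
     (\<integral>\<^sup>+z. ennreal ((1 + \<beta>) * (1 - (cmod z)\<^sup>2) powr \<beta>) * f z \<partial>disk_area)"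
    unfolding weighted_area_def by (subst nn_integral_density) (auto intro: borel_imp_measurable_weighted_area)
  also have "\<dots> = ennreal (1 / pi) * (\<integral>\<^sup>+z. ennreal ((1 + \<beta>) * (1 - (cmod z)\<^sup>2) powr \<beta>) * f z * indicator unit_disk z \<partial>lborel)"
    by (rule nn_integral_disk_area) measurable
  also have "\<dots> = ennreal (1 / pi) * (\<integral>\<^sup>+z. ennreal (1 + \<beta>) * (ennreal (indicator unit_disk z * (1 - (cmod z)\<^sup>2) powr \<beta>) * f z) \<partial>lborel)"
    using b by (intro arg_cong[where f="\<lambda>x. ennreal (1 / pi) * x"] nn_integral_cong)
      (auto simp: indicator_def ennreal_mult mult_ac)
  also have "\<dots> = ennreal (1 / pi) * (ennreal (1 + \<beta>) * (\<integral>\<^sup>+z. (ennreal (indicator unit_disk z * (1 - (cmod z)\<^sup>2) powr \<beta>) * f z) \<partial>lborel))"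
    by (rule arg_cong[where f="\<lambda>x. ennreal (1 / pi) * x"], rule nn_integral_cmult, unfold measurable_lborel2, measurable)
  also have "\<dots> = ennreal ((1 + \<beta>) / pi) * (\<integral>\<^sup>+z. (ennreal (indicator unit_disk z * (1 - (cmod z)\<^sup>2) powr \<beta>) * f z) \<partial>lborel)"
    using b by (simp add: mult.assoc[symmetric] ennreal_mult[symmetric])
  finally show ?thesis .
qed

lemma AE_weighted_area_disk: "AE z in weighted_area \<beta>. z \<in> unit_disk"
proof -
  have "AE z in disk_area. z \<in> unit_disk"
    unfolding disk_area_def by (rule AE_uniform_measureI) auto
  then show ?thesis
    unfolding weighted_area_def
    by (subst AE_density) (auto intro!: borel_imp_measurable_weighted_area)
qed

lemma measurable_indicator_unit_disk [measurable]:
  "(indicator unit_disk :: complex \<Rightarrow> ennreal) \<in> borel_measurable borel"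
  by (rule borel_measurable_indicator) simp

text \<open>The area of an annulus depends linearly on the squares of its radii, so \<open>|z|\<^sup>2\<close> is uniformly
  distributed on \<open>(0, 1)\<close>. This takes the place of polar coordinates.\<close>

lemma distr_norm_square_unit_disk:
  "distr (density lborel (indicator unit_disk)) borel (\<lambda>z::complex. (cmod z)\<^sup>2) =
   density lborel (\<lambda>t::real. ennreal pi * indicator {0<..<1} t)" (is "?N = ?L")
proof (rule measure_eqI_lessThan)
  have N: "emeasure ?N {x<..} = emeasure lborel {z \<in> unit_disk. x < (cmod z)\<^sup>2}" for x
  proof -
    have A: "{z \<in> unit_disk. x < (cmod z)\<^sup>2} \<in> sets lborel"
      unfolding Collect_conj_eq Collect_mem_eq sets_lborel
      by (intro borel_open open_Int open_ball open_Collect_less continuous_intros)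
    have "emeasure ?N {x<..} = emeasure (density lborel (indicator unit_disk)) {z::complex. x < (cmod z)\<^sup>2}"
      by (subst emeasure_distr) (auto simp: vimage_def)
    also have "\<dots> = (\<integral>\<^sup>+z. indicator unit_disk z * indicator {z::complex. x < (cmod z)\<^sup>2} z \<partial>lborel)"
      by (rule emeasure_density) auto
    also have "\<dots> = (\<integral>\<^sup>+z. indicator {z \<in> unit_disk. x < (cmod z)\<^sup>2} z \<partial>lborel)"
      by (intro nn_integral_cong) (auto simp: indicator_def)
    also have "\<dots> = emeasure lborel {z \<in> unit_disk. x < (cmod z)\<^sup>2}"
      by (rule nn_integral_indicator[OF A])
    finally show ?thesis .
  qed
  have L: "emeasure ?L {x<..} = ennreal pi * emeasure lborel ({0<..<1} \<inter> {x<..})" for x :: real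
  proof -
    have "emeasure ?L {x<..} = (\<integral>\<^sup>+t. ennreal pi * indicator ({0<..<1} \<inter> {x<..}) t \<partial>lborel)"
      by (subst emeasure_density) (auto intro!: nn_integral_cong simp: indicator_def)
    then show ?thesis by (simp add: nn_integral_cmult)
  qed
  show eq: "emeasure ?N {x<..} = emeasure ?L {x<..}" for x :: real
  proof -
    consider "x < 0" | "0 \<le> x" "x < 1" | "1 \<le> x" by linarith
    then show ?thesis
    proof cases
      case 1
      then have "{z \<in> unit_disk. x < (cmod z)\<^sup>2} = unit_disk"
        by (auto intro: less_le_trans[of _ 0])
      moreover have "{0<..<1} \<inter> {x<..} = {0<..<1}" using 1 by auto
      ultimately show ?thesis unfolding N L using emeasure_complex_ball[of 1 0] by simp
    next
      case 2
      have "{z \<in> unit_disk. x < (cmod z)\<^sup>2} = unit_disk - cball 0 (sqrt x)"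
        using 2 by (auto simp: not_le) (metis abs_norm_cancel real_less_rsqrt real_sqrt_abs real_sqrt_less_iff not_le)+
      moreover have "emeasure lborel (unit_disk - cball (0::complex) (sqrt x)) =
          emeasure lborel unit_disk - emeasure lborel (cball (0::complex) (sqrt x))"
        using 2 by (intro emeasure_Diff) (auto simp: emeasure_cball, smt (verit) real_sqrt_less_iff real_sqrt_one)
      moreover have "emeasure lborel (cball (0::complex) (sqrt x)) = ennreal (pi * x)"
        using 2 by (simp add: emeasure_cball unit_ball_vol_2)
      moreover have "{0<..<1} \<inter> {x<..} = {x<..<1}" using 2 by auto
      ultimately show ?thesis unfolding N L using emeasure_complex_ball[of 1 0] 2
        by (simp add: ennreal_minus ennreal_mult[symmetric] algebra_simps)
    next
      case 3
      have "{z \<in> unit_disk. x < (cmod z)\<^sup>2} = {}"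
        using 3 by (auto simp: not_less) (smt (verit) norm_ge_zero power_le_one)
      moreover have "{0<..<1} \<inter> {x<..} = {}" using 3 by auto
      ultimately show ?thesis unfolding N L by (simp only: emeasure_empty mult_zero_right)
    qed
  qed
  show "emeasure ?N {x<..} < \<infinity>" for x :: real
  proof -
    have "emeasure lborel ({0<..<1} \<inter> {x<..}) \<le> emeasure lborel {0<..<1::real}"
      by (rule emeasure_mono) auto
    then have "emeasure lborel ({0<..<1} \<inter> {x<..}) < top"
      by (auto intro: le_less_trans)
    then show ?thesis unfolding eq L by (simp add: ennreal_mult_less_top)
  qed
qed simp_all

lemma nn_integral_radial_unit_disk:
  fixes h :: "real \<Rightarrow> ennreal"
  assumes [measurable]: "h \<in> borel_measurable borel"
  shows "(\<integral>\<^sup>+z. indicator unit_disk z * h ((cmod z)\<^sup>2) \<partial>lborel) =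
         ennreal pi * (\<integral>\<^sup>+t. indicator {0<..<1} t * h t \<partial>lborel)"
proof -
  have "(\<integral>\<^sup>+z. indicator unit_disk z * h ((cmod z)\<^sup>2) \<partial>lborel) =
    (\<integral>\<^sup>+z. h ((cmod z)\<^sup>2) \<partial>density lborel (indicator unit_disk))"
    by (subst nn_integral_density) auto
  also have "\<dots> = (\<integral>\<^sup>+t. h t \<partial>distr (density lborel (indicator unit_disk)) borel (\<lambda>z::complex. (cmod z)\<^sup>2))"
    by (subst nn_integral_distr) auto
  also have "\<dots> = (\<integral>\<^sup>+t. ennreal pi * (indicator {0<..<1} t * h t) \<partial>lborel)"
    unfolding distr_norm_square_unit_disk by (subst nn_integral_density) (auto simp: mult_ac)
  also have "\<dots> = ennreal pi * (\<integral>\<^sup>+t. indicator {0<..<1} t * h t \<partial>lborel)"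
    by (rule nn_integral_cmult) auto
  finally show ?thesis .
qed

text \<open>The integral of \<open>|z| ^ (2 * n)\<close> with respect to the weighted area of exponent \<open>\<beta>\<close>. Its reciprocal
  is the coefficient of \<open>x ^ n\<close> in the binomial series of \<open>(1 - x) powr -(\<beta> + 2)\<close>.\<close>

definition bergman_moment :: "real \<Rightarrow> nat \<Rightarrow> real" where
  "bergman_moment \<beta> n = fact n / pochhammer (\<beta> + 2) n"

lemma bergman_moment_pos: "-1 < \<beta> \<Longrightarrow> 0 < bergman_moment \<beta> n"
  by (simp add: bergman_moment_def pochhammer_pos)

lemma bergman_moment_0 [simp]: "bergman_moment \<beta> 0 = 1"
  by (simp add: bergman_moment_def)

text \<open>In the variable \<open>t = |z|\<^sup>2\<close> this is a Beta integral.\<close>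

lemma nn_integral_moment:
  assumes b: "-1 < \<beta>"
  shows "(\<integral>\<^sup>+z. ennreal (cmod z ^ (2 * n)) \<partial>weighted_area \<beta>) = ennreal (bergman_moment \<beta> n)"
proof -
  let ?h = "\<lambda>t::real. t ^ n * (1 - t) powr \<beta>"
  have "(\<integral>\<^sup>+z. ennreal (cmod z ^ (2 * n)) \<partial>weighted_area \<beta>) =
    ennreal ((1 + \<beta>) / pi) * (\<integral>\<^sup>+z. indicator unit_disk z * ennreal (?h ((cmod z)\<^sup>2)) \<partial>lborel)"
    using b by (subst nn_integral_weighted_area)
      (auto intro!: arg_cong[where f="\<lambda>x. _ * x"] nn_integral_cong simp: indicator_def ennreal_mult[symmetric] power_mult mult.commute[of "_ powr _"])
  also have "(\<integral>\<^sup>+z. indicator unit_disk z * ennreal (?h ((cmod z)\<^sup>2)) \<partial>lborel) =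
      ennreal pi * (\<integral>\<^sup>+t. indicator {0<..<1} t * ennreal (?h t) \<partial>lborel)"
    by (rule nn_integral_radial_unit_disk) measurable
  also have "(\<integral>\<^sup>+t. indicator {0<..<1} t * ennreal (?h t) \<partial>lborel) = ennreal (Beta (real n + 1) (\<beta> + 1))"
  proof -
    have "((\<lambda>t. t powr (real n + 1 - 1) * (1 - t) powr (\<beta> + 1 - 1)) has_integral Beta (real n + 1) (\<beta> + 1)) {0..1}"
      using b by (intro has_integral_Beta_real) auto
    then have "((\<lambda>t. t powr (real n + 1 - 1) * (1 - t) powr (\<beta> + 1 - 1)) has_integral Beta (real n + 1) (\<beta> + 1)) {0<..<1}"
      by (simp add: has_integral_Icc_iff_Ioo)
    then have "(?h has_integral Beta (real n + 1) (\<beta> + 1)) {0<..<1}"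
      by (rule has_integral_eq[rotated]) (simp add: powr_realpow)
    from nn_integral_has_integral_lebesgue[OF _ this]
    have "(\<integral>\<^sup>+t. ennreal (indicator {0<..<1} t * ?h t) \<partial>lborel) = ennreal (Beta (real n + 1) (\<beta> + 1))"
      by simp
    then show ?thesis by (simp add: ennreal_mult' ennreal_indicator)
  qed
  also have "ennreal ((1 + \<beta>) / pi) * (ennreal pi * ennreal (Beta (real n + 1) (\<beta> + 1))) =
     ennreal ((1 + \<beta>) * Beta (real n + 1) (\<beta> + 1))"
    using b by (simp add: mult.assoc[symmetric] ennreal_mult[symmetric]) (simp add: ennreal_mult'[symmetric])
  also have "(1 + \<beta>) * Beta (real n + 1) (\<beta> + 1) = bergman_moment \<beta> n"
  proof -
    have nz: "\<beta> + 1 \<notin> \<int>\<^sub>\<le>\<^sub>0" "\<beta> + 2 \<notin> \<int>\<^sub>\<le>\<^sub>0" using b by (auto elim!: nonpos_Ints_cases)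
    have "Gamma (\<beta> + 2) = (\<beta> + 1) * Gamma (\<beta> + 1)"
      using Gamma_plus1[OF nz(1)] by (simp add: add.assoc)
    moreover have "Gamma (real n + 1) = fact n" by (metis Gamma_fact add.commute)
    moreover have "pochhammer (\<beta> + 2) n = Gamma (\<beta> + 2 + real n) / Gamma (\<beta> + 2)"
      by (rule pochhammer_Gamma[OF nz(2)])
    moreover have "real n + 1 + (\<beta> + 1) = \<beta> + 2 + real n" by simp
    ultimately show ?thesis by (simp add: Beta_def bergman_moment_def field_simps)
  qed
  finally show ?thesis .
qed

lemma emeasure_weighted_area_UNIV: "-1 < \<beta> \<Longrightarrow> emeasure (weighted_area \<beta>) UNIV = 1"
  using nn_integral_moment[of \<beta> 0] by simp

lemma finite_measure_weighted_area: "-1 < \<beta> \<Longrightarrow> finite_measure (weighted_area \<beta>)"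
  by (rule finite_measureI) (simp add: emeasure_weighted_area_UNIV)

lemma distr_rotation_weighted_area:
  assumes b: "-1 < \<beta>"
  shows "distr (weighted_area \<beta>) borel (\<lambda>z. cis \<theta> * z) = distr (weighted_area \<beta>) borel (\<lambda>z. z)"
proof (rule measure_eqI)
  fix A assume "A \<in> sets (distr (weighted_area \<beta>) borel (\<lambda>z. cis \<theta> * z))"
  then have A[measurable]: "A \<in> sets borel" by simp
  let ?w = "\<lambda>z. indicator unit_disk z * (1 - (cmod z)\<^sup>2) powr \<beta> * indicator A z"
  have inj: "inj_on (\<lambda>z. cis \<theta> * z) UNIV" by (auto simp: inj_on_def)
  have surj: "range (\<lambda>z. cis \<theta> * z) = UNIV"
    by (rule surjI[where f="\<lambda>z. cis (-\<theta>) * z"]) (simp add: mult.assoc[symmetric] cis_mult)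
  have [measurable]: "(\<lambda>z. (1 - (cmod z)\<^sup>2) powr \<beta>) \<in> borel_measurable borel" by measurable
  have m: "?w \<in> borel_measurable borel" by measurable
  have m2: "(\<lambda>z. ?w (cis \<theta> * z)) \<in> borel_measurable borel" by measurable
  have "(\<integral>\<^sup>+z. ennreal (indicator (range (\<lambda>z. cis \<theta> * z)) z * ?w z) \<partial>lborel) =
        (\<integral>\<^sup>+z. ennreal (indicator UNIV z * ((cmod (cis \<theta>))\<^sup>2 * ?w (cis \<theta> * z))) \<partial>lborel)"
  proof (rule nn_integral_change_of_variables_complex[where g'="\<lambda>_. cis \<theta>"])
    show "((\<lambda>z. cis \<theta> * z) has_field_derivative cis \<theta>) (at z)" for z
      by (auto intro!: derivative_eq_intros)
  qed (use inj m m2 surj in \<open>auto simp: mult_ac\<close>)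
  then have eq: "(\<integral>\<^sup>+z. ennreal (?w z) \<partial>lborel) = (\<integral>\<^sup>+z. ennreal (?w (cis \<theta> * z)) \<partial>lborel)"
    using surj by simp
  have d: "(cis \<theta> * z \<in> unit_disk) = (z \<in> unit_disk)" for z by (simp add: norm_mult)
  have em: "emeasure (distr (weighted_area \<beta>) borel g) A = ennreal ((1 + \<beta>) / pi) *
      (\<integral>\<^sup>+z. ennreal (indicator unit_disk z * (1 - (cmod z)\<^sup>2) powr \<beta> * indicator A (g z)) \<partial>lborel)"
    if [measurable]: "g \<in> borel_measurable borel" for g
  proof -
    have mg: "g \<in> measurable (weighted_area \<beta>) borel" by (rule borel_imp_measurable_weighted_area) fact
    have "emeasure (distr (weighted_area \<beta>) borel g) A = (\<integral>\<^sup>+z. indicator A z \<partial>distr (weighted_area \<beta>) borel g)"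
      by simp
    also have "\<dots> = (\<integral>\<^sup>+z. indicator A (g z) \<partial>weighted_area \<beta>)"
      using mg by (subst nn_integral_distr) auto
    also have "\<dots> = ennreal ((1 + \<beta>) / pi) *
      (\<integral>\<^sup>+z. ennreal (indicator unit_disk z * (1 - (cmod z)\<^sup>2) powr \<beta>) * indicator A (g z) \<partial>lborel)"
      by (rule nn_integral_weighted_area) (use b in measurable)
    finally show ?thesis
      by (simp add: ennreal_mult'' ennreal_indicator)
  qed
  show "emeasure (distr (weighted_area \<beta>) borel (\<lambda>z. cis \<theta> * z)) A =
    emeasure (distr (weighted_area \<beta>) borel (\<lambda>z. z)) A"
    using eq em[of "\<lambda>z. z"] em[of "\<lambda>z. cis \<theta> * z"] by (simp add: norm_mult indicator_def d)
qed simp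

lemma integral_rotation_weighted_area:
  fixes F :: "complex \<Rightarrow> complex"
  assumes b: "-1 < \<beta>" and F[measurable]: "F \<in> borel_measurable borel"
  shows "(\<integral>z. F (cis \<theta> * z) \<partial>weighted_area \<beta>) = (\<integral>z. F z \<partial>weighted_area \<beta>)"
proof -
  have m: "(\<lambda>z. cis \<theta> * z) \<in> borel_measurable (weighted_area \<beta>)"
    "(\<lambda>z. z) \<in> borel_measurable (weighted_area \<beta>)"
    by (rule borel_imp_measurable_weighted_area, simp)+
  show ?thesis
    using integral_distr[OF m(1) F] integral_distr[OF m(2) F] distr_rotation_weighted_area[OF b] by simp
qed

text \<open>Rotating by the angle \<open>\<pi> / (m - n)\<close> changes the sign of the integrand but not the integral.\<close>

lemma integral_monomials_orthogonal:
  assumes b: "-1 < \<beta>" and "m \<noteq> n"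
  shows "(LINT z:ball 0 R|weighted_area \<beta>. z ^ m * cnj z ^ n) = 0"
proof -
  let ?F = "\<lambda>z::complex. indicator (ball 0 R) z *\<^sub>R (z ^ m * cnj z ^ n)"
  define \<theta> where "\<theta> = pi / (real m - real n)"
  have "(real m - real n) * \<theta> = pi" using assms by (simp add: \<theta>_def)
  then have "real m * \<theta> - real n * \<theta> = pi" by (simp add: algebra_simps)
  then have c: "cis \<theta> ^ m * cnj (cis \<theta>) ^ n = -1"
  proof -
    have "cis \<theta> ^ m * cnj (cis \<theta>) ^ n = cis (real m * \<theta> - real n * \<theta>)"
      by (simp only: Complex.DeMoivre cis_cnj cis_mult mult_minus_right diff_conv_add_uminus)
    then show ?thesis using \<open>real m * \<theta> - real n * \<theta> = pi\<close> by simp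
  qed
  have "?F (cis \<theta> * z) = - ?F z" for z
  proof -
    have "(cis \<theta> * z) ^ m * cnj (cis \<theta> * z) ^ n = (cis \<theta> ^ m * cnj (cis \<theta>) ^ n) * (z ^ m * cnj z ^ n)"
      by (simp add: power_mult_distrib)
    then show ?thesis unfolding c by (simp add: indicator_def norm_mult)
  qed
  moreover have "?F \<in> borel_measurable borel"
    by (intro borel_measurable_continuous_on_indicator continuous_intros) auto
  ultimately have "- (\<integral>z. ?F z \<partial>weighted_area \<beta>) = (\<integral>z. ?F z \<partial>weighted_area \<beta>)"
    using integral_rotation_weighted_area[OF b, of ?F \<theta>] by simp
  then have "(\<integral>z. ?F z \<partial>weighted_area \<beta>) = 0" by (simp add: complex_eq_iff)
  then show ?thesis by (simp add: set_lebesgue_integral_def)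
qed

section \<open>Parseval identity for power series on the disk\<close>

lemma borel_ball_complex [measurable]: "ball (a::complex) R \<in> sets borel"
  by simp

lemma measurable_continuous_on_weighted_area:
  fixes f :: "complex \<Rightarrow> 'a::real_normed_vector"
  assumes "continuous_on (ball 0 R) f"
  shows "(\<lambda>z. indicator (ball 0 R) z *\<^sub>R f z) \<in> borel_measurable (weighted_area \<beta>)"
  by (intro borel_imp_measurable_weighted_area borel_measurable_continuous_on_indicator)
    (use assms in auto)

lemma set_integrable_bounded_weighted_area:
  fixes f :: "complex \<Rightarrow> 'a::{banach,second_countable_topology}"
  assumes "-1 < \<beta>" "continuous_on (ball 0 R) f" "\<And>z. z \<in> ball 0 R \<Longrightarrow> norm (f z) \<le> C"
  shows "set_integrable (weighted_area \<beta>) (ball 0 R) f"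
proof -
  interpret finite_measure "weighted_area \<beta>" by (rule finite_measure_weighted_area) fact
  show ?thesis unfolding set_integrable_def
  proof (rule integrable_const_bound[where B="max C 0"])
    show "AE z in weighted_area \<beta>. norm (indicator (ball 0 R) z *\<^sub>R f z) \<le> max C 0"
      using assms(3) by (intro always_eventually) (auto simp: indicator_def intro: le_max_iff_disj[THEN iffD2])
  qed (use measurable_continuous_on_weighted_area assms in blast)
qed

lemma measure_weighted_area_UNIV: "-1 < \<beta> \<Longrightarrow> measure (weighted_area \<beta>) UNIV = 1"
  by (simp add: measure_def emeasure_weighted_area_UNIV)

lemma norm_set_integral_le_const:
  fixes f :: "complex \<Rightarrow> 'a::{banach,second_countable_topology}"
  assumes b: "-1 < \<beta>" and f: "set_integrable (weighted_area \<beta>) A f"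
    and C: "\<And>z. z \<in> A \<Longrightarrow> norm (f z) \<le> C" "0 \<le> C"
  shows "norm (LINT z:A|weighted_area \<beta>. f z) \<le> C"
    and "(\<integral>z. norm (indicator A z *\<^sub>R f z) \<partial>weighted_area \<beta>) \<le> C"
proof -
  interpret finite_measure "weighted_area \<beta>" by (rule finite_measure_weighted_area) fact
  have "(\<integral>z. norm (indicator A z *\<^sub>R f z) \<partial>weighted_area \<beta>) \<le> (\<integral>z. C \<partial>weighted_area \<beta>)"
  proof (rule integral_mono)
    show "integrable (weighted_area \<beta>) (\<lambda>z. norm (indicator A z *\<^sub>R f z))"
      using f unfolding set_integrable_def by (rule integrable_norm)
  qed (use C in \<open>auto simp: indicator_def\<close>)
  then show *: "(\<integral>z. norm (indicator A z *\<^sub>R f z) \<partial>weighted_area \<beta>) \<le> C"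
    using measure_weighted_area_UNIV[OF b] by simp
  show "norm (LINT z:A|weighted_area \<beta>. f z) \<le> C"
    unfolding set_lebesgue_integral_def by (rule order_trans[OF integral_norm_bound *])
qed

context
  fixes g :: "complex \<Rightarrow> complex" and b :: "nat \<Rightarrow> complex" and \<beta> :: real
  assumes sums: "\<And>z. z \<in> unit_disk \<Longrightarrow> (\<lambda>n. b n * z ^ n) sums g z"
    and \<beta>: "-1 < \<beta>"
begin

lemma power_series_disk_summable_norm:
  assumes "0 \<le> R" "R < 1"
  shows "summable (\<lambda>n. cmod (b n) * R ^ n)"
proof -
  have "summable (\<lambda>n. b n * complex_of_real ((R + 1) / 2) ^ n)"
    using sums[of "complex_of_real ((R + 1) / 2)"] assms by (auto simp: sums_iff norm_divide simp del: of_real_divide)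
  then have "summable (\<lambda>n. norm (b n * complex_of_real R ^ n))"
    by (rule powser_insidea) (use assms in \<open>auto simp: norm_divide simp del: of_real_divide\<close>)
  then show ?thesis using assms by (simp add: norm_mult norm_power)
qed

lemma power_series_disk_holomorphic: "g holomorphic_on unit_disk"
proof -
  have "g analytic_on unit_disk \<or> g holomorphic_on unit_disk"
    using power_series_holomorphic[of 0 1 b g] sums by simp
  then show ?thesis by (auto intro: analytic_imp_holomorphic)
qed

lemma power_series_disk_norm_le:
  assumes "0 \<le> R" "R < 1" "z \<in> ball 0 R"
  shows "cmod (g z) \<le> (\<Sum>n. cmod (b n) * R ^ n)"
proof -
  have z: "z \<in> unit_disk" using assms by auto
  have le: "norm (b n * z ^ n) \<le> cmod (b n) * R ^ n" for n
    using assms by (auto simp: norm_mult norm_power intro!: mult_left_mono power_mono)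
  have "summable (\<lambda>n. norm (b n * z ^ n))"
    by (rule summable_comparison_test'[OF power_series_disk_summable_norm[OF assms(1,2)]]) (use le in auto)
  then have "cmod (\<Sum>n. b n * z ^ n) \<le> (\<Sum>n. norm (b n * z ^ n))" by (rule summable_norm)
  also have "\<dots> \<le> (\<Sum>n. cmod (b n) * R ^ n)"
    by (intro suminf_le le power_series_disk_summable_norm[OF assms(1,2)]) fact
  finally show ?thesis using sums[OF z] by (simp add: sums_iff)
qed

text \<open>On a disk of radius less than one the series converges uniformly and can be integrated term by
  term.\<close>

lemma integral_power_series_times:
  assumes R: "0 \<le> R" "R < 1" and h: "continuous_on (ball 0 R) h" "\<And>z. z \<in> ball 0 R \<Longrightarrow> cmod (h z) \<le> C"
  shows "(\<lambda>n. b n * (LINT z:ball 0 R|weighted_area \<beta>. z ^ n * h z)) sums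
         (LINT z:ball 0 R|weighted_area \<beta>. g z * h z)"
proof -
  let ?M = "weighted_area \<beta>" and ?B = "ball (0::complex) R"
  let ?f = "\<lambda>n z. indicator ?B z *\<^sub>R (b n * z ^ n * h z)"
  define C' where "C' = max C 0"
  have C': "cmod (h z) \<le> C'" "0 \<le> C'" if "z \<in> ?B" for z using h(2)[OF that] by (auto simp: C'_def)
  have C'0: "0 \<le> C'" by (simp add: C'_def)
  have bd: "norm (b n * z ^ n * h z) \<le> cmod (b n) * R ^ n * C'" if "z \<in> ?B" for n z
    using that R C'[OF that] by (auto simp: norm_mult norm_power intro!: mult_mono power_mono)
  have sm: "summable (\<lambda>n. cmod (b n) * R ^ n * C')"
    by (intro summable_mult2 power_series_disk_summable_norm R)
  have cont: "continuous_on ?B (\<lambda>z. b n * z ^ n * h z)" for n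
    by (intro continuous_intros h(1))
  have int: "set_integrable ?M ?B (\<lambda>z. b n * z ^ n * h z)" for n
    by (rule set_integrable_bounded_weighted_area[OF \<beta> cont bd])
  have sums_pt: "(\<lambda>n. ?f n z) sums (indicator ?B z *\<^sub>R (g z * h z))" for z
  proof (cases "z \<in> ?B")
    case True
    then have "(\<lambda>n. b n * z ^ n * h z) sums (g z * h z)"
      using R by (intro sums_mult2 sums) auto
    then show ?thesis using True by simp
  qed simp
  have "(\<lambda>n. integral\<^sup>L ?M (?f n)) sums (\<integral>z. (\<Sum>n. ?f n z) \<partial>?M)"
  proof (rule sums_integral)
    show "integrable ?M (?f n)" for n using int by (simp add: set_integrable_def)
    show "AE z in ?M. summable (\<lambda>n. norm (?f n z))"
      by (intro always_eventually allI summable_comparison_test'[OF sm])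
        (use bd R C'0 in \<open>auto simp: indicator_def\<close>)
    show "summable (\<lambda>n. \<integral>z. norm (?f n z) \<partial>?M)"
      by (rule summable_comparison_test'[OF sm])
        (use norm_set_integral_le_const(2)[OF \<beta> int bd] C'0 R in auto)
  qed
  moreover have "(\<lambda>z. \<Sum>n. ?f n z) = (\<lambda>z. indicator ?B z *\<^sub>R (g z * h z))"
    using sums_pt by (auto simp: sums_iff)
  moreover have "integral\<^sup>L ?M (?f n) = b n * (LINT z:?B|?M. z ^ n * h z)" for n
    unfolding set_lebesgue_integral_def
    by (subst integral_mult_right_zero[symmetric]) (simp add: mult_ac scaleR_conv_of_real)
  ultimately show ?thesis by (simp add: set_lebesgue_integral_def)
qed

lemma integral_power_series_monomial_ball:
  assumes R: "0 \<le> R" "R < 1"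
  shows "(LINT z:ball 0 R|weighted_area \<beta>. g z * cnj z ^ n) =
         b n * (LINT z:ball 0 R|weighted_area \<beta>. z ^ n * cnj z ^ n)"
proof -
  have "(\<lambda>m. b m * (LINT z:ball 0 R|weighted_area \<beta>. z ^ m * cnj z ^ n)) sums
         (LINT z:ball 0 R|weighted_area \<beta>. g z * cnj z ^ n)"
    by (rule integral_power_series_times[OF R, where C=1])
      (use R in \<open>auto intro!: continuous_intros power_le_one simp: norm_power\<close>)
  moreover have "(\<lambda>m. b m * (LINT z:ball 0 R|weighted_area \<beta>. z ^ m * cnj z ^ n)) =
     (\<lambda>m. if m = n then b n * (LINT z:ball 0 R|weighted_area \<beta>. z ^ n * cnj z ^ n) else 0)"
    by (auto simp: fun_eq_iff integral_monomials_orthogonal[OF \<beta>])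
  ultimately show ?thesis
    using sums_single[of n "\<lambda>m. b n * (LINT z:ball 0 R|weighted_area \<beta>. z ^ n * cnj z ^ n)"] sums_unique2
    by auto
qed

text \<open>Integrating \<open>g cnj g\<close> term by term in both factors leaves only the diagonal terms.\<close>

lemma nn_integral_power_series_square_ball:
  assumes R: "0 \<le> R" "R < 1"
  shows "(\<integral>\<^sup>+z. indicator (ball 0 R) z * ennreal ((cmod (g z))\<^sup>2) \<partial>weighted_area \<beta>) =
         (\<integral>\<^sup>+z. indicator (ball 0 R) z * (\<Sum>n. ennreal ((cmod (b n))\<^sup>2 * cmod z ^ (2 * n))) \<partial>weighted_area \<beta>)"
proof -
  let ?M = "weighted_area \<beta>" and ?B = "ball (0::complex) R"
  define c where "c n = (LINT z:?B|?M. cmod z ^ (2 * n))" for n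
  define G where "G = (\<Sum>n. cmod (b n) * R ^ n)"
  have sub: "?B \<subseteq> unit_disk" using R by auto
  have cg: "continuous_on ?B g"
    using holomorphic_on_imp_continuous_on[OF power_series_disk_holomorphic] sub continuous_on_subset by blast
  have zz: "z ^ n * cnj z ^ n = complex_of_real (cmod z ^ (2 * n))" for z n
    by (metis complex_norm_square of_real_power power_mult power_mult_distrib)
  have cc: "(LINT z:?B|?M. z ^ n * cnj z ^ n) = complex_of_real (c n)" for n
    unfolding c_def zz set_lebesgue_integral_def
    by (subst integral_complex_of_real[symmetric]) (simp add: scaleR_conv_of_real)
  have c0: "0 \<le> c n" for n
    unfolding c_def set_lebesgue_integral_def by (rule integral_nonneg_AE) (auto simp: indicator_def)
  have "(\<lambda>n. b n * (LINT z:?B|?M. z ^ n * cnj (g z))) sums (LINT z:?B|?M. g z * cnj (g z))"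
    by (rule integral_power_series_times[OF R, where C=G])
      (use power_series_disk_norm_le[OF R] cg in \<open>auto intro!: continuous_intros simp: G_def\<close>)
  moreover have "(LINT z:?B|?M. z ^ n * cnj (g z)) = cnj (b n) * c n" for n
  proof -
    have "(LINT z:?B|?M. z ^ n * cnj (g z)) = cnj (LINT z:?B|?M. g z * cnj z ^ n)"
    proof -
      have "cnj (\<integral>z. indicator ?B z *\<^sub>R (g z * cnj z ^ n) \<partial>?M) =
            (\<integral>z. cnj (indicator ?B z *\<^sub>R (g z * cnj z ^ n)) \<partial>?M)"
        by (rule Bochner_Integration.integral_cnj[symmetric])
      also have "(\<lambda>z. cnj (indicator ?B z *\<^sub>R (g z * cnj z ^ n))) = (\<lambda>z. indicator ?B z *\<^sub>R (z ^ n * cnj (g z)))"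
        by (auto simp: fun_eq_iff)
      finally show ?thesis unfolding set_lebesgue_integral_def by simp
    qed
    then show ?thesis using integral_power_series_monomial_ball[OF R, of n] cc by simp
  qed
  moreover have "(LINT z:?B|?M. g z * cnj (g z)) = complex_of_real (LINT z:?B|?M. (cmod (g z))\<^sup>2)"
    unfolding set_lebesgue_integral_def
    by (subst integral_complex_of_real[symmetric])
      (simp add: scaleR_conv_of_real complex_norm_square[symmetric])
  ultimately have "(\<lambda>n. complex_of_real ((cmod (b n))\<^sup>2 * c n)) sums complex_of_real (LINT z:?B|?M. (cmod (g z))\<^sup>2)"
    by (simp add: mult.assoc[symmetric] complex_norm_square[symmetric])
  then have s: "(\<lambda>n. (cmod (b n))\<^sup>2 * c n) sums (LINT z:?B|?M. (cmod (g z))\<^sup>2)"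
    by (simp only: sums_of_real_iff)
  have nn: "(\<integral>\<^sup>+z. indicator ?B z * ennreal (h z) \<partial>?M) = ennreal (LINT z:?B|?M. h z)"
    if "continuous_on ?B h" "\<And>z. z \<in> ?B \<Longrightarrow> h z \<le> K" "\<And>z. 0 \<le> h z" for h :: "complex \<Rightarrow> real" and K
  proof -
    have "set_integrable ?M ?B h"
      by (rule set_integrable_bounded_weighted_area[OF \<beta>, where C=K]) (use that in auto)
    then have "(\<integral>\<^sup>+z. ennreal (indicator ?B z *\<^sub>R h z) \<partial>?M) = ennreal (LINT z:?B|?M. h z)"
      unfolding set_lebesgue_integral_def set_integrable_def
      by (rule nn_integral_eq_integral) (use that in auto)
    moreover have "(\<integral>\<^sup>+z. ennreal (indicator ?B z *\<^sub>R h z) \<partial>?M) = (\<integral>\<^sup>+z. indicator ?B z * ennreal (h z) \<partial>?M)"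
      by (intro nn_integral_cong) (auto simp: indicator_def)
    ultimately show ?thesis by simp
  qed
  have "(\<integral>\<^sup>+z. indicator ?B z * ennreal ((cmod (g z))\<^sup>2) \<partial>?M) = ennreal (LINT z:?B|?M. (cmod (g z))\<^sup>2)"
    by (rule nn[where K="G\<^sup>2"]) (use cg power_series_disk_norm_le[OF R] in \<open>auto intro!: continuous_intros power_mono simp: G_def\<close>)
  also have "\<dots> = (\<Sum>n. ennreal ((cmod (b n))\<^sup>2 * c n))"
    using s c0 by (simp add: sums_iff suminf_ennreal2)
  also have "\<dots> = (\<Sum>n. \<integral>\<^sup>+z. indicator ?B z * ennreal ((cmod (b n))\<^sup>2 * cmod z ^ (2 * n)) \<partial>?M)"
  proof -
    have "(\<integral>\<^sup>+z. indicator ?B z * ennreal ((cmod (b n))\<^sup>2 * cmod z ^ (2 * n)) \<partial>?M) =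
      ennreal (LINT z:?B|?M. (cmod (b n))\<^sup>2 * cmod z ^ (2 * n))" for n
      by (rule nn[where K="(cmod (b n))\<^sup>2"])
        (use R in \<open>auto intro!: continuous_intros mult_left_le power_le_one\<close>)
    moreover have "(LINT z:?B|?M. (cmod (b n))\<^sup>2 * cmod z ^ (2 * n)) = (cmod (b n))\<^sup>2 * c n" for n
      by (simp add: c_def)
    ultimately show ?thesis by (simp only:)
  qed
  also have "\<dots> = (\<integral>\<^sup>+z. (\<Sum>n. indicator ?B z * ennreal ((cmod (b n))\<^sup>2 * cmod z ^ (2 * n))) \<partial>?M)"
    by (rule nn_integral_suminf[symmetric]) (intro borel_imp_measurable_weighted_area, measurable)
  finally show ?thesis by simp
qed

text \<open>The identity holds on the disks of radius \<open>1 - 1 / (k + 2)\<close>, and both sides increase with \<open>k\<close>.\<close>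

theorem bergman_parseval:
  "(\<integral>\<^sup>+z. indicator unit_disk z * ennreal ((cmod (g z))\<^sup>2) \<partial>weighted_area \<beta>) =
   (\<Sum>n. ennreal ((cmod (b n))\<^sup>2 * bergman_moment \<beta> n))"
proof -
  let ?M = "weighted_area \<beta>"
  define R where "R k = 1 - 1 / (real k + 2)" for k
  have R: "0 \<le> R k" "R k < 1" for k by (auto simp: R_def field_simps)
  have Rmono: "R k \<le> R l" if "k \<le> l" for k l using that by (auto simp: R_def field_simps)
  have Rlim: "R \<longlonglongrightarrow> 1" unfolding R_def by real_asymp
  have SUP: "(\<integral>\<^sup>+z. indicator unit_disk z * h z \<partial>?M) = (SUP k. \<integral>\<^sup>+z. indicator (ball 0 (R k)) z * h z \<partial>?M)"
    if m: "\<And>k. (\<lambda>z. indicator (ball 0 (R k)) z * h z) \<in> borel_measurable ?M" for h :: "complex \<Rightarrow> ennreal"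
  proof -
    have "(SUP k. indicator (ball 0 (R k)) z * h z) = indicator unit_disk z * h z" for z :: complex
    proof (cases "z \<in> unit_disk")
      case True
      then have "\<exists>k. cmod z < R k"
        using order_tendstoD(1)[OF Rlim, of "cmod z"] by (auto dest: eventually_happens)
      then obtain k where "cmod z < R k" by blast
      then show ?thesis
        by (intro antisym SUP_least SUP_upper2[of k]) (use True in \<open>auto simp: indicator_def\<close>)
    next
      case False
      then have "z \<notin> ball 0 (R k)" for k using R[of k] by auto
      then show ?thesis using False by simp
    qed
    then have "(\<integral>\<^sup>+z. indicator unit_disk z * h z \<partial>?M) = (\<integral>\<^sup>+z. (SUP k. indicator (ball 0 (R k)) z * h z) \<partial>?M)"
      by simp
    also have "\<dots> = (SUP k. \<integral>\<^sup>+z. indicator (ball 0 (R k)) z * h z \<partial>?M)"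
    proof (rule nn_integral_monotone_convergence_SUP)
      show "incseq (\<lambda>k z. indicator (ball 0 (R k)) z * h z)"
        using Rmono by (auto simp: incseq_def le_fun_def indicator_def intro: less_le_trans)
    qed (use m in auto)
    finally show ?thesis .
  qed
  have cg: "continuous_on (ball 0 (R k)) g" for k
    by (rule continuous_on_subset[OF holomorphic_on_imp_continuous_on[OF power_series_disk_holomorphic]])
      (use R[of k] in auto)
  have m1: "(\<lambda>z. indicator (ball 0 (R k)) z * ennreal ((cmod (g z))\<^sup>2)) \<in> borel_measurable ?M" for k
  proof -
    have "(\<lambda>z. indicator (ball 0 (R k)) z *\<^sub>R (cmod (g z))\<^sup>2) \<in> borel_measurable ?M"
      by (intro measurable_continuous_on_weighted_area continuous_intros cg)
    then have "(\<lambda>z. ennreal (indicator (ball 0 (R k)) z *\<^sub>R (cmod (g z))\<^sup>2)) \<in> borel_measurable ?M" by measurable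
    then show ?thesis by (simp add: ennreal_mult' ennreal_indicator)
  qed
  have "(\<integral>\<^sup>+z. indicator unit_disk z * ennreal ((cmod (g z))\<^sup>2) \<partial>?M) =
    (\<integral>\<^sup>+z. indicator unit_disk z * (\<Sum>n. ennreal ((cmod (b n))\<^sup>2 * cmod z ^ (2 * n))) \<partial>?M)"
  proof -
    have m2: "(\<lambda>z. indicator (ball 0 (R k)) z * (\<Sum>n. ennreal ((cmod (b n))\<^sup>2 * cmod z ^ (2 * n)))) \<in> borel_measurable ?M" for k
      by (intro borel_imp_measurable_weighted_area borel_measurable_times_ennreal
          borel_measurable_indicator borel_measurable_suminf_order) (auto, measurable)
    show ?thesis
      unfolding SUP[OF m1] SUP[OF m2] by (simp only: nn_integral_power_series_square_ball[OF R])
  qed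
  also have "\<dots> = (\<integral>\<^sup>+z. (\<Sum>n. ennreal ((cmod (b n))\<^sup>2 * cmod z ^ (2 * n))) \<partial>?M)"
    using AE_weighted_area_disk[of \<beta>] by (intro nn_integral_cong_AE) auto
  also have "\<dots> = (\<Sum>n. \<integral>\<^sup>+z. ennreal ((cmod (b n))\<^sup>2 * cmod z ^ (2 * n)) \<partial>?M)"
    by (rule nn_integral_suminf) (intro borel_imp_measurable_weighted_area, measurable)
  also have "(\<lambda>n. \<integral>\<^sup>+z. ennreal ((cmod (b n))\<^sup>2 * cmod z ^ (2 * n)) \<partial>?M) =
     (\<lambda>n. ennreal ((cmod (b n))\<^sup>2 * bergman_moment \<beta> n))"
  proof
    fix n
    have "(\<integral>\<^sup>+z. ennreal ((cmod (b n))\<^sup>2 * cmod z ^ (2 * n)) \<partial>?M) =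
      (\<integral>\<^sup>+z. ennreal ((cmod (b n))\<^sup>2) * ennreal (cmod z ^ (2 * n)) \<partial>?M)"
      by (simp add: ennreal_mult)
    also have "\<dots> = ennreal ((cmod (b n))\<^sup>2) * (\<integral>\<^sup>+z. ennreal (cmod z ^ (2 * n)) \<partial>?M)"
      by (rule nn_integral_cmult) (intro borel_imp_measurable_weighted_area, measurable)
    finally show "(\<integral>\<^sup>+z. ennreal ((cmod (b n))\<^sup>2 * cmod z ^ (2 * n)) \<partial>?M) = ennreal ((cmod (b n))\<^sup>2 * bergman_moment \<beta> n)"
      using nn_integral_moment[OF \<beta>, of n] bergman_moment_pos[OF \<beta>, of n] by (simp add: ennreal_mult)
  qed
  finally show ?thesis .
qed

text \<open>On the disks of radius \<open>1 - 1 / (k + 2)\<close> the integral is a Taylor coefficient times a partial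
  moment; an integrable \<open>g\<close> dominates the passage to the unit disk.\<close>

lemma bergman_coefficient:
  assumes int: "set_integrable (weighted_area \<beta>) unit_disk g"
  shows "(LINT z:unit_disk|weighted_area \<beta>. g z * cnj z ^ n) = b n * bergman_moment \<beta> n"
proof -
  let ?M = "weighted_area \<beta>"
  define R where "R k = 1 - 1 / (real k + 2)" for k
  have R: "0 \<le> R k" "R k < 1" for k by (auto simp: R_def field_simps)
  have Rmono: "R k \<le> R l" if "k \<le> l" for k l using that by (auto simp: R_def field_simps)
  have Rlim: "R \<longlonglongrightarrow> 1" unfolding R_def by real_asymp
  have UN: "(\<Union>k. ball 0 (R k)) = unit_disk"
  proof (intro equalityI subsetI)
    fix z :: complex assume "z \<in> unit_disk"
    then have "\<exists>k. cmod z < R k"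
      using order_tendstoD(1)[OF Rlim, of "cmod z"] by (auto dest: eventually_happens)
    then show "z \<in> (\<Union>k. ball 0 (R k))" by auto
  qed (use R in \<open>auto intro: less_trans\<close>)
  have inc: "incseq (\<lambda>k. ball (0::complex) (R k))"
    using Rmono by (auto simp: incseq_def subset_ball)
  have lim: "(\<lambda>k. LINT z:ball 0 (R k)|?M. h z) \<longlonglongrightarrow> (LINT z:unit_disk|?M. h z)"
    if "set_integrable ?M unit_disk h" for h :: "complex \<Rightarrow> complex"
    using set_integral_cont_up[of "\<lambda>k. ball 0 (R k)" ?M h] inc that unfolding UN by simp
  have cg: "continuous_on unit_disk g"
    using holomorphic_on_imp_continuous_on[OF power_series_disk_holomorphic] .
  have "set_integrable ?M unit_disk (\<lambda>z. g z * cnj z ^ n)"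
    unfolding set_integrable_def
  proof (rule Bochner_Integration.integrable_bound[OF int[unfolded set_integrable_def]])
    show "(\<lambda>z. indicator unit_disk z *\<^sub>R (g z * cnj z ^ n)) \<in> borel_measurable ?M"
      by (intro measurable_continuous_on_weighted_area continuous_intros cg)
    show "AE z in ?M. norm (indicator unit_disk z *\<^sub>R (g z * cnj z ^ n)) \<le> norm (indicator unit_disk z *\<^sub>R g z)"
      by (intro always_eventually) (auto simp: indicator_def norm_mult norm_power intro!: mult_left_le power_le_one)
  qed
  from lim[OF this] have 1: "(\<lambda>k. b n * (LINT z:ball 0 (R k)|?M. z ^ n * cnj z ^ n)) \<longlonglongrightarrow>
      (LINT z:unit_disk|?M. g z * cnj z ^ n)"
    using integral_power_series_monomial_ball R by simp
  have "set_integrable ?M unit_disk (\<lambda>z. z ^ n * cnj z ^ n)"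
    by (rule set_integrable_bounded_weighted_area[OF \<beta>, where C=1])
      (auto intro!: continuous_intros mult_le_one power_le_one simp: norm_mult norm_power)
  from lim[OF this] have 2: "(\<lambda>k. b n * (LINT z:ball 0 (R k)|?M. z ^ n * cnj z ^ n)) \<longlonglongrightarrow>
     b n * (LINT z:unit_disk|?M. z ^ n * cnj z ^ n)"
    by (rule tendsto_mult_left)
  have zz: "z ^ n * cnj z ^ n = complex_of_real (cmod z ^ (2 * n))" for z n
    by (metis complex_norm_square of_real_power power_mult power_mult_distrib)
  have "(LINT z:unit_disk|?M. z ^ n * cnj z ^ n) = complex_of_real (\<integral>z. indicator unit_disk z * cmod z ^ (2 * n) \<partial>?M)"
    unfolding set_lebesgue_integral_def zz
    by (subst integral_complex_of_real[symmetric]) (simp add: scaleR_conv_of_real)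
  also have "(\<integral>z. indicator unit_disk z * cmod z ^ (2 * n) \<partial>?M) = bergman_moment \<beta> n"
  proof -
    have "(\<integral>\<^sup>+z. ennreal (indicator unit_disk z * cmod z ^ (2 * n)) \<partial>?M) = (\<integral>\<^sup>+z. ennreal (cmod z ^ (2 * n)) \<partial>?M)"
      using AE_weighted_area_disk[of \<beta>] by (intro nn_integral_cong_AE) auto
    also have "\<dots> = ennreal (bergman_moment \<beta> n)" by (rule nn_integral_moment[OF \<beta>])
    finally show ?thesis
      using bergman_moment_pos[OF \<beta>, of n]
      by (subst integral_eq_nn_integral)
        (auto intro!: borel_imp_measurable_weighted_area borel_measurable_times borel_measurable_indicator)
  qed
  finally show ?thesis using LIMSEQ_unique[OF 1 2] by simp
qed

end

section \<open>Energy integrals\<close>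

abbreviation square_integrable :: "real \<Rightarrow> (complex \<Rightarrow> complex) \<Rightarrow> bool" where
  "square_integrable \<beta> g \<equiv> set_integrable (weighted_area \<beta>) unit_disk (\<lambda>z. (cmod (g z))\<^sup>2)"

abbreviation square_integral :: "real \<Rightarrow> (complex \<Rightarrow> complex) \<Rightarrow> real" where
  "square_integral \<beta> g \<equiv> LINT z:unit_disk|weighted_area \<beta>. (cmod (g z))\<^sup>2"

text \<open>Extended nonnegative values allow norm estimates to be stated before the functions are known to
  lie in the space.\<close>

definition bergman_energy :: "real \<Rightarrow> (complex \<Rightarrow> complex) \<Rightarrow> ennreal" where
  "bergman_energy \<beta> g = (\<integral>\<^sup>+z. indicator unit_disk z * ennreal ((cmod (g z))\<^sup>2) \<partial>weighted_area \<beta>)"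

lemma bergman_energy_cong:
  "(\<And>z. z \<in> unit_disk \<Longrightarrow> f z = g z) \<Longrightarrow> bergman_energy \<beta> f = bergman_energy \<beta> g"
  unfolding bergman_energy_def by (intro nn_integral_cong) (auto simp: indicator_def)

lemma measurable_energy_integrand:
  assumes "continuous_on unit_disk g"
  shows "(\<lambda>z. indicator unit_disk z * ennreal ((cmod (g z))\<^sup>2)) \<in> borel_measurable borel"
proof -
  have "(\<lambda>z. indicator unit_disk z *\<^sub>R (cmod (g z))\<^sup>2) \<in> borel_measurable borel"
    by (intro borel_measurable_continuous_on_indicator continuous_intros assms) simp
  then have "(\<lambda>z. ennreal (indicator unit_disk z *\<^sub>R (cmod (g z))\<^sup>2)) \<in> borel_measurable borel" by measurable
  then show ?thesis by (simp add: ennreal_mult' ennreal_indicator)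
qed

lemma bergman_energy_lborel:
  assumes "continuous_on unit_disk g" "-1 < \<beta>"
  shows "bergman_energy \<beta> g = ennreal ((1 + \<beta>) / pi) *
    (\<integral>\<^sup>+z. ennreal (indicator unit_disk z * ((1 - (cmod z)\<^sup>2) powr \<beta> * (cmod (g z))\<^sup>2)) \<partial>lborel)"
  unfolding bergman_energy_def
  by (subst nn_integral_weighted_area[OF measurable_energy_integrand[OF assms(1)] assms(2)])
    (auto intro!: arg_cong[where f="\<lambda>x. _ * x"] nn_integral_cong simp: indicator_def ennreal_mult)

lemma bergman_energy_power_series:
  assumes "\<And>z. z \<in> unit_disk \<Longrightarrow> (\<lambda>n. b n * z ^ n) sums g z" "-1 < \<beta>"
  shows "bergman_energy \<beta> g = (\<Sum>n. ennreal ((cmod (b n))\<^sup>2 * bergman_moment \<beta> n))"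
  unfolding bergman_energy_def by (rule bergman_parseval) fact+

lemma set_integrable_square_iff:
  assumes "continuous_on unit_disk g"
  shows "square_integrable \<beta> g \<longleftrightarrow> bergman_energy \<beta> g < \<infinity>"
    and "square_integrable \<beta> g \<Longrightarrow>
      bergman_energy \<beta> g = ennreal (square_integral \<beta> g)"
proof -
  let ?h = "\<lambda>z. indicator unit_disk z *\<^sub>R (cmod (g z))\<^sup>2"
  have m: "?h \<in> borel_measurable (weighted_area \<beta>)"
    by (intro measurable_continuous_on_weighted_area continuous_intros assms)
  have e: "bergman_energy \<beta> g = (\<integral>\<^sup>+z. ennreal (?h z) \<partial>weighted_area \<beta>)"
    unfolding bergman_energy_def by (intro nn_integral_cong) (auto simp: indicator_def)
  show "square_integrable \<beta> g \<longleftrightarrow> bergman_energy \<beta> g < \<infinity>"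
    unfolding set_integrable_def integrable_iff_bounded e using m by simp
  assume "square_integrable \<beta> g"
  then show "bergman_energy \<beta> g = ennreal (square_integral \<beta> g)"
    unfolding e set_integrable_def set_lebesgue_integral_def by (rule nn_integral_eq_integral) auto
qed

section \<open>Square-integrable functions\<close>

lemma set_integrable_of_square:
  fixes g :: "complex \<Rightarrow> complex"
  assumes b: "-1 < \<beta>" and c: "continuous_on unit_disk g"
    and i: "square_integrable \<beta> g"
  shows "set_integrable (weighted_area \<beta>) unit_disk g"
proof -
  have "set_integrable (weighted_area \<beta>) unit_disk (\<lambda>z. 1 :: real)"
    by (rule set_integrable_bounded_weighted_area[OF b, where C=1]) auto
  then have "set_integrable (weighted_area \<beta>) unit_disk (\<lambda>z. 1 + (cmod (g z))\<^sup>2)"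
    using i by (rule set_integral_add)
  then show ?thesis unfolding set_integrable_def
  proof (rule Bochner_Integration.integrable_bound)
    show "(\<lambda>z. indicator unit_disk z *\<^sub>R g z) \<in> borel_measurable (weighted_area \<beta>)"
      by (rule measurable_continuous_on_weighted_area[OF c])
    have "x \<le> 1 + x\<^sup>2" for x :: real
    proof -
      have "2 * x \<le> x\<^sup>2 + 1" using zero_le_power2[of "x - 1"] unfolding power2_diff by simp
      moreover have "0 \<le> x\<^sup>2" by simp
      ultimately show ?thesis by linarith
    qed
    then show "AE z in weighted_area \<beta>. norm (indicator unit_disk z *\<^sub>R g z)
       \<le> norm (indicator unit_disk z *\<^sub>R (1 + (cmod (g z))\<^sup>2))"
      by (intro always_eventually) (auto simp: indicator_def)
  qed
qed

text \<open>This turns weighted arithmetic-geometric estimates into the Cauchy-Schwarz inequality. The best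
  weight is \<open>t = sqrt (B / A)\<close>; both roots are shifted by \<open>d\<close> to avoid a zero denominator.\<close>

lemma le_sqrt_mult_of_le_weighted:
  fixes I A B :: real
  assumes A: "0 \<le> A" and B: "0 \<le> B" and le: "\<And>t. 0 < t \<Longrightarrow> 2 * I \<le> t * A + 1 / t * B"
  shows "I \<le> sqrt A * sqrt B"
proof (rule field_le_epsilon)
  fix e :: real assume e: "0 < e"
  let ?a = "sqrt A" and ?b = "sqrt B"
  \<comment> \<open>The shift costs \<open>d (?a + ?b)\<close>, which has to be at most \<open>2 e\<close>.\<close>
  define d where "d = 2 * e / (?a + ?b + 1)"
  have ab: "0 \<le> ?a" "0 \<le> ?b" using A B by auto
  have d: "0 < d" using ab e by (simp add: d_def add_nonneg_pos)
  have sh: "y / (x + d) * x\<^sup>2 \<le> y * x" if "0 \<le> x" "0 \<le> y" for x y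
  proof -
    have "x\<^sup>2 / (x + d) \<le> x" using that d by (simp add: field_simps power2_eq_square)
    then have "y * (x\<^sup>2 / (x + d)) \<le> y * x" using that by (intro mult_left_mono)
    then show ?thesis by simp
  qed
  have "2 * I \<le> (?b + d) / (?a + d) * A + 1 / ((?b + d) / (?a + d)) * B"
    by (rule le) (use ab d in \<open>auto intro!: divide_pos_pos add_nonneg_pos\<close>)
  also have "\<dots> = (?b + d) / (?a + d) * ?a\<^sup>2 + (?a + d) / (?b + d) * ?b\<^sup>2"
    using A B by simp
  also have "\<dots> \<le> (?b + d) * ?a + (?a + d) * ?b"
    using ab d by (intro add_mono sh) auto
  also have "\<dots> = 2 * (?a * ?b) + d * (?a + ?b)" by (simp add: algebra_simps)
  also have "d * (?a + ?b) \<le> 2 * e"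
  proof -
    have "d * (?a + ?b) \<le> d * (?a + ?b + 1)" using d by simp
    also have "\<dots> = 2 * e" using ab by (simp add: d_def add_nonneg_pos order_less_imp_not_eq2)
    finally show ?thesis .
  qed
  finally show "I \<le> ?a * ?b + e" by simp
qed

lemma set_integrable_product:
  fixes f g :: "complex \<Rightarrow> complex"
  assumes c: "continuous_on unit_disk f" "continuous_on unit_disk g"
    and i: "square_integrable \<beta> f"
           "square_integrable \<beta> g"
  shows "set_integrable (weighted_area \<beta>) unit_disk (\<lambda>z. f z * cnj (g z))"
    and "cmod (LINT z:unit_disk|weighted_area \<beta>. f z * cnj (g z)) \<le>
      sqrt (square_integral \<beta> f) *
      sqrt (square_integral \<beta> g)"
proof -
  let ?M = "weighted_area \<beta>"
  have s: "set_integrable ?M unit_disk (\<lambda>z. t * (cmod (f z))\<^sup>2 + s * (cmod (g z))\<^sup>2)" for t s :: real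
    using i by (intro set_integral_add set_integrable_mult_right) auto
  have am: "2 * (x * y) \<le> t * x\<^sup>2 + 1 / t * y\<^sup>2" if "0 < t" for x y t :: real
  proof -
    have "0 \<le> (t * x - y)\<^sup>2 / t" using that by simp
    also have "\<dots> = t * x\<^sup>2 + 1 / t * y\<^sup>2 - 2 * (x * y)" using that by (simp add: power2_eq_square field_simps)
    finally show ?thesis by simp
  qed
  show p: "set_integrable ?M unit_disk (\<lambda>z. f z * cnj (g z))"
    unfolding set_integrable_def
  proof (rule Bochner_Integration.integrable_bound[OF s[of 1 1, unfolded set_integrable_def]])
    show "(\<lambda>z. indicator unit_disk z *\<^sub>R (f z * cnj (g z))) \<in> borel_measurable ?M"
      by (intro measurable_continuous_on_weighted_area continuous_intros c)
    have "x * y \<le> x\<^sup>2 + y\<^sup>2" if "0 \<le> x" "0 \<le> y" for x y :: real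
    proof -
      have "2 * (x * y) \<le> x\<^sup>2 + y\<^sup>2" using am[of 1 x y] by simp
      then show ?thesis using mult_nonneg_nonneg[OF that] by linarith
    qed
    then show "AE z in ?M. norm (indicator unit_disk z *\<^sub>R (f z * cnj (g z)))
       \<le> norm (indicator unit_disk z *\<^sub>R (1 * (cmod (f z))\<^sup>2 + 1 * (cmod (g z))\<^sup>2))"
      by (intro always_eventually) (auto simp: indicator_def norm_mult)
  qed
  define I where "I = (\<integral>z. norm (indicator unit_disk z *\<^sub>R (f z * cnj (g z))) \<partial>?M)"
  define A where "A = (LINT z:unit_disk|?M. (cmod (f z))\<^sup>2)"
  define B where "B = (LINT z:unit_disk|?M. (cmod (g z))\<^sup>2)"
  have A0: "0 \<le> A" and B0: "0 \<le> B"
    unfolding A_def B_def set_lebesgue_integral_def by (auto intro!: integral_nonneg_AE)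
  have le: "2 * I \<le> t * A + 1 / t * B" if "0 < t" for t
  proof -
    have "2 * I = (\<integral>z. 2 * norm (indicator unit_disk z *\<^sub>R (f z * cnj (g z))) \<partial>?M)" by (simp add: I_def)
    also have "\<dots> \<le> (\<integral>z. indicator unit_disk z *\<^sub>R (t * (cmod (f z))\<^sup>2 + 1 / t * (cmod (g z))\<^sup>2) \<partial>?M)"
    proof (rule integral_mono)
      show "integrable ?M (\<lambda>z. 2 * norm (indicator unit_disk z *\<^sub>R (f z * cnj (g z))))"
        using p unfolding set_integrable_def by (intro integrable_mult_right integrable_norm)
      show "integrable ?M (\<lambda>z. indicator unit_disk z *\<^sub>R (t * (cmod (f z))\<^sup>2 + 1 / t * (cmod (g z))\<^sup>2))"
        using s unfolding set_integrable_def .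
      show "2 * norm (indicator unit_disk z *\<^sub>R (f z * cnj (g z)))
        \<le> indicator unit_disk z *\<^sub>R (t * (cmod (f z))\<^sup>2 + 1 / t * (cmod (g z))\<^sup>2)" for z
        using am[OF that, of "cmod (f z)" "cmod (g z)"] by (simp add: indicator_def norm_mult)
    qed
    also have "\<dots> = t * A + 1 / t * B"
    proof -
      have "set_integrable ?M unit_disk (\<lambda>z. t * (cmod (f z))\<^sup>2)"
        "set_integrable ?M unit_disk (\<lambda>z. 1 / t * (cmod (g z))\<^sup>2)"
        using i by (intro set_integrable_mult_right; simp)+
      from set_integral_add(2)[OF this] show ?thesis
        by (simp add: A_def B_def set_lebesgue_integral_def)
    qed
    finally show ?thesis .
  qed
  have "I \<le> sqrt A * sqrt B" by (rule le_sqrt_mult_of_le_weighted[OF A0 B0 le])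
  moreover have "cmod (LINT z:unit_disk|?M. f z * cnj (g z)) \<le> I"
    unfolding set_lebesgue_integral_def I_def by (rule integral_norm_bound)
  ultimately show "cmod (LINT z:unit_disk|?M. f z * cnj (g z)) \<le> sqrt (LINT z:unit_disk|?M. (cmod (f z))\<^sup>2) *
      sqrt (LINT z:unit_disk|?M. (cmod (g z))\<^sup>2)"
    unfolding A_def B_def by simp
qed


section \<open>The reproducing kernel\<close>

definition bergman_kernel :: "real \<Rightarrow> complex \<Rightarrow> complex \<Rightarrow> complex" where
  "bergman_kernel \<beta> w z = (1 - z * cnj w) powr complex_of_real (- (\<beta> + 2))"

lemma norm_bergman_kernel:
  "cmod (bergman_kernel \<beta> w z) = cmod (1 - z * cnj w) powr (- (\<beta> + 2))"
  unfolding bergman_kernel_def by (subst norm_powr_real_powr') auto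

text \<open>The coefficients of this series are the reciprocal moments, which is the reason for the
  reproducing property.\<close>

lemma bergman_kernel_sums:
  assumes "cmod (z * cnj w) < 1"
  shows "(\<lambda>n. (cnj w) ^ n / complex_of_real (bergman_moment \<beta> n) * z ^ n) sums bergman_kernel \<beta> w z"
proof -
  let ?a = "complex_of_real (- (\<beta> + 2))"
  have "(\<lambda>n. (?a gchoose n) * (- (z * cnj w)) ^ n) sums (1 + - (z * cnj w)) powr ?a"
    by (rule gen_binomial_complex) (use assms in simp)
  moreover have "(?a gchoose n) * (- (z * cnj w)) ^ n = (cnj w) ^ n / complex_of_real (bergman_moment \<beta> n) * z ^ n" for n
  proof -
    have "pochhammer (- ?a) n = complex_of_real (pochhammer (\<beta> + 2) n)"
      by (metis minus_minus of_real_minus pochhammer_of_real)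
    moreover have "(- (z * cnj w)) ^ n = (-1) ^ n * (z * cnj w) ^ n" by (rule power_minus)
    moreover have "(-1) ^ n * (-1) ^ n = (1::complex)" by (metis power_mult_distrib mult_minus1 minus_minus power_one)
    ultimately show ?thesis
      by (simp add: gbinomial_pochhammer bergman_moment_def power_mult_distrib mult_ac)
  qed
  ultimately show ?thesis by (simp add: bergman_kernel_def)
qed

lemma norm_mult_cnj_less_1: "z \<in> unit_disk \<Longrightarrow> w \<in> unit_disk \<Longrightarrow> cmod (z * cnj w) < 1"
  using mult_strict_mono[of "cmod z" 1 "cmod w" 1] by (cases "w = 0") (auto simp: norm_mult)

lemma bergman_kernel_holomorphic:
  assumes "w \<in> unit_disk"
  shows "bergman_kernel \<beta> w holomorphic_on unit_disk"
proof -
  have "1 - z * cnj w \<notin> \<real>\<^sub>\<le>\<^sub>0" if "z \<in> unit_disk" for z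
  proof
    assume "1 - z * cnj w \<in> \<real>\<^sub>\<le>\<^sub>0"
    then have "Re (1 - z * cnj w) \<le> 0" by (simp add: complex_nonpos_Reals_iff)
    then have "1 \<le> Re (z * cnj w)" by simp
    also have "\<dots> \<le> cmod (z * cnj w)" by (rule complex_Re_le_cmod)
    also have "\<dots> < 1" using that assms by (rule norm_mult_cnj_less_1)
    finally show False by simp
  qed
  then show ?thesis unfolding bergman_kernel_def[abs_def] by (intro holomorphic_intros) auto
qed

lemma norm_one_minus_mult_ge: "z \<in> unit_disk \<Longrightarrow> 1 - cmod w \<le> cmod (1 - z * cnj w)"
proof -
  assume "z \<in> unit_disk"
  then have "cmod (z * cnj w) \<le> cmod w" by (auto simp: norm_mult intro: mult_left_le_one_le)
  then show ?thesis using norm_triangle_ineq2[of 1 "z * cnj w"] by simp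
qed

lemma norm_bergman_kernel_le:
  assumes "z \<in> unit_disk" "w \<in> unit_disk" "-1 < \<beta>"
  shows "cmod (bergman_kernel \<beta> w z) \<le> (1 - cmod w) powr (- (\<beta> + 2))"
  unfolding norm_bergman_kernel
  using assms norm_one_minus_mult_ge[OF assms(1), of w] by (intro powr_mono2') auto

text \<open>Integrated against the kernel series term by term, \<open>g\<close> contributes its \<open>n\<close>-th Taylor coefficient
  times the \<open>n\<close>-th moment, and the moment cancels against the coefficient of the kernel.\<close>

lemma bergman_reproducing:
  assumes b: "-1 < \<beta>" and g: "g holomorphic_on unit_disk" and w: "w \<in> unit_disk"
    and int: "set_integrable (weighted_area \<beta>) unit_disk g"
  shows "(LINT z:unit_disk|weighted_area \<beta>. g z * cnj (bergman_kernel \<beta> w z)) = g w"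
proof -
  let ?M = "weighted_area \<beta>"
  define b where "b n = (deriv ^^ n) g 0 / fact n" for n
  have bs: "(\<lambda>n. b n * z ^ n) sums g z" if "z \<in> unit_disk" for z
    using holomorphic_power_series[OF g that] by (simp add: b_def)
  let ?c = "bergman_moment \<beta>"
  have cpos: "0 < ?c n" for n by (rule bergman_moment_pos[OF b])
  have sm: "summable (\<lambda>n. cmod w ^ n / ?c n)"
  proof -
    have "summable (\<lambda>n. cnj (complex_of_real (cmod w)) ^ n / complex_of_real (?c n) * 1 ^ n)"
      using bergman_kernel_sums[of 1 "complex_of_real (cmod w)" \<beta>] w by (auto simp: sums_iff)
    then have "summable (\<lambda>n. complex_of_real (cmod w ^ n / ?c n))" by simp
    then show ?thesis by (simp only: summable_complex_of_real)
  qed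
  have cg: "continuous_on unit_disk g" using g by (rule holomorphic_on_imp_continuous_on)
  let ?f = "\<lambda>n z. indicator unit_disk z *\<^sub>R (g z * cnj z ^ n * (w ^ n / complex_of_real (?c n)))"
  have nf: "norm (?f n z) \<le> norm (indicator unit_disk z *\<^sub>R g z) * (cmod w ^ n / ?c n)" for n z
    using cpos[of n] by (auto simp: indicator_def norm_mult norm_power norm_divide
        intro!: mult_mono divide_right_mono power_le_one mult_left_le)
  have intn: "integrable ?M (\<lambda>z. norm (indicator unit_disk z *\<^sub>R g z))"
    using int unfolding set_integrable_def by (rule integrable_norm)
  have intf: "integrable ?M (?f n)" for n
  proof (rule Bochner_Integration.integrable_bound[OF integrable_mult_left[OF intn, of "cmod w ^ n / ?c n"]])
    show "?f n \<in> borel_measurable ?M"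
      by (intro measurable_continuous_on_weighted_area continuous_intros cg)
    show "AE z in ?M. norm (?f n z) \<le> norm (norm (indicator unit_disk z *\<^sub>R g z) * (cmod w ^ n / ?c n))"
    proof (intro always_eventually allI)
      fix z
      have "0 \<le> norm (indicator unit_disk z *\<^sub>R g z) * (cmod w ^ n / ?c n)" using cpos[of n] by simp
      then show "norm (?f n z) \<le> norm (norm (indicator unit_disk z *\<^sub>R g z) * (cmod w ^ n / ?c n))"
        using nf[where n=n and z=z] by (simp only: real_norm_def abs_of_nonneg)
    qed
  qed
  have "(\<lambda>n. integral\<^sup>L ?M (?f n)) sums (\<integral>z. (\<Sum>n. ?f n z) \<partial>?M)"
  proof (rule sums_integral[OF intf])
    show "AE z in ?M. summable (\<lambda>n. norm (?f n z))"
    proof (intro always_eventually allI)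
      fix z
      show "summable (\<lambda>n. norm (?f n z))"
        by (rule summable_comparison_test'[OF summable_mult[OF sm, of "norm (indicator unit_disk z *\<^sub>R g z)"]])
          (simp only: real_norm_def abs_norm_cancel nf)
    qed
    show "summable (\<lambda>n. \<integral>z. norm (?f n z) \<partial>?M)"
    proof (rule summable_comparison_test'[OF summable_mult[OF sm]])
      fix n
      have "(\<integral>z. norm (?f n z) \<partial>?M) \<le> (\<integral>z. norm (indicator unit_disk z *\<^sub>R g z) * (cmod w ^ n / ?c n) \<partial>?M)"
        by (intro integral_mono integrable_norm intf integrable_mult_left intn nf)
      then show "norm (\<integral>z. norm (?f n z) \<partial>?M) \<le>
          (\<integral>z. norm (indicator unit_disk z *\<^sub>R g z) \<partial>?M) * (cmod w ^ n / ?c n)"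
        by (simp add: integral_nonneg_AE)
    qed
  qed
  moreover have "integral\<^sup>L ?M (?f n) = b n * w ^ n" for n
  proof -
    have "integral\<^sup>L ?M (?f n) = (\<integral>z. (indicator unit_disk z *\<^sub>R (g z * cnj z ^ n)) * (w ^ n / complex_of_real (?c n)) \<partial>?M)"
      by (intro Bochner_Integration.integral_cong) (auto simp: scaleR_conv_of_real)
    also have "\<dots> = (LINT z:unit_disk|?M. g z * cnj z ^ n) * (w ^ n / complex_of_real (?c n))"
      unfolding set_lebesgue_integral_def by (rule integral_mult_left_zero)
    also have "\<dots> = b n * w ^ n"
      using bergman_coefficient[OF bs b int, of n] cpos[of n] by simp
    finally show ?thesis .
  qed
  moreover have "(\<Sum>n. ?f n z) = indicator unit_disk z *\<^sub>R (g z * cnj (bergman_kernel \<beta> w z))" for z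
  proof (cases "z \<in> unit_disk")
    case True
    have "cmod (z * cnj w) < 1" using True w by (rule norm_mult_cnj_less_1)
    from bergman_kernel_sums[OF this, of \<beta>]
    have "(\<lambda>n. cnj ((cnj w) ^ n / complex_of_real (?c n) * z ^ n)) sums cnj (bergman_kernel \<beta> w z)"
      by (simp only: sums_cnj)
    from sums_mult[OF this, of "g z"] True show ?thesis by (simp add: sums_iff mult_ac)
  qed simp
  ultimately have "(\<lambda>n. b n * w ^ n) sums (\<integral>z. indicator unit_disk z *\<^sub>R (g z * cnj (bergman_kernel \<beta> w z)) \<partial>?M)"
    by simp
  then show ?thesis using bs[OF w] sums_unique2 unfolding set_lebesgue_integral_def by blast
qed

lemma set_integrable_square_bergman_kernel:
  assumes "-1 < \<beta>" "w \<in> unit_disk"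
  shows "square_integrable \<beta> (bergman_kernel \<beta> w)"
proof (rule set_integrable_bounded_weighted_area[OF assms(1)])
  show "continuous_on unit_disk (\<lambda>z. (cmod (bergman_kernel \<beta> w z))\<^sup>2)"
    using holomorphic_on_imp_continuous_on[OF bergman_kernel_holomorphic[OF assms(2)]]
    by (intro continuous_intros)
  show "norm ((cmod (bergman_kernel \<beta> w z))\<^sup>2) \<le> ((1 - cmod w) powr (- (\<beta> + 2)))\<^sup>2" if "z \<in> unit_disk" for z
    using norm_bergman_kernel_le[OF that assms(2,1)] by (simp add: power_mono)
qed

text \<open>This is the reproducing property of the kernel applied to the kernel itself.\<close>

lemma bergman_kernel_square_integral:
  assumes b: "-1 < \<beta>" and w: "w \<in> unit_disk"
  shows "(square_integral \<beta> (bergman_kernel \<beta> w)) = (1 - (cmod w)\<^sup>2) powr (- (\<beta> + 2))"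
proof -
  let ?k = "bergman_kernel \<beta> w"
  have h: "?k holomorphic_on unit_disk" by (rule bergman_kernel_holomorphic[OF w])
  have "complex_of_real (square_integral \<beta> ?k) = (LINT z:unit_disk|weighted_area \<beta>. ?k z * cnj (?k z))"
    unfolding set_lebesgue_integral_def
    by (subst integral_complex_of_real[symmetric])
      (simp add: scaleR_conv_of_real complex_norm_square[symmetric])
  also have "\<dots> = ?k w"
    by (rule bergman_reproducing[OF b h w])
      (rule set_integrable_of_square[OF b holomorphic_on_imp_continuous_on[OF h] set_integrable_square_bergman_kernel[OF b w]])
  also have "\<dots> = complex_of_real ((1 - (cmod w)\<^sup>2) powr (- (\<beta> + 2)))"
  proof -
    have "1 - w * cnj w = complex_of_real (1 - (cmod w)\<^sup>2)" by (simp add: complex_norm_square[symmetric])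
    moreover have "0 \<le> 1 - (cmod w)\<^sup>2" using w by (simp add: power_le_one)
    ultimately show ?thesis unfolding bergman_kernel_def by (simp only: powr_of_real)
  qed
  finally show ?thesis by (simp only: of_real_eq_iff)
qed

lemma norm_le_bergman_energy:
  assumes b: "-1 < \<beta>" and g: "g holomorphic_on unit_disk" and w: "w \<in> unit_disk"
    and int: "square_integrable \<beta> g"
  shows "(cmod (g w))\<^sup>2 \<le> (square_integral \<beta> g) * (1 - (cmod w)\<^sup>2) powr (- (\<beta> + 2))"
proof -
  have c: "continuous_on unit_disk g" "continuous_on unit_disk (bergman_kernel \<beta> w)"
    using holomorphic_on_imp_continuous_on g bergman_kernel_holomorphic[OF w] by blast+
  have "cmod (g w) \<le> sqrt (square_integral \<beta> g) * sqrt ((1 - (cmod w)\<^sup>2) powr (- (\<beta> + 2)))"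
    using set_integrable_product(2)[OF c int set_integrable_square_bergman_kernel[OF b w]]
      bergman_reproducing[OF b g w set_integrable_of_square[OF b c(1) int]]
      bergman_kernel_square_integral[OF b w] by simp
  then have "(cmod (g w))\<^sup>2 \<le> (sqrt (square_integral \<beta> g) * sqrt ((1 - (cmod w)\<^sup>2) powr (- (\<beta> + 2))))\<^sup>2"
    by (rule power_mono) simp
  moreover have "0 \<le> (square_integral \<beta> g)"
    unfolding set_lebesgue_integral_def by (auto intro!: integral_nonneg_AE)
  ultimately show ?thesis by (simp add: power_mult_distrib)
qed

section \<open>Trading a derivative for two powers of the weight\<close>

text \<open>For \<open>\<beta> > -1\<close> the factor \<open>Suc n / (n + \<beta> + 3)\<close> lies between two positive constants. Hence the
  Parseval sums of \<open>g\<close> with exponent \<open>\<beta>\<close> and of \<open>g'\<close> with exponent \<open>\<beta> + 2\<close> are comparable.\<close>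

lemma bergman_moment_shift:
  assumes "-1 < \<beta>"
  shows "(real (Suc n))\<^sup>2 * bergman_moment (\<beta> + 2) n =
    (\<beta> + 2) * (\<beta> + 3) * (real (Suc n) / (real n + \<beta> + 3)) * bergman_moment \<beta> (Suc n)"
proof -
  let ?s = "\<beta> + 2"
  have "pochhammer ?s (Suc (Suc n)) = ?s * ((?s + 1) * pochhammer (\<beta> + 4) n)"
    by (simp only: pochhammer_rec) (simp add: add.assoc)
  moreover have "pochhammer ?s (Suc (Suc n)) = pochhammer ?s (Suc n) * (real n + \<beta> + 3)"
    by (subst pochhammer_Suc) (simp add: algebra_simps)
  ultimately have e: "pochhammer ?s (Suc n) * (real n + \<beta> + 3) = ?s * (\<beta> + 3) * pochhammer (\<beta> + 4) n"
    by (simp add: algebra_simps)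
  have p: "0 < pochhammer ?s (Suc n)" "0 < pochhammer (\<beta> + 4) n" "0 < real n + \<beta> + 3"
    using assms by (auto intro: pochhammer_pos)
  have "(real (Suc n))\<^sup>2 * bergman_moment (\<beta> + 2) n = real (Suc n) * fact (Suc n) / pochhammer (\<beta> + 4) n"
    by (simp add: bergman_moment_def power2_eq_square add.assoc)
  also have "\<dots> = (real (Suc n) * fact (Suc n)) * (?s * (\<beta> + 3)) / (?s * (\<beta> + 3) * pochhammer (\<beta> + 4) n)"
    using assms by simp
  also have "\<dots> = (real (Suc n) * fact (Suc n)) * (?s * (\<beta> + 3)) / (pochhammer ?s (Suc n) * (real n + \<beta> + 3))"
    by (simp only: e)
  also have "\<dots> = (\<beta> + 2) * (\<beta> + 3) * (real (Suc n) / (real n + \<beta> + 3)) * bergman_moment \<beta> (Suc n)"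
    by (simp only: bergman_moment_def) (simp add: mult_ac)
  finally show ?thesis .
qed

lemma taylor_disk:
  assumes "g holomorphic_on unit_disk" "z \<in> unit_disk"
  shows "(\<lambda>n. (deriv ^^ n) g 0 / fact n * z ^ n) sums g z"
  using holomorphic_power_series[OF assms] by simp

lemma taylor_coeff_deriv:
  "(deriv ^^ n) (deriv g) 0 / fact n = of_nat (Suc n) * ((deriv ^^ Suc n) g 0 / fact (Suc n) :: complex)"
  using of_nat_neq_0[of n, where 'a=complex] by (simp add: funpow_swap1)

lemma bergman_energy_taylor:
  assumes "-1 < \<beta>" "g holomorphic_on unit_disk"
  shows "bergman_energy \<beta> g = (\<Sum>n. ennreal ((cmod ((deriv ^^ n) g 0 / fact n))\<^sup>2 * bergman_moment \<beta> n))"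
  by (rule bergman_energy_power_series[OF _ assms(1)]) (rule taylor_disk[OF assms(2)])

text \<open>Both inequalities compare Parseval sums term by term; only the constant coefficient of \<open>g\<close> is
  invisible in \<open>g'\<close>.\<close>

lemma bergman_energy_deriv:
  assumes b: "-1 < \<beta>" and g: "g holomorphic_on unit_disk"
  shows "bergman_energy (\<beta> + 2) (deriv g) \<le> ennreal ((\<beta> + 2) * (\<beta> + 3)) * bergman_energy \<beta> g"
    and "bergman_energy \<beta> g \<le> ennreal ((cmod (g 0))\<^sup>2) + ennreal (1 / (\<beta> + 2)) * bergman_energy (\<beta> + 2) (deriv g)"
proof -
  define a where "a n = (cmod ((deriv ^^ n) g 0 / fact n))\<^sup>2" for n
  have a0: "0 \<le> a n" for n by (simp add: a_def)
  have E: "bergman_energy \<beta> g = (\<Sum>n. ennreal (a n * bergman_moment \<beta> n))"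
    unfolding a_def by (rule bergman_energy_taylor[OF b g])
  have E0: "bergman_energy \<beta> g = ennreal (a 0) + (\<Sum>n. ennreal (a (Suc n) * bergman_moment \<beta> (Suc n)))"
    unfolding E by (subst suminf_offset[where i=1]) (auto simp: add.commute)
  have d: "deriv g holomorphic_on unit_disk" by (rule holomorphic_deriv[OF g]) simp
  have E': "bergman_energy (\<beta> + 2) (deriv g) =
    (\<Sum>n. ennreal (a (Suc n) * ((real (Suc n))\<^sup>2 * bergman_moment (\<beta> + 2) n)))"
  proof -
    have e: "(cmod ((deriv ^^ n) (deriv g) 0 / fact n))\<^sup>2 = a (Suc n) * (real (Suc n))\<^sup>2" for n
      unfolding taylor_coeff_deriv a_def by (simp only: norm_mult norm_of_nat power_mult_distrib mult.commute)
    have b2: "-1 < \<beta> + 2" using b by simp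
    show ?thesis unfolding bergman_energy_taylor[OF b2 d] by (simp only: e mult.assoc)
  qed
  have mp: "0 < bergman_moment \<beta> n" for n by (rule bergman_moment_pos[OF b])
  have up: "(real (Suc n))\<^sup>2 * bergman_moment (\<beta> + 2) n \<le> (\<beta> + 2) * (\<beta> + 3) * bergman_moment \<beta> (Suc n)" for n
  proof -
    have "real (Suc n) / (real n + \<beta> + 3) \<le> 1" using b by simp
    then have "(\<beta> + 2) * (\<beta> + 3) * (real (Suc n) / (real n + \<beta> + 3)) * bergman_moment \<beta> (Suc n) \<le>
      (\<beta> + 2) * (\<beta> + 3) * 1 * bergman_moment \<beta> (Suc n)"
      using b mp[of "Suc n"] by (intro mult_right_mono mult_left_mono) auto
    then show ?thesis unfolding bergman_moment_shift[OF b] by simp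
  qed
  have lo: "bergman_moment \<beta> (Suc n) \<le> 1 / (\<beta> + 2) * ((real (Suc n))\<^sup>2 * bergman_moment (\<beta> + 2) n)" for n
  proof -
    have "1 * real n \<le> (\<beta> + 3) * real n" using b by (intro mult_right_mono) auto
    then have "(real n + \<beta> + 3) \<le> (\<beta> + 3) * real (Suc n)" by (simp add: algebra_simps)
    then have "1 \<le> (\<beta> + 3) * (real (Suc n) / (real n + \<beta> + 3))" using b by (simp add: field_simps)
    then have "1 * bergman_moment \<beta> (Suc n) \<le> (\<beta> + 3) * (real (Suc n) / (real n + \<beta> + 3)) * bergman_moment \<beta> (Suc n)"
      using mp[of "Suc n"] by (intro mult_right_mono) auto
    then show ?thesis unfolding bergman_moment_shift[OF b] using b by simp
  qed
  have "bergman_energy (\<beta> + 2) (deriv g) \<le> (\<Sum>n. ennreal ((\<beta> + 2) * (\<beta> + 3)) * ennreal (a (Suc n) * bergman_moment \<beta> (Suc n)))"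
    unfolding E'
  proof (rule suminf_le)
    fix n
    have "a (Suc n) * ((real (Suc n))\<^sup>2 * bergman_moment (\<beta> + 2) n) \<le> a (Suc n) * ((\<beta> + 2) * (\<beta> + 3) * bergman_moment \<beta> (Suc n))"
      by (intro mult_left_mono up a0)
    then show "ennreal (a (Suc n) * ((real (Suc n))\<^sup>2 * bergman_moment (\<beta> + 2) n)) \<le>
      ennreal ((\<beta> + 2) * (\<beta> + 3)) * ennreal (a (Suc n) * bergman_moment \<beta> (Suc n))"
      using b a0 mp[of "Suc n"] by (subst ennreal_mult[symmetric]) (auto intro!: ennreal_leI simp: mult_ac)
  qed auto
  also have "\<dots> = ennreal ((\<beta> + 2) * (\<beta> + 3)) * (\<Sum>n. ennreal (a (Suc n) * bergman_moment \<beta> (Suc n)))"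
    by (rule ennreal_suminf_cmult)
  also have "\<dots> \<le> ennreal ((\<beta> + 2) * (\<beta> + 3)) * bergman_energy \<beta> g"
    unfolding E0 by (intro mult_left_mono) auto
  finally show "bergman_energy (\<beta> + 2) (deriv g) \<le> ennreal ((\<beta> + 2) * (\<beta> + 3)) * bergman_energy \<beta> g" .
  note E0
  also have "(\<Sum>n. ennreal (a (Suc n) * bergman_moment \<beta> (Suc n))) \<le>
     (\<Sum>n. ennreal (1 / (\<beta> + 2)) * ennreal (a (Suc n) * ((real (Suc n))\<^sup>2 * bergman_moment (\<beta> + 2) n)))"
  proof (rule suminf_le)
    fix n
    have "a (Suc n) * bergman_moment \<beta> (Suc n) \<le> a (Suc n) * (1 / (\<beta> + 2) * ((real (Suc n))\<^sup>2 * bergman_moment (\<beta> + 2) n))"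
      by (intro mult_left_mono lo a0)
    then show "ennreal (a (Suc n) * bergman_moment \<beta> (Suc n)) \<le>
      ennreal (1 / (\<beta> + 2)) * ennreal (a (Suc n) * ((real (Suc n))\<^sup>2 * bergman_moment (\<beta> + 2) n))"
      using b by (subst ennreal_mult'[symmetric]) (auto intro!: ennreal_leI simp: mult_ac)
  qed auto
  also have "\<dots> = ennreal (1 / (\<beta> + 2)) * bergman_energy (\<beta> + 2) (deriv g)"
    unfolding E' by (rule ennreal_suminf_cmult)
  finally show "bergman_energy \<beta> g \<le> ennreal ((cmod (g 0))\<^sup>2) + ennreal (1 / (\<beta> + 2)) * bergman_energy (\<beta> + 2) (deriv g)"
    by (simp add: a_def add_left_mono)
qed

lemma bergman_energy_weight_le:
  assumes b: "-1 < \<beta>" and c: "continuous_on unit_disk g"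
  shows "bergman_energy (\<beta> + 2) g \<le> ennreal ((\<beta> + 3) / (\<beta> + 1)) * bergman_energy \<beta> g"
proof -
  have "(\<integral>\<^sup>+z. ennreal (indicator unit_disk z * ((1 - (cmod z)\<^sup>2) powr (\<beta> + 2) * (cmod (g z))\<^sup>2)) \<partial>lborel) \<le>
    (\<integral>\<^sup>+z. ennreal (indicator unit_disk z * ((1 - (cmod z)\<^sup>2) powr \<beta> * (cmod (g z))\<^sup>2)) \<partial>lborel)"
  proof (intro nn_integral_mono ennreal_leI)
    fix z :: complex
    show "indicator unit_disk z * ((1 - (cmod z)\<^sup>2) powr (\<beta> + 2) * (cmod (g z))\<^sup>2) \<le>
       indicator unit_disk z * ((1 - (cmod z)\<^sup>2) powr \<beta> * (cmod (g z))\<^sup>2)"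
    proof (cases "z \<in> unit_disk")
      case True
      then have "0 < 1 - (cmod z)\<^sup>2" "1 - (cmod z)\<^sup>2 \<le> 1" by (auto simp: power_less_one_iff)
      then have "(1 - (cmod z)\<^sup>2) powr (\<beta> + 2) \<le> (1 - (cmod z)\<^sup>2) powr \<beta>"
        by (intro powr_mono') auto
      then show ?thesis using True by (simp add: mult_right_mono)
    qed simp
  qed
  then have "bergman_energy (\<beta> + 2) g \<le> ennreal ((1 + (\<beta> + 2)) / pi) *
     (\<integral>\<^sup>+z. ennreal (indicator unit_disk z * ((1 - (cmod z)\<^sup>2) powr \<beta> * (cmod (g z))\<^sup>2)) \<partial>lborel)"
    using b by (subst bergman_energy_lborel[OF c]) (auto intro: mult_left_mono)
  also have "ennreal ((1 + (\<beta> + 2)) / pi) = ennreal ((\<beta> + 3) / (\<beta> + 1)) * ennreal ((1 + \<beta>) / pi)"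
  proof -
    have "(\<beta> + 3) / (\<beta> + 1) * ((1 + \<beta>) / pi) = (1 + (\<beta> + 2)) / pi"
      using b by (simp add: add.commute[of 1 \<beta>])
    then show ?thesis using b by (subst ennreal_mult[symmetric]) auto
  qed
  finally show ?thesis using bergman_energy_lborel[OF c b] by (simp add: mult.assoc)
qed

lemma one_minus_norm_square_pos: "z \<in> unit_disk \<Longrightarrow> 0 < 1 - (cmod z)\<^sup>2"
  by (simp add: power_less_one_iff)

lemma one_minus_norm_square_le: "1 - (cmod z)\<^sup>2 \<le> 2 * (1 - cmod z)"
  using zero_le_power2[of "1 - cmod z"] by (simp add: power2_eq_square algebra_simps)

section \<open>Composition with univalent maps\<close>

lemma nn_integral_compose_univalent_le:
  fixes F :: "complex \<Rightarrow> real"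
  assumes h: "\<phi> holomorphic_on unit_disk" and inj: "inj_on \<phi> unit_disk" and sub: "\<phi> ` unit_disk \<subseteq> unit_disk"
    and F: "continuous_on unit_disk F" "\<And>z. 0 \<le> F z"
  shows "(\<integral>\<^sup>+z. ennreal (indicator unit_disk z * ((cmod (deriv \<phi> z))\<^sup>2 * F (\<phi> z))) \<partial>lborel) \<le>
         (\<integral>\<^sup>+z. ennreal (indicator unit_disk z * F z) \<partial>lborel)"
proof -
  have c: "continuous_on unit_disk \<phi>" "continuous_on unit_disk (deriv \<phi>)"
    using holomorphic_on_imp_continuous_on[OF h] holomorphic_on_imp_continuous_on[OF holomorphic_deriv[OF h]] by auto
  have op: "open (\<phi> ` unit_disk)"
    by (rule open_mapping_thm3[OF h _ inj]) simp
  have "(\<integral>\<^sup>+z. ennreal (indicator (\<phi> ` unit_disk) z * F z) \<partial>lborel) =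
    (\<integral>\<^sup>+z. ennreal (indicator unit_disk z * ((cmod (deriv \<phi> z))\<^sup>2 * F (\<phi> z))) \<partial>lborel)"
  proof (rule nn_integral_change_of_variables_complex[OF _ _ inj F(2)])
    show "(\<phi> has_field_derivative deriv \<phi> z) (at z)" if "z \<in> unit_disk" for z
      by (rule holomorphic_derivI[OF h _ that]) simp
    have "(\<lambda>z. indicator (\<phi> ` unit_disk) z *\<^sub>R F z) \<in> borel_measurable borel"
      by (rule borel_measurable_continuous_on_indicator) (use op F sub continuous_on_subset in auto)
    then show "(\<lambda>z. indicator (\<phi> ` unit_disk) z * F z) \<in> borel_measurable borel" by simp
    have "continuous_on unit_disk (\<lambda>z. F (\<phi> z))"
      by (rule continuous_on_compose2[OF F(1) c(1) sub])
    then have "(\<lambda>z. indicator unit_disk z *\<^sub>R ((cmod (deriv \<phi> z))\<^sup>2 * F (\<phi> z))) \<in> borel_measurable borel"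
      by (intro borel_measurable_continuous_on_indicator continuous_intros c) auto
    then show "(\<lambda>z. indicator unit_disk z * ((cmod (deriv \<phi> z))\<^sup>2 * F (\<phi> z))) \<in> borel_measurable borel" by simp
  qed simp
  moreover have "(\<integral>\<^sup>+z. ennreal (indicator (\<phi> ` unit_disk) z * F z) \<partial>lborel) \<le>
     (\<integral>\<^sup>+z. ennreal (indicator unit_disk z * F z) \<partial>lborel)"
    by (intro nn_integral_mono ennreal_leI mult_right_mono F) (use sub in \<open>auto simp: indicator_def\<close>)
  ultimately show ?thesis by simp
qed

lemma ennreal_combine:
  assumes "0 \<le> k" "0 \<le> p" "0 \<le> q" "0 \<le> x" "0 \<le> y"
  shows "ennreal k * (ennreal p * (ennreal x * E) + ennreal q * (ennreal y * E)) = ennreal (k * (p * x + q * y)) * E"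
  using assms by (simp add: mult_nonneg_nonneg ennreal_mult ennreal_plus distrib_left distrib_right mult_ac)

lemma ennreal_combine':
  assumes "0 \<le> u" "0 \<le> v" "0 \<le> w"
  shows "ennreal u * E + ennreal v * (ennreal w * E) = ennreal (u + v * w) * E"
  using assms by (simp add: mult_nonneg_nonneg ennreal_mult ennreal_plus distrib_left distrib_right mult_ac)

text \<open>For negative \<open>\<alpha>\<close> the weight at \<open>z\<close> is not bounded by a multiple of the weight at \<open>\<phi> z\<close>: the first
  one blows up at the circle even where \<open>\<phi>\<close> stays away from it. After one more derivative the
  exponent is \<open>\<alpha> + 2 > 0\<close>, and then the hypothesis on \<open>K\<close> compares the weights in the direction that
  is needed. The constant is independent of \<open>g\<close>.\<close>

lemma bergman_energy_compose_deriv_le: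
  assumes b: "-1 < \<alpha>"
    and h: "\<phi> holomorphic_on unit_disk" and inj: "inj_on \<phi> unit_disk" and sub: "\<phi> ` unit_disk \<subseteq> unit_disk"
    and A: "\<And>z. z \<in> unit_disk \<Longrightarrow> cmod (deriv \<phi> z) \<le> A"
    and B: "\<And>z. z \<in> unit_disk \<Longrightarrow> cmod (deriv (deriv \<phi>) z) \<le> B * cmod (deriv \<phi> z)"
    and K: "0 < K" "\<And>z. z \<in> unit_disk \<Longrightarrow> 1 - (cmod z)\<^sup>2 \<le> K * (1 - (cmod (\<phi> z))\<^sup>2)"
  shows "\<exists>C>0. \<forall>g. g holomorphic_on unit_disk \<longrightarrow>
     bergman_energy \<alpha> (\<lambda>z. g (\<phi> z) * deriv \<phi> z) \<le> ennreal C * bergman_energy \<alpha> g"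
proof -
  let ?s = "\<alpha> + 2"
  \<comment> \<open>The summand 1 makes \<open>C\<close> positive, so that functions of infinite energy need no further argument.\<close>
  define C where "C = 1 + A\<^sup>2 * (1 - (cmod (\<phi> 0))\<^sup>2) powr (- ?s) +
    1 / ?s * (K powr ?s * (2 * A\<^sup>2 * (?s * (\<alpha> + 3)) + 2 * B\<^sup>2 * ((\<alpha> + 3) / (\<alpha> + 1))))"
  have C0: "0 < C"
  proof -
    have n1: "0 \<le> 2 * A\<^sup>2 * (?s * (\<alpha> + 3))" and n2: "0 \<le> 2 * B\<^sup>2 * ((\<alpha> + 3) / (\<alpha> + 1))"
      using b by (intro mult_nonneg_nonneg; simp)+
    have "0 \<le> 1 / ?s * (K powr ?s * (2 * A\<^sup>2 * (?s * (\<alpha> + 3)) + 2 * B\<^sup>2 * ((\<alpha> + 3) / (\<alpha> + 1))))"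
      using b by (intro mult_nonneg_nonneg add_nonneg_nonneg[OF n1 n2]) auto
    then show ?thesis unfolding C_def by (intro add_pos_nonneg) auto
  qed
  have "bergman_energy \<alpha> (\<lambda>z. g (\<phi> z) * deriv \<phi> z) \<le> ennreal C * bergman_energy \<alpha> g"
    if g: "g holomorphic_on unit_disk" for g
  proof (cases "bergman_energy \<alpha> g = \<infinity>")
    case True
    then show ?thesis using C0 by (simp add: ennreal_mult_top)
  next
    case False
    let ?h = "\<lambda>z. g (\<phi> z) * deriv \<phi> z"
    have dphi: "deriv \<phi> holomorphic_on unit_disk" by (rule holomorphic_deriv[OF h]) simp
    have dg: "deriv g holomorphic_on unit_disk" by (rule holomorphic_deriv[OF g]) simp
    have gphi: "(\<lambda>z. g (\<phi> z)) holomorphic_on unit_disk"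
      using holomorphic_on_compose_gen[OF h g] sub by (simp add: o_def image_subset_iff_funcset)
    have hh: "?h holomorphic_on unit_disk" by (intro holomorphic_intros gphi dphi)
    have cg: "continuous_on unit_disk g" "continuous_on unit_disk (deriv g)"
      using holomorphic_on_imp_continuous_on g dg by blast+
    have phiD: "\<phi> z \<in> unit_disk" if "z \<in> unit_disk" for z using sub that by blast
    have der: "deriv ?h z = deriv g (\<phi> z) * (deriv \<phi> z)\<^sup>2 + g (\<phi> z) * deriv (deriv \<phi>) z" if "z \<in> unit_disk" for z
    proof (rule DERIV_imp_deriv)
      have 1: "(\<phi> has_field_derivative deriv \<phi> z) (at z)" by (rule holomorphic_derivI[OF h _ that]) simp
      have 2: "(deriv \<phi> has_field_derivative deriv (deriv \<phi>) z) (at z)" by (rule holomorphic_derivI[OF dphi _ that]) simp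
      have 3: "(g has_field_derivative deriv g (\<phi> z)) (at (\<phi> z))" by (rule holomorphic_derivI[OF g _ phiD[OF that]]) simp
      have 4: "((\<lambda>z. g (\<phi> z)) has_field_derivative deriv g (\<phi> z) * deriv \<phi> z) (at z)"
        using DERIV_chain2[OF 3 1] .
      show "(?h has_field_derivative deriv g (\<phi> z) * (deriv \<phi> z)\<^sup>2 + g (\<phi> z) * deriv (deriv \<phi>) z) (at z)"
        using DERIV_mult[OF 4 2] by (simp add: power2_eq_square mult_ac add.commute)
    qed
    let ?F = "\<lambda>w. (1 - (cmod w)\<^sup>2) powr ?s * (2 * A\<^sup>2 * (cmod (deriv g w))\<^sup>2 + 2 * B\<^sup>2 * (cmod (g w))\<^sup>2)"
    have pt: "(1 - (cmod z)\<^sup>2) powr ?s * (cmod (deriv ?h z))\<^sup>2 \<le> K powr ?s * ((cmod (deriv \<phi> z))\<^sup>2 * ?F (\<phi> z))"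
      if z: "z \<in> unit_disk" for z
    proof -
      have p1: "0 \<le> 1 - (cmod z)\<^sup>2" using z by (simp add: power_le_one)
      have p2: "0 \<le> 1 - (cmod (\<phi> z))\<^sup>2" using phiD[OF z] by (simp add: power_le_one)
      have "(1 - (cmod z)\<^sup>2) powr ?s \<le> (K * (1 - (cmod (\<phi> z))\<^sup>2)) powr ?s"
        using b p1 K(2)[OF z] by (intro powr_mono2) auto
      also have "\<dots> = K powr ?s * (1 - (cmod (\<phi> z))\<^sup>2) powr ?s" by (simp add: powr_mult)
      finally have w: "(1 - (cmod z)\<^sup>2) powr ?s \<le> K powr ?s * (1 - (cmod (\<phi> z))\<^sup>2) powr ?s" .
      let ?x = "cmod (deriv g (\<phi> z))" and ?y = "cmod (g (\<phi> z))" and ?d = "cmod (deriv \<phi> z)"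
      have "cmod (deriv ?h z) \<le> ?x * ?d\<^sup>2 + ?y * cmod (deriv (deriv \<phi>) z)"
        unfolding der[OF z] using norm_triangle_ineq by (metis norm_mult norm_power)
      also have "\<dots> \<le> ?x * (A * ?d) + ?y * (B * ?d)"
        using A[OF z] B[OF z] by (intro add_mono mult_left_mono) (auto simp: power2_eq_square mult_right_mono)
      also have "\<dots> = ?d * (A * ?x + B * ?y)" by (simp add: algebra_simps)
      finally have "(cmod (deriv ?h z))\<^sup>2 \<le> (?d * (A * ?x + B * ?y))\<^sup>2" by (intro power_mono) auto
      also have "\<dots> = ?d\<^sup>2 * (A * ?x + B * ?y)\<^sup>2" by (simp add: power_mult_distrib)
      also have "(A * ?x + B * ?y)\<^sup>2 \<le> 2 * A\<^sup>2 * ?x\<^sup>2 + 2 * B\<^sup>2 * ?y\<^sup>2"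
        using zero_le_power2[of "A * ?x - B * ?y"] by (simp add: power2_eq_square algebra_simps)
      finally have "(cmod (deriv ?h z))\<^sup>2 \<le> ?d\<^sup>2 * (2 * A\<^sup>2 * ?x\<^sup>2 + 2 * B\<^sup>2 * ?y\<^sup>2)" by (simp add: mult_left_mono)
      with w have "(1 - (cmod z)\<^sup>2) powr ?s * (cmod (deriv ?h z))\<^sup>2 \<le>
          (K powr ?s * (1 - (cmod (\<phi> z))\<^sup>2) powr ?s) * (?d\<^sup>2 * (2 * A\<^sup>2 * ?x\<^sup>2 + 2 * B\<^sup>2 * ?y\<^sup>2))"
        by (intro mult_mono) auto
      then show ?thesis by (simp add: mult_ac)
    qed
    have cF: "continuous_on unit_disk ?F"
      by (intro continuous_intros cg) ((metis one_minus_norm_square_pos less_irrefl) | simp)+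
    have "(\<integral>\<^sup>+z. ennreal (indicator unit_disk z * ((1 - (cmod z)\<^sup>2) powr ?s * (cmod (deriv ?h z))\<^sup>2)) \<partial>lborel)
      \<le> (\<integral>\<^sup>+z. ennreal (K powr ?s) * ennreal (indicator unit_disk z * ((cmod (deriv \<phi> z))\<^sup>2 * ?F (\<phi> z))) \<partial>lborel)"
      by (intro nn_integral_mono, subst ennreal_mult'[symmetric])
        (auto intro!: ennreal_leI pt simp: indicator_def)
    also have "\<dots> = ennreal (K powr ?s) * (\<integral>\<^sup>+z. ennreal (indicator unit_disk z * ((cmod (deriv \<phi> z))\<^sup>2 * ?F (\<phi> z))) \<partial>lborel)"
    proof (rule nn_integral_cmult)
      have "(\<lambda>z. indicator unit_disk z *\<^sub>R ((cmod (deriv \<phi> z))\<^sup>2 * ?F (\<phi> z))) \<in> borel_measurable borel"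
        by (intro borel_measurable_continuous_on_indicator continuous_on_mult
            continuous_on_compose2[OF cF holomorphic_on_imp_continuous_on[OF h] sub]
            continuous_on_power continuous_on_norm holomorphic_on_imp_continuous_on[OF dphi]) simp
      then show "(\<lambda>z. ennreal (indicator unit_disk z * ((cmod (deriv \<phi> z))\<^sup>2 * ?F (\<phi> z)))) \<in> borel_measurable lborel"
        by simp
    qed
    also have "\<dots> \<le> ennreal (K powr ?s) * (\<integral>\<^sup>+z. ennreal (indicator unit_disk z * ?F z) \<partial>lborel)"
      by (intro mult_left_mono nn_integral_compose_univalent_le[OF h inj sub cF]) auto
    finally have I: "(\<integral>\<^sup>+z. ennreal (indicator unit_disk z * ((1 - (cmod z)\<^sup>2) powr ?s * (cmod (deriv ?h z))\<^sup>2)) \<partial>lborel)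
      \<le> ennreal (K powr ?s) * (\<integral>\<^sup>+z. ennreal (indicator unit_disk z * ?F z) \<partial>lborel)" .
    have m: "(\<lambda>z. ennreal (indicator unit_disk z * ((1 - (cmod z)\<^sup>2) powr ?s * (cmod (u z))\<^sup>2))) \<in> borel_measurable lborel"
      if "continuous_on unit_disk u" for u :: "complex \<Rightarrow> complex"
    proof -
      have "(\<lambda>z. indicator unit_disk z *\<^sub>R ((1 - (cmod z)\<^sup>2) powr ?s * (cmod (u z))\<^sup>2)) \<in> borel_measurable borel"
        by (intro borel_measurable_continuous_on_indicator continuous_intros that) ((metis one_minus_norm_square_pos less_irrefl) | simp)+
      then show ?thesis by simp
    qed
    have "(\<integral>\<^sup>+z. ennreal (indicator unit_disk z * ?F z) \<partial>lborel) =
      (\<integral>\<^sup>+z. ennreal (2 * A\<^sup>2) * ennreal (indicator unit_disk z * ((1 - (cmod z)\<^sup>2) powr ?s * (cmod (deriv g z))\<^sup>2)) +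
        ennreal (2 * B\<^sup>2) * ennreal (indicator unit_disk z * ((1 - (cmod z)\<^sup>2) powr ?s * (cmod (g z))\<^sup>2)) \<partial>lborel)"
      by (intro nn_integral_cong) (auto simp: indicator_def ennreal_mult[symmetric] ennreal_plus[symmetric] algebra_simps simp del: ennreal_plus)
    also have "\<dots> = ennreal (2 * A\<^sup>2) * (\<integral>\<^sup>+z. ennreal (indicator unit_disk z * ((1 - (cmod z)\<^sup>2) powr ?s * (cmod (deriv g z))\<^sup>2)) \<partial>lborel) +
        ennreal (2 * B\<^sup>2) * (\<integral>\<^sup>+z. ennreal (indicator unit_disk z * ((1 - (cmod z)\<^sup>2) powr ?s * (cmod (g z))\<^sup>2)) \<partial>lborel)"
      by (subst nn_integral_add) (use m cg in \<open>auto simp: nn_integral_cmult\<close>)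
    finally have J: "(\<integral>\<^sup>+z. ennreal (indicator unit_disk z * ?F z) \<partial>lborel) = \<dots>" .
    have b2: "-1 < ?s" using b by simp
    have ch: "continuous_on unit_disk (deriv ?h)"
      by (rule holomorphic_on_imp_continuous_on[OF holomorphic_deriv[OF hh]]) simp
    have "bergman_energy ?s (deriv ?h) \<le> ennreal ((1 + ?s) / pi) * (ennreal (K powr ?s) * (\<integral>\<^sup>+z. ennreal (indicator unit_disk z * ?F z) \<partial>lborel))"
      unfolding bergman_energy_lborel[OF ch b2] by (intro mult_left_mono I) auto
    also have "\<dots> = ennreal (K powr ?s) * (ennreal (2 * A\<^sup>2) * bergman_energy ?s (deriv g) + ennreal (2 * B\<^sup>2) * bergman_energy ?s g)"
      unfolding J bergman_energy_lborel[OF cg(1) b2] bergman_energy_lborel[OF cg(2) b2]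
      by (simp add: distrib_left mult_ac)
    also have "\<dots> \<le> ennreal (K powr ?s) * (ennreal (2 * A\<^sup>2) * (ennreal (?s * (\<alpha> + 3)) * bergman_energy \<alpha> g) +
       ennreal (2 * B\<^sup>2) * (ennreal ((\<alpha> + 3) / (\<alpha> + 1)) * bergman_energy \<alpha> g))"
      using bergman_energy_deriv(1)[OF b g] bergman_energy_weight_le[OF b cg(1)]
      by (intro mult_left_mono add_mono) auto
    also have "\<dots> = ennreal (K powr ?s * (2 * A\<^sup>2 * (?s * (\<alpha> + 3)) + 2 * B\<^sup>2 * ((\<alpha> + 3) / (\<alpha> + 1)))) * bergman_energy \<alpha> g"
      using b by (intro ennreal_combine) auto
    finally have E2: "bergman_energy ?s (deriv ?h) \<le> ennreal (K powr ?s * (2 * A\<^sup>2 * (?s * (\<alpha> + 3)) + 2 * B\<^sup>2 * ((\<alpha> + 3) / (\<alpha> + 1)))) * bergman_energy \<alpha> g" .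
    have int: "square_integrable \<alpha> g"
      using False set_integrable_square_iff(1)[OF cg(1)] by (simp add: less_top)
    have "(cmod (?h 0))\<^sup>2 = (cmod (deriv \<phi> 0))\<^sup>2 * (cmod (g (\<phi> 0)))\<^sup>2" by (simp add: norm_mult power_mult_distrib)
    also have "\<dots> \<le> A\<^sup>2 * ((square_integral \<alpha> g) * (1 - (cmod (\<phi> 0))\<^sup>2) powr (- ?s))"
      using A[of 0] phiD[of 0] by (intro mult_mono norm_le_bergman_energy[OF b g _ int] power_mono) auto
    finally have "ennreal ((cmod (?h 0))\<^sup>2) \<le> ennreal (A\<^sup>2 * (1 - (cmod (\<phi> 0))\<^sup>2) powr (- ?s)) * bergman_energy \<alpha> g"
      unfolding set_integrable_square_iff(2)[OF cg(1) int]
      by (subst ennreal_mult'[symmetric]) (auto intro!: ennreal_leI simp: mult_ac)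
    moreover have "ennreal (1 / ?s) * bergman_energy ?s (deriv ?h) \<le>
      ennreal (1 / ?s) * (ennreal (K powr ?s * (2 * A\<^sup>2 * (?s * (\<alpha> + 3)) + 2 * B\<^sup>2 * ((\<alpha> + 3) / (\<alpha> + 1)))) * bergman_energy \<alpha> g)"
      by (intro mult_left_mono E2) auto
    ultimately have "bergman_energy \<alpha> ?h \<le> ennreal (A\<^sup>2 * (1 - (cmod (\<phi> 0))\<^sup>2) powr (- ?s)) * bergman_energy \<alpha> g +
      ennreal (1 / ?s) * (ennreal (K powr ?s * (2 * A\<^sup>2 * (?s * (\<alpha> + 3)) + 2 * B\<^sup>2 * ((\<alpha> + 3) / (\<alpha> + 1)))) * bergman_energy \<alpha> g)"
      using bergman_energy_deriv(2)[OF b hh] add_mono order_trans by blast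
    also have "\<dots> = ennreal (C - 1) * bergman_energy \<alpha> g"
    proof -
      have n1: "0 \<le> 2 * A\<^sup>2 * (?s * (\<alpha> + 3))" and n2: "0 \<le> 2 * B\<^sup>2 * ((\<alpha> + 3) / (\<alpha> + 1))"
        using b by (intro mult_nonneg_nonneg; simp)+
      have C1: "C - 1 = A\<^sup>2 * (1 - (cmod (\<phi> 0))\<^sup>2) powr (- ?s) + 1 / ?s *
          (K powr ?s * (2 * A\<^sup>2 * (?s * (\<alpha> + 3)) + 2 * B\<^sup>2 * ((\<alpha> + 3) / (\<alpha> + 1))))"
        by (simp add: C_def)
      show ?thesis unfolding C1
        by (rule ennreal_combine') (use b in \<open>auto intro!: mult_nonneg_nonneg add_nonneg_nonneg[OF n1 n2]\<close>)
    qed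
    also have "\<dots> \<le> ennreal C * bergman_energy \<alpha> g"
      by (intro mult_right_mono ennreal_leI) auto
    finally show ?thesis .
  qed
  with C0 show ?thesis by blast
qed

section \<open>Linear fractional self-maps\<close>

context
  fixes a b c d :: complex
  assumes lf: "nonconst_lf_self_map a b c d"
begin

lemma lf_det: "a * d - b * c \<noteq> 0"
  using lf by (simp add: nonconst_lf_self_map_def)

lemma lf_numerator_le:
  assumes "cmod z \<le> 1"
  shows "cmod (a * z + b) \<le> cmod (c * z + d)"
proof -
  have "closure unit_disk \<subseteq> {z. cmod (a * z + b) \<le> cmod (c * z + d)}"
  proof (rule closure_minimal)
    show "unit_disk \<subseteq> {z. cmod (a * z + b) \<le> cmod (c * z + d)}"
    proof
      fix z assume z: "z \<in> unit_disk"
      then have "c * z + d \<noteq> 0" "linear_fractional a b c d z \<in> unit_disk"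
        using lf unfolding nonconst_lf_self_map_def by blast+
      then show "z \<in> {z. cmod (a * z + b) \<le> cmod (c * z + d)}"
        by (simp add: linear_fractional_def norm_divide divide_less_eq)
    qed
    show "closed {z. cmod (a * z + b) \<le> cmod (c * z + d)}"
      by (intro closed_Collect_le continuous_intros)
  qed
  then show ?thesis using assms by auto
qed

text \<open>A pole on the circle would force the numerator to vanish at the same point, since the map is
  bounded there, and then the determinant would be zero.\<close>

lemma lf_denominator_nonzero:
  assumes "cmod z \<le> 1"
  shows "c * z + d \<noteq> 0"
proof
  assume 0: "c * z + d = 0"
  then have "a * z + b = 0" using lf_numerator_le[OF assms] by simp
  then have "b = - (a * z)" "d = - (c * z)" using 0 by (simp_all add: add_eq_0_iff)
  then show False using lf_det by (simp add: algebra_simps)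
qed

lemma lf_maps_disk: "z \<in> unit_disk \<Longrightarrow> linear_fractional a b c d z \<in> unit_disk"
  using lf unfolding nonconst_lf_self_map_def by blast

lemma lf_norm_le_1: "cmod z \<le> 1 \<Longrightarrow> cmod (linear_fractional a b c d z) \<le> 1"
  using lf_numerator_le[of z] lf_denominator_nonzero[of z]
  by (simp add: linear_fractional_def norm_divide divide_le_eq)

lemma lf_denominator_bounds: "\<exists>l u. 0 < l \<and> (\<forall>z. cmod z \<le> 1 \<longrightarrow> l \<le> cmod (c * z + d) \<and> cmod (c * z + d) \<le> u)"
proof -
  have "compact (cball (0::complex) 1)" "continuous_on (cball 0 1) (\<lambda>z. cmod (c * z + d))"
    by (auto intro!: continuous_intros)
  then obtain z0 where z0: "z0 \<in> cball 0 1" "\<forall>z\<in>cball 0 1. cmod (c * z0 + d) \<le> cmod (c * z + d)"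
    using continuous_attains_inf[of "cball (0::complex) 1" "\<lambda>z. cmod (c * z + d)"] by auto
  have "0 < cmod (c * z0 + d)" using lf_denominator_nonzero[of z0] z0 by simp
  moreover have "cmod (c * z + d) \<le> cmod c + cmod d" if "cmod z \<le> 1" for z
  proof -
    have "cmod (c * z + d) \<le> cmod c * cmod z + cmod d" by (metis norm_mult norm_triangle_ineq)
    also have "\<dots> \<le> cmod c * 1 + cmod d" using that by (intro add_mono mult_left_mono) auto
    finally show ?thesis by simp
  qed
  ultimately show ?thesis using z0 by (intro exI[of _ "cmod (c * z0 + d)"] exI[of _ "cmod c + cmod d"]) auto
qed

lemma lf_has_derivative:
  assumes "cmod z \<le> 1"
  shows "(linear_fractional a b c d has_field_derivative (a * d - b * c) / (c * z + d)\<^sup>2) (at z)"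
  unfolding linear_fractional_def[abs_def]
  using lf_denominator_nonzero[OF assms]
  by (auto intro!: derivative_eq_intros simp: power2_eq_square algebra_simps)

lemma lf_deriv: "cmod z \<le> 1 \<Longrightarrow> deriv (linear_fractional a b c d) z = (a * d - b * c) / (c * z + d)\<^sup>2"
  by (rule DERIV_imp_deriv[OF lf_has_derivative])

lemma lf_holomorphic: "linear_fractional a b c d holomorphic_on unit_disk"
  by (auto simp: holomorphic_on_open intro!: lf_has_derivative exI)

lemma lf_continuous: "continuous_on (cball 0 1) (linear_fractional a b c d)"
  by (intro continuous_at_imp_continuous_on ballI) (metis DERIV_isCont lf_has_derivative mem_cball_0)

lemma lf_inj: "inj_on (linear_fractional a b c d) (cball 0 1)"
proof (rule inj_onI)
  fix x y assume xy: "x \<in> cball 0 1" "y \<in> cball 0 1" and e: "linear_fractional a b c d x = linear_fractional a b c d y"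
  then have nz: "c * x + d \<noteq> 0" "c * y + d \<noteq> 0" using lf_denominator_nonzero by auto
  from e nz have "(a * x + b) * (c * y + d) = (a * y + b) * (c * x + d)"
    by (simp add: linear_fractional_def frac_eq_eq)
  then have "(a * d - b * c) * (x - y) = 0" by (simp add: algebra_simps)
  then show "x = y" using lf_det by simp
qed

lemma lf_deriv_bounds:
  "\<exists>l u. 0 < l \<and> (\<forall>z. cmod z \<le> 1 \<longrightarrow> l \<le> cmod (deriv (linear_fractional a b c d) z) \<and>
     cmod (deriv (linear_fractional a b c d) z) \<le> u)"
proof -
  obtain l u where l: "0 < l" and lu: "\<And>z. cmod z \<le> 1 \<Longrightarrow> l \<le> cmod (c * z + d) \<and> cmod (c * z + d) \<le> u"
    using lf_denominator_bounds by blast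
  have u: "0 < u" using l lu[of 0] by simp
  let ?D = "cmod (a * d - b * c)"
  have D: "0 < ?D" using lf_det by simp
  have "?D / u\<^sup>2 \<le> cmod (deriv (linear_fractional a b c d) z) \<and> cmod (deriv (linear_fractional a b c d) z) \<le> ?D / l\<^sup>2"
    if "cmod z \<le> 1" for z
    using lu[OF that] l u D
    by (auto simp: lf_deriv[OF that] norm_divide norm_power intro!: divide_left_mono power_mono mult_pos_pos zero_less_power)
  then show ?thesis using D u by (intro exI[of _ "?D / u\<^sup>2"] exI[of _ "?D / l\<^sup>2"]) auto
qed

lemma lf_deriv2_bound:
  "\<exists>B. \<forall>z\<in>unit_disk. cmod (deriv (deriv (linear_fractional a b c d)) z) \<le> B * cmod (deriv (linear_fractional a b c d) z)"
proof -
  obtain l u where l: "0 < l" and lu: "\<And>z. cmod z \<le> 1 \<Longrightarrow> l \<le> cmod (c * z + d) \<and> cmod (c * z + d) \<le> u"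
    using lf_denominator_bounds by blast
  have "cmod (deriv (deriv (linear_fractional a b c d)) z) \<le> (2 * cmod c / l) * cmod (deriv (linear_fractional a b c d) z)"
    if z: "z \<in> unit_disk" for z
  proof -
    have nz: "c * z + d \<noteq> 0" using lf_denominator_nonzero[of z] z by simp
    have "((\<lambda>z. (a * d - b * c) / (c * z + d)\<^sup>2) has_field_derivative
        (- 2 * c / (c * z + d)) * ((a * d - b * c) / (c * z + d)\<^sup>2)) (at z)"
      using nz by (auto intro!: derivative_eq_intros simp: power2_eq_square divide_simps)
    then have "(deriv (linear_fractional a b c d) has_field_derivative
        (- 2 * c / (c * z + d)) * ((a * d - b * c) / (c * z + d)\<^sup>2)) (at z)"
      by (rule has_field_derivative_transform_within_open[of _ _ _ unit_disk]) (use z in \<open>auto simp: lf_deriv\<close>)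
    then have e: "deriv (deriv (linear_fractional a b c d)) z = (- 2 * c / (c * z + d)) * deriv (linear_fractional a b c d) z"
      using z by (simp add: DERIV_imp_deriv lf_deriv)
    have "cmod (- 2 * c / (c * z + d)) \<le> 2 * cmod c / l"
      using lu[of z] z l nz by (auto simp: norm_divide norm_mult intro!: divide_left_mono)
    then show ?thesis unfolding e norm_mult by (rule mult_right_mono) simp
  qed
  then show ?thesis by blast
qed

lemma lf_Lipschitz:
  "\<exists>L>0. \<forall>z w. cmod z \<le> 1 \<longrightarrow> cmod w \<le> 1 \<longrightarrow>
     cmod (linear_fractional a b c d z - linear_fractional a b c d w) \<le> L * cmod (z - w)"
proof -
  obtain l u where u: "\<And>z. cmod z \<le> 1 \<Longrightarrow> cmod (deriv (linear_fractional a b c d) z) \<le> u"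
    using lf_deriv_bounds by blast
  have "cmod (linear_fractional a b c d z - linear_fractional a b c d w) \<le> \<bar>u\<bar> * cmod (z - w)"
    if "cmod z \<le> 1" "cmod w \<le> 1" for z w
  proof (rule field_differentiable_bound[of "cball 0 1"])
    show "(linear_fractional a b c d has_field_derivative deriv (linear_fractional a b c d) x) (at x within cball 0 1)"
      if "x \<in> cball 0 1" for x
      using that lf_has_derivative[of x] lf_deriv[of x] by (simp add: has_field_derivative_at_within)
    show "cmod (deriv (linear_fractional a b c d) x) \<le> \<bar>u\<bar>" if "x \<in> cball 0 1" for x
      using u[of x] that by simp
  qed (use that in auto)
  then have "cmod (linear_fractional a b c d z - linear_fractional a b c d w) \<le> (\<bar>u\<bar> + 1) * cmod (z - w)"
    if "cmod z \<le> 1" "cmod w \<le> 1" for z w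
    using that by (smt (verit) mult_right_mono norm_ge_zero)
  then show ?thesis by (intro exI[of _ "\<bar>u\<bar> + 1"]) auto
qed

end

lemma one_minus_moebius_square:
  assumes "cmod p < 1" "cmod w \<le> 1"
  shows "1 - (cmod ((w - p) / (1 - cnj p * w)))\<^sup>2 = (1 - (cmod p)\<^sup>2) * (1 - (cmod w)\<^sup>2) / (cmod (1 - cnj p * w))\<^sup>2"
proof -
  have "cmod (cnj p * w) < 1" using assms by (cases "p = 0") (auto simp: norm_mult intro: le_less_trans[OF mult_left_le])
  then have nz: "1 - cnj p * w \<noteq> 0" by auto
  have "(cmod (1 - cnj p * w))\<^sup>2 - (cmod (w - p))\<^sup>2 = (1 - (cmod p)\<^sup>2) * (1 - (cmod w)\<^sup>2)"
    unfolding cmod_power2 by (simp add: power2_eq_square algebra_simps)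
  then show ?thesis using nz by (simp add: norm_divide power_divide field_simps)
qed

text \<open>The Schwarz lemma is applied to the composition with an automorphism that sends \<open>\<phi> 0\<close> to \<open>0\<close>.\<close>

lemma one_minus_norm_square_le_compose:
  assumes h: "\<phi> holomorphic_on unit_disk" and sub: "\<And>z. z \<in> unit_disk \<Longrightarrow> \<phi> z \<in> unit_disk"
  shows "\<exists>K>0. \<forall>z\<in>unit_disk. 1 - (cmod z)\<^sup>2 \<le> K * (1 - (cmod (\<phi> z))\<^sup>2)"
proof -
  define p where "p = \<phi> 0"
  have p: "cmod p < 1" using sub[of 0] by (simp add: p_def)
  let ?s = "\<lambda>z. (\<phi> z - p) / (1 - cnj p * \<phi> z)"
  define K where "K = (1 - (cmod p)\<^sup>2) / (1 - cmod p)\<^sup>2"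
  have K: "0 < K" using p by (simp add: K_def power_less_one_iff)
  have den: "1 - cmod p \<le> cmod (1 - cnj p * \<phi> z)" if "z \<in> unit_disk" for z
    using norm_one_minus_mult_ge[OF sub[OF that], of p] by (simp add: mult.commute)
  have s: "cmod (?s z) < 1" "1 - (cmod (?s z))\<^sup>2 \<le> K * (1 - (cmod (\<phi> z))\<^sup>2)" if z: "z \<in> unit_disk" for z
  proof -
    have e: "1 - (cmod (?s z))\<^sup>2 = (1 - (cmod p)\<^sup>2) * (1 - (cmod (\<phi> z))\<^sup>2) / (cmod (1 - cnj p * \<phi> z))\<^sup>2"
      using one_minus_moebius_square[OF p] sub[OF z] by simp
    have pos: "0 < (1 - (cmod p)\<^sup>2) * (1 - (cmod (\<phi> z))\<^sup>2)"
      using p sub[OF z] by (intro mult_pos_pos) (auto simp: power_less_one_iff)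
    have d0: "0 < cmod (1 - cnj p * \<phi> z)" using den[OF z] p by linarith
    have "0 < 1 - (cmod (?s z))\<^sup>2" unfolding e using pos d0 by simp
    then show "cmod (?s z) < 1" by (simp add: power_less_one_iff abs_square_less_1)
    have "(1 - (cmod p)\<^sup>2) * (1 - (cmod (\<phi> z))\<^sup>2) / (cmod (1 - cnj p * \<phi> z))\<^sup>2 \<le>
      (1 - (cmod p)\<^sup>2) * (1 - (cmod (\<phi> z))\<^sup>2) / (1 - cmod p)\<^sup>2"
      using pos den[OF z] p d0 by (intro divide_left_mono power_mono mult_pos_pos zero_less_power) auto
    then show "1 - (cmod (?s z))\<^sup>2 \<le> K * (1 - (cmod (\<phi> z))\<^sup>2)" unfolding e K_def by simp
  qed
  have "?s holomorphic_on unit_disk"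
  proof (intro holomorphic_intros h)
    show "1 - cnj p * \<phi> z \<noteq> 0" if "z \<in> unit_disk" for z using den[OF that] p by auto
  qed
  then have S: "cmod (?s z) \<le> cmod z" if "z \<in> unit_disk" for z
    using Schwarz_Lemma(1)[of ?s z] s(1) that by (simp add: p_def)
  have "1 - (cmod z)\<^sup>2 \<le> K * (1 - (cmod (\<phi> z))\<^sup>2)" if z: "z \<in> unit_disk" for z
  proof -
    have "(cmod (?s z))\<^sup>2 \<le> (cmod z)\<^sup>2" using S[OF z] by (intro power_mono) auto
    then show ?thesis using s(2)[OF z] by linarith
  qed
  then show ?thesis using K by blast
qed

lemma lf_bergman_energy_compose_le:
  assumes "-1 < \<alpha>" and lf: "nonconst_lf_self_map a b c d" and \<phi>: "\<phi> = linear_fractional a b c d"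
  shows "\<exists>C>0. \<forall>g. g holomorphic_on unit_disk \<longrightarrow>
     bergman_energy \<alpha> (\<lambda>z. g (\<phi> z) * deriv \<phi> z) \<le> ennreal C * bergman_energy \<alpha> g"
proof -
  have h: "\<phi> holomorphic_on unit_disk" using lf_holomorphic[OF lf] \<phi> by simp
  have sub: "\<And>z. z \<in> unit_disk \<Longrightarrow> \<phi> z \<in> unit_disk" using lf_maps_disk[OF lf] \<phi> by simp
  obtain K where K: "0 < K" "\<And>z. z \<in> unit_disk \<Longrightarrow> 1 - (cmod z)\<^sup>2 \<le> K * (1 - (cmod (\<phi> z))\<^sup>2)"
    using one_minus_norm_square_le_compose[OF h sub] by blast
  obtain A where A: "\<And>z. z \<in> unit_disk \<Longrightarrow> cmod (deriv \<phi> z) \<le> A"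
    using lf_deriv_bounds[OF lf] \<phi> by (metis less_imp_le mem_ball_0)
  obtain B where B: "\<And>z. z \<in> unit_disk \<Longrightarrow> cmod (deriv (deriv \<phi>) z) \<le> B * cmod (deriv \<phi> z)"
    using lf_deriv2_bound[OF lf] \<phi> by blast
  have inj: "inj_on \<phi> unit_disk" using lf_inj[OF lf] \<phi> by (auto intro: inj_on_subset)
  show ?thesis
    by (rule bergman_energy_compose_deriv_le[OF assms(1) h inj _ A B K]) (use sub in auto)
qed

text \<open>The reason is that \<open>\<psi> y * x \<noteq> 1\<close> for \<open>|x| < 1\<close> and \<open>|y| \<le> 1\<close>. Without denominators this says that
  \<open>(a x - c) y \<noteq> d - b x\<close>, so the quotient \<open>(d - b x) / (a x - c)\<close> is never a point of the closed disk.\<close>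

lemma krein_adjoint_lf_self_map:
  assumes lf: "nonconst_lf_self_map a b c d"
  shows "nonconst_lf_self_map (cnj a) (- cnj c) (- cnj b) (cnj d)"
proof -
  have less: "cmod (a * x - c) < cmod (d - b * x)" if x: "cmod x < 1" for x
  proof (rule ccontr)
    assume n: "\<not> ?thesis"
    have ne: "(a * x - c) * y \<noteq> d - b * x" if y: "cmod y \<le> 1" for y
    proof
      assume "(a * x - c) * y = d - b * x"
      then have "(a * y + b) * x = c * y + d" by (simp add: algebra_simps)
      moreover have "cmod ((a * y + b) * x) < cmod (c * y + d)"
      proof -
        have "cmod ((a * y + b) * x) \<le> cmod (c * y + d) * cmod x"
          using lf_numerator_le[OF lf y] by (simp add: norm_mult mult_right_mono)
        also have "\<dots> < cmod (c * y + d) * 1"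
          using lf_denominator_nonzero[OF lf y] x by (intro mult_strict_left_mono) auto
        finally show ?thesis by simp
      qed
      ultimately show False by simp
    qed
    show False
    proof (cases "a * x - c = 0")
      case True
      then have "d - b * x = 0" using n by simp
      then show False using ne[of 0] by simp
    next
      case False
      then have "cmod ((d - b * x) / (a * x - c)) \<le> 1"
        using n by (simp add: norm_divide divide_le_eq)
      from ne[OF this] False show False by simp
    qed
  qed
  have cx: "cmod (cnj a * z + - cnj c) = cmod (a * cnj z - c)" "cmod (- cnj b * z + cnj d) = cmod (d - b * cnj z)" for z
    by (subst complex_mod_cnj[symmetric], simp)+
  have "- cnj b * z + cnj d \<noteq> 0 \<and> linear_fractional (cnj a) (- cnj c) (- cnj b) (cnj d) z \<in> unit_disk"
    if z: "z \<in> unit_disk" for z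
  proof -
    have "cmod (cnj a * z + - cnj c) < cmod (- cnj b * z + cnj d)"
      unfolding cx using less[of "cnj z"] z by simp
    then show ?thesis by (auto simp: linear_fractional_def norm_divide divide_less_eq)
  qed
  moreover have "cnj a * cnj d - (- cnj c) * (- cnj b) \<noteq> 0"
    using lf_det[OF lf] by (metis complex_cnj_cancel_iff complex_cnj_diff complex_cnj_mult complex_cnj_zero minus_mult_minus mult.commute)
  ultimately show ?thesis unfolding nonconst_lf_self_map_def by auto
qed

lemma lf_compose:
  assumes 1: "nonconst_lf_self_map a b c d" and 2: "nonconst_lf_self_map a' b' c' d'"
  shows "\<exists>p q s t. nonconst_lf_self_map p q s t \<and>
    (\<forall>z. cmod z \<le> 1 \<longrightarrow> linear_fractional a b c d (linear_fractional a' b' c' d' z) = linear_fractional p q s t z)"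
proof -
  define p q s t where "p = a * a' + b * c'" and "q = a * b' + b * d'" and "s = c * a' + d * c'" and "t = c * b' + d * d'"
  note defs = p_def q_def s_def t_def
  have e: "s * z + t \<noteq> 0 \<and> linear_fractional a b c d (linear_fractional a' b' c' d' z) = linear_fractional p q s t z"
    if z: "cmod z \<le> 1" for z
  proof -
    let ?w = "linear_fractional a' b' c' d' z"
    have n2: "c' * z + d' \<noteq> 0" by (rule lf_denominator_nonzero[OF 2 z])
    have n1: "c * ?w + d \<noteq> 0" by (rule lf_denominator_nonzero[OF 1 lf_norm_le_1[OF 2 z]])
    have den: "s * z + t = (c * ?w + d) * (c' * z + d')"
      using n2 by (simp add: defs linear_fractional_def field_simps)
    have num: "p * z + q = (a * ?w + b) * (c' * z + d')"
      using n2 by (simp add: defs linear_fractional_def field_simps)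
    have "linear_fractional p q s t z = (p * z + q) / (s * z + t)" by (simp add: linear_fractional_def)
    also have "\<dots> = (a * ?w + b) / (c * ?w + d)" unfolding num den using n2 by simp
    also have "\<dots> = linear_fractional a b c d ?w" by (simp add: linear_fractional_def)
    finally show ?thesis using n1 n2 den by simp
  qed
  have "p * t - q * s = (a * d - b * c) * (a' * d' - b' * c')" by (simp add: defs algebra_simps)
  then have "p * t - q * s \<noteq> 0" using lf_det[OF 1] lf_det[OF 2] by simp
  moreover have "linear_fractional p q s t z \<in> unit_disk" if "z \<in> unit_disk" for z
    using e[of z] lf_maps_disk[OF 1 lf_maps_disk[OF 2 that]] that by simp
  ultimately have "nonconst_lf_self_map p q s t" unfolding nonconst_lf_self_map_def using e by force
  then show ?thesis using e by blast
qed

text \<open>For \<open>|\<omega>| = 1\<close> the right-hand side says that the Krein adjoint maps \<open>\<xi>\<close> to \<open>\<omega>\<close>: on the circle it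
  inverts \<open>\<psi>\<close>. For \<open>|\<omega>| < 1\<close> both sides are false.\<close>

lemma krein_adjoint_circle:
  assumes lf: "nonconst_lf_self_map a b c d" and \<omega>: "cmod \<omega> \<le> 1" and \<xi>: "cmod \<xi> = 1"
  shows "linear_fractional a b c d \<omega> = \<xi> \<longleftrightarrow> krein_adjoint a b c d \<xi> * cnj \<omega> = 1"
proof -
  have n1: "c * \<omega> + d \<noteq> 0" by (rule lf_denominator_nonzero[OF lf \<omega>])
  have n2: "- cnj b * \<xi> + cnj d \<noteq> 0"
    by (rule lf_denominator_nonzero[OF krein_adjoint_lf_self_map[OF lf]]) (use \<xi> in simp)
  have \<xi>1: "\<xi> * cnj \<xi> = 1" using \<xi> by (simp add: complex_norm_square[symmetric])
  have "linear_fractional a b c d \<omega> = \<xi> \<longleftrightarrow> a * \<omega> + b = \<xi> * (c * \<omega> + d)"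
    using n1 by (simp add: linear_fractional_def divide_eq_eq)
  also have "\<dots> \<longleftrightarrow> (a * \<omega> + b) * cnj \<xi> = c * \<omega> + d"
  proof
    assume "a * \<omega> + b = \<xi> * (c * \<omega> + d)"
    then have "(a * \<omega> + b) * cnj \<xi> = (\<xi> * cnj \<xi>) * (c * \<omega> + d)" by (simp add: mult_ac)
    then show "(a * \<omega> + b) * cnj \<xi> = c * \<omega> + d" by (simp add: \<xi>1)
  next
    assume "(a * \<omega> + b) * cnj \<xi> = c * \<omega> + d"
    then have "\<xi> * (c * \<omega> + d) = (\<xi> * cnj \<xi>) * (a * \<omega> + b)" by (metis mult.assoc mult.commute)
    then show "a * \<omega> + b = \<xi> * (c * \<omega> + d)" by (simp add: \<xi>1)
  qed
  also have "\<dots> \<longleftrightarrow> (a * cnj \<xi> - c) * \<omega> = d - b * cnj \<xi>" by (auto simp: algebra_simps)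
  also have "\<dots> \<longleftrightarrow> (cnj a * \<xi> + - cnj c) * cnj \<omega> = - cnj b * \<xi> + cnj d"
    by (subst complex_cnj_cancel_iff[symmetric]) simp
  also have "\<dots> \<longleftrightarrow> krein_adjoint a b c d \<xi> * cnj \<omega> = 1"
    using n2 by (simp add: krein_adjoint_def linear_fractional_def divide_eq_eq)
  finally show ?thesis .
qed

section \<open>The Dirichlet space as a Hilbert space\<close>

lemma power_series_disk_deriv:
  fixes b :: "nat \<Rightarrow> complex"
  assumes s: "\<And>z. z \<in> unit_disk \<Longrightarrow> (\<lambda>n. b n * z ^ n) sums g z" and z: "z \<in> unit_disk"
  shows "(\<lambda>n. of_nat (Suc n) * b (Suc n) * z ^ n) sums deriv g z"
proof -
  define K where "K = complex_of_real ((cmod z + 1) / 2)"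
  have K: "cmod z < cmod K" "K \<in> unit_disk" using z by (auto simp: K_def norm_divide simp del: of_real_divide)
  have smK: "summable (\<lambda>n. b n * K ^ n)" using s[OF K(2)] by (rule sums_summable)
  have D: "((\<lambda>x. \<Sum>n. b n * x ^ n) has_field_derivative (\<Sum>n. diffs b n * z ^ n)) (at z)"
    by (rule termdiffs_strong[OF smK K(1)])
  have "(g has_field_derivative (\<Sum>n. diffs b n * z ^ n)) (at z)"
    by (rule has_field_derivative_transform_within_open[OF D open_ball z])
      (use s in \<open>simp add: sums_iff\<close>)
  then have "deriv g z = (\<Sum>n. diffs b n * z ^ n)" by (rule DERIV_imp_deriv)
  moreover have "summable (\<lambda>n. diffs b n * z ^ n)"
    by (rule termdiff_converges[of z 1]) (use s z in \<open>auto intro: sums_summable\<close>)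
  ultimately show ?thesis by (simp add: diffs_def sums_iff)
qed

lemma deriv_cong_disk:
  assumes "\<And>z. z \<in> unit_disk \<Longrightarrow> f z = g z" "z \<in> unit_disk"
  shows "deriv f z = deriv g z"
  by (rule deriv_cong_ev) (use assms in \<open>auto intro!: eventually_nhds_in_open[of unit_disk, THEN eventually_mono]\<close>)

lemma holomorphic_disk_has_deriv:
  "f holomorphic_on unit_disk \<Longrightarrow> z \<in> unit_disk \<Longrightarrow> (f has_field_derivative deriv f z) (at z)"
  by (rule holomorphic_derivI[OF _ open_ball])

lemma continuous_on_deriv_disk: "f holomorphic_on unit_disk \<Longrightarrow> continuous_on unit_disk (deriv f)"
  by (intro holomorphic_on_imp_continuous_on holomorphic_deriv) auto

lemma deriv_lincomb:
  assumes "f holomorphic_on unit_disk" "g holomorphic_on unit_disk" "z \<in> unit_disk"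
  shows "deriv (\<lambda>z. a * f z + b * g z) z = a * deriv f z + b * deriv g z"
  using holomorphic_disk_has_deriv[OF assms(1,3)] holomorphic_disk_has_deriv[OF assms(2,3)]
  by (intro DERIV_imp_deriv) (auto intro!: derivative_eq_intros)

lemma energy_nonneg: "0 \<le> (square_integral \<alpha> u)"
  unfolding set_lebesgue_integral_def by (auto intro!: integral_nonneg_AE)

lemma dirichlet_norm_square:
  "(dirichlet_norm \<alpha> f)\<^sup>2 = (cmod (f 0))\<^sup>2 + (square_integral \<alpha> (deriv f))"
  unfolding dirichlet_norm_def by (simp add: energy_nonneg)

lemma dirichlet_norm_nonneg [simp]: "0 \<le> dirichlet_norm \<alpha> f"
  unfolding dirichlet_norm_def by (simp add: energy_nonneg)

lemma energy_le_norm: "(square_integral \<alpha> (deriv f)) \<le> (dirichlet_norm \<alpha> f)\<^sup>2"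
  unfolding dirichlet_norm_square by simp

lemma norm_at_0_le: "cmod (f 0) \<le> dirichlet_norm \<alpha> f"
  by (rule power2_le_imp_le) (auto simp: dirichlet_norm_square energy_nonneg)

text \<open>The element of the Dirichlet space that represents the functional \<open>f \<mapsto> f' w\<close>: the primitive of the
  Bergman kernel that vanishes at \<open>0\<close>, extended by zero outside the disk.\<close>

definition derivative_kernel :: "real \<Rightarrow> complex \<Rightarrow> complex \<Rightarrow> complex" where
  "derivative_kernel \<alpha> w = (SOME k. k \<in> dirichlet_space \<alpha> \<and> k 0 = 0 \<and> (\<forall>z\<in>unit_disk. deriv k z = bergman_kernel \<alpha> w z))"

text \<open>The square of the norm of the \<open>n\<close>-th monomial. The constant monomial is counted through its value
  at the origin, hence the separate case.\<close>

definition dirichlet_weight :: "real \<Rightarrow> nat \<Rightarrow> real" where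
  "dirichlet_weight \<alpha> n = (case n of 0 \<Rightarrow> 1 | Suc k \<Rightarrow> (real (Suc k))\<^sup>2 * bergman_moment \<alpha> k)"

definition disk_one :: "complex \<Rightarrow> complex" where
  "disk_one z = (if z \<in> unit_disk then 1 else 0)"

definition disk_monomial :: "nat \<Rightarrow> complex \<Rightarrow> complex" where
  "disk_monomial n z = (if z \<in> unit_disk then z ^ n else 0)"

lemma deriv_disk_monomial:
  assumes "z \<in> unit_disk"
  shows "deriv (disk_monomial n) z = of_nat n * z ^ (n - 1)"
proof -
  have "deriv (disk_monomial n) z = deriv (\<lambda>z. z ^ n) z"
    by (rule deriv_cong_disk[OF _ assms]) (simp add: disk_monomial_def)
  also have "\<dots> = of_nat n * z ^ (n - 1)"
    by (rule DERIV_imp_deriv) (auto intro!: derivative_eq_intros)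
  finally show ?thesis .
qed

definition disk_polynomial :: "(nat \<Rightarrow> complex) \<Rightarrow> nat \<Rightarrow> complex \<Rightarrow> complex" where
  "disk_polynomial a N z = (if z \<in> unit_disk then (\<Sum>n<N. a n * z ^ n) else 0)"

lemma disk_polynomial_Suc:
  "disk_polynomial a (Suc N) = (\<lambda>z. 1 * disk_polynomial a N z + a N * disk_monomial N z)"
  by (auto simp: disk_polynomial_def disk_monomial_def)

lemma disk_polynomial_sums:
  assumes "z \<in> unit_disk"
  shows "(\<lambda>n. (if n < N then a n else 0) * z ^ n) sums disk_polynomial a N z"
proof -
  have "(\<lambda>n. if n \<in> {..<N} then a n * z ^ n else 0) sums (\<Sum>n<N. a n * z ^ n)"
    by (rule sums_If_finite_set) simp
  moreover have "(\<lambda>n. (if n < N then a n else 0) * z ^ n) = (\<lambda>n. if n \<in> {..<N} then a n * z ^ n else 0)" by auto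
  ultimately show ?thesis using assms by (simp add: disk_polynomial_def)
qed

context
  fixes \<alpha> :: real
  assumes \<alpha>: "-1 < \<alpha>"
begin

lemma dirichlet_space_iff:
  "f \<in> dirichlet_space \<alpha> \<longleftrightarrow> f holomorphic_on unit_disk \<and> (\<forall>z. z \<notin> unit_disk \<longrightarrow> f z = 0) \<and>
     bergman_energy \<alpha> (deriv f) < \<infinity>"
  unfolding dirichlet_space_def using set_integrable_square_iff(1)[OF continuous_on_deriv_disk] by auto

lemma dirichlet_spaceD:
  assumes "f \<in> dirichlet_space \<alpha>"
  shows "f holomorphic_on unit_disk" "\<And>z. z \<notin> unit_disk \<Longrightarrow> f z = 0"
    "square_integrable \<alpha> (deriv f)"
    "continuous_on unit_disk (deriv f)" "deriv f holomorphic_on unit_disk"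
    "set_integrable (weighted_area \<alpha>) unit_disk (deriv f)"
proof -
  show 1: "f holomorphic_on unit_disk" and "\<And>z. z \<notin> unit_disk \<Longrightarrow> f z = 0"
    and 2: "square_integrable \<alpha> (deriv f)"
    using assms unfolding dirichlet_space_def by auto
  show 3: "continuous_on unit_disk (deriv f)" by (rule continuous_on_deriv_disk[OF 1])
  show "deriv f holomorphic_on unit_disk" by (rule holomorphic_deriv[OF 1]) simp
  show "set_integrable (weighted_area \<alpha>) unit_disk (deriv f)" by (rule set_integrable_of_square[OF \<alpha> 3 2])
qed

lemma dirichlet_lincomb:
  assumes f: "f \<in> dirichlet_space \<alpha>" and g: "g \<in> dirichlet_space \<alpha>"
  shows "(\<lambda>z. a * f z + b * g z) \<in> dirichlet_space \<alpha>"
proof -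
  let ?h = "\<lambda>z. a * f z + b * g z" and ?M = "weighted_area \<alpha>"
  note F = dirichlet_spaceD[OF f] and G = dirichlet_spaceD[OF g]
  have h: "?h holomorphic_on unit_disk" by (intro holomorphic_intros F G)
  have "set_integrable ?M unit_disk (\<lambda>z. 2 * (cmod a)\<^sup>2 * (cmod (deriv f z))\<^sup>2 + 2 * (cmod b)\<^sup>2 * (cmod (deriv g z))\<^sup>2)"
    by (intro set_integral_add set_integrable_mult_right F(3) G(3))
  then have "set_integrable ?M unit_disk (\<lambda>z. (cmod (deriv ?h z))\<^sup>2)"
    unfolding set_integrable_def
  proof (rule Bochner_Integration.integrable_bound)
    show "(\<lambda>z. indicator unit_disk z *\<^sub>R (cmod (deriv ?h z))\<^sup>2) \<in> borel_measurable ?M"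
      by (intro measurable_continuous_on_weighted_area continuous_intros continuous_on_deriv_disk h)
    have "(cmod (deriv ?h z))\<^sup>2 \<le> 2 * (cmod a)\<^sup>2 * (cmod (deriv f z))\<^sup>2 + 2 * (cmod b)\<^sup>2 * (cmod (deriv g z))\<^sup>2"
      if "z \<in> unit_disk" for z
    proof -
      have "cmod (deriv ?h z) \<le> cmod a * cmod (deriv f z) + cmod b * cmod (deriv g z)"
        unfolding deriv_lincomb[OF F(1) G(1) that] by (metis norm_mult norm_triangle_ineq)
      then have "(cmod (deriv ?h z))\<^sup>2 \<le> (cmod a * cmod (deriv f z) + cmod b * cmod (deriv g z))\<^sup>2"
        by (rule power_mono) simp
      also have "\<dots> \<le> 2 * (cmod a)\<^sup>2 * (cmod (deriv f z))\<^sup>2 + 2 * (cmod b)\<^sup>2 * (cmod (deriv g z))\<^sup>2"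
        using zero_le_power2[of "cmod a * cmod (deriv f z) - cmod b * cmod (deriv g z)"]
        by (simp add: power2_eq_square algebra_simps)
      finally show ?thesis .
    qed
    then show "AE z in ?M. norm (indicator unit_disk z *\<^sub>R (cmod (deriv ?h z))\<^sup>2) \<le>
        norm (indicator unit_disk z *\<^sub>R (2 * (cmod a)\<^sup>2 * (cmod (deriv f z))\<^sup>2 + 2 * (cmod b)\<^sup>2 * (cmod (deriv g z))\<^sup>2))"
      by (intro always_eventually) (auto simp: indicator_def)
  qed
  then show ?thesis unfolding dirichlet_space_def using h F(2) G(2) by auto
qed

lemma dirichlet_scale: "f \<in> dirichlet_space \<alpha> \<Longrightarrow> (\<lambda>z. a * f z) \<in> dirichlet_space \<alpha>"
  using dirichlet_lincomb[of f f a 0] by simp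

lemma dirichlet_diff: "f \<in> dirichlet_space \<alpha> \<Longrightarrow> g \<in> dirichlet_space \<alpha> \<Longrightarrow> (\<lambda>z. f z - g z) \<in> dirichlet_space \<alpha>"
  using dirichlet_lincomb[of f g 1 "-1"] by simp

lemma dirichlet_inner_lincomb_left:
  assumes f: "f \<in> dirichlet_space \<alpha>" and g: "g \<in> dirichlet_space \<alpha>" and h: "h \<in> dirichlet_space \<alpha>"
  shows "dirichlet_inner \<alpha> (\<lambda>z. a * f z + b * g z) h = a * dirichlet_inner \<alpha> f h + b * dirichlet_inner \<alpha> g h"
proof -
  let ?M = "weighted_area \<alpha>"
  note F = dirichlet_spaceD[OF f] and G = dirichlet_spaceD[OF g] and H = dirichlet_spaceD[OF h]
  have i: "set_integrable ?M unit_disk (\<lambda>z. deriv f z * cnj (deriv h z))"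
    "set_integrable ?M unit_disk (\<lambda>z. deriv g z * cnj (deriv h z))"
    by (rule set_integrable_product; rule F G H)+
  have "(LINT z:unit_disk|?M. deriv (\<lambda>z. a * f z + b * g z) z * cnj (deriv h z)) =
    (LINT z:unit_disk|?M. a * (deriv f z * cnj (deriv h z)) + b * (deriv g z * cnj (deriv h z)))"
    by (intro set_lebesgue_integral_cong) (auto simp: deriv_lincomb[OF F(1) G(1)] algebra_simps)
  also have "\<dots> = a * (LINT z:unit_disk|?M. deriv f z * cnj (deriv h z)) + b * (LINT z:unit_disk|?M. deriv g z * cnj (deriv h z))"
    using i by (subst set_integral_add) (auto intro!: set_integrable_mult_right)
  finally show ?thesis by (simp add: dirichlet_inner_def algebra_simps)
qed

lemma dirichlet_inner_commute: "dirichlet_inner \<alpha> g f = cnj (dirichlet_inner \<alpha> f g)"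
proof -
  have "cnj (LINT z:unit_disk|weighted_area \<alpha>. deriv f z * cnj (deriv g z)) =
        (LINT z:unit_disk|weighted_area \<alpha>. deriv g z * cnj (deriv f z))"
    unfolding set_lebesgue_integral_def
    by (subst Bochner_Integration.integral_cnj[symmetric], intro Bochner_Integration.integral_cong) auto
  then show ?thesis by (simp add: dirichlet_inner_def mult.commute)
qed

lemma dirichlet_inner_lincomb_right:
  assumes "f \<in> dirichlet_space \<alpha>" "g \<in> dirichlet_space \<alpha>" "h \<in> dirichlet_space \<alpha>"
  shows "dirichlet_inner \<alpha> h (\<lambda>z. a * f z + b * g z) = cnj a * dirichlet_inner \<alpha> h f + cnj b * dirichlet_inner \<alpha> h g"
  using dirichlet_inner_lincomb_left[OF assms, of a b] dirichlet_inner_commute[of h]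
  by (metis complex_cnj_add complex_cnj_mult)

lemma dirichlet_inner_self: "dirichlet_inner \<alpha> f f = complex_of_real ((dirichlet_norm \<alpha> f)\<^sup>2)"
proof -
  have "complex_of_real (square_integral \<alpha> (deriv f)) =
    (LINT z:unit_disk|weighted_area \<alpha>. deriv f z * cnj (deriv f z))"
    unfolding set_lebesgue_integral_def
    by (subst integral_complex_of_real[symmetric])
      (simp add: scaleR_conv_of_real complex_norm_square[symmetric])
  then show ?thesis unfolding dirichlet_norm_square dirichlet_inner_def
    by (simp add: complex_norm_square[symmetric])
qed

text \<open>The inner product is the sum of a product of numbers and an integral. The Cauchy-Schwarz inequality
  of the integral is combined with the one of the real plane.\<close>

lemma dirichlet_Cauchy_Schwarz:
  assumes f: "f \<in> dirichlet_space \<alpha>" and g: "g \<in> dirichlet_space \<alpha>"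
  shows "cmod (dirichlet_inner \<alpha> f g) \<le> dirichlet_norm \<alpha> f * dirichlet_norm \<alpha> g"
proof -
  define A where "A = (square_integral \<alpha> (deriv f))"
  define B where "B = (square_integral \<alpha> (deriv g))"
  define x y where "x = cmod (f 0)" and "y = cmod (g 0)"
  have AB: "0 \<le> A" "0 \<le> B" "0 \<le> x" "0 \<le> y" by (auto simp: A_def B_def energy_nonneg x_def y_def)
  have "cmod (dirichlet_inner \<alpha> f g) \<le> cmod (f 0 * cnj (g 0)) + cmod (LINT z:unit_disk|weighted_area \<alpha>. deriv f z * cnj (deriv g z))"
    unfolding dirichlet_inner_def by (rule norm_triangle_ineq)
  also have "\<dots> \<le> x * y + sqrt A * sqrt B"
    unfolding A_def B_def x_def y_def
    by (intro add_mono set_integrable_product(2) dirichlet_spaceD f g) (simp add: norm_mult)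
  also have "\<dots> \<le> sqrt (x\<^sup>2 + A) * sqrt (y\<^sup>2 + B)"
  proof (rule power2_le_imp_le)
    have "2 * (x * sqrt B) * (y * sqrt A) \<le> (x * sqrt B)\<^sup>2 + (y * sqrt A)\<^sup>2" by (rule sum_squares_bound)
    then have "(x * y + sqrt A * sqrt B)\<^sup>2 \<le> (x\<^sup>2 + A) * (y\<^sup>2 + B)"
      using AB by (simp add: power2_sum power_mult_distrib algebra_simps)
    then show "(x * y + sqrt A * sqrt B)\<^sup>2 \<le> (sqrt (x\<^sup>2 + A) * sqrt (y\<^sup>2 + B))\<^sup>2"
      using AB by (simp add: power_mult_distrib)
  qed (use AB in auto)
  finally show ?thesis unfolding dirichlet_norm_def A_def B_def x_def y_def .
qed

lemma dirichlet_norm_scale: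
  assumes f: "f \<in> dirichlet_space \<alpha>"
  shows "dirichlet_norm \<alpha> (\<lambda>z. a * f z) = cmod a * dirichlet_norm \<alpha> f"
proof -
  have af: "(\<lambda>z. a * f z) \<in> dirichlet_space \<alpha>" by (rule dirichlet_scale[OF f])
  have "complex_of_real ((dirichlet_norm \<alpha> (\<lambda>z. a * f z))\<^sup>2) = dirichlet_inner \<alpha> (\<lambda>z. a * f z) (\<lambda>z. a * f z)"
    by (rule dirichlet_inner_self[symmetric])
  also have "\<dots> = a * dirichlet_inner \<alpha> f (\<lambda>z. a * f z)"
    using dirichlet_inner_lincomb_left[OF f f af, of a 0] by simp
  also have "\<dots> = a * cnj a * dirichlet_inner \<alpha> f f"
    using dirichlet_inner_lincomb_right[OF f f f, of a 0] by simp
  also have "\<dots> = complex_of_real ((cmod a * dirichlet_norm \<alpha> f)\<^sup>2)"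
    by (simp add: dirichlet_inner_self power_mult_distrib complex_norm_square[symmetric])
  finally have "(dirichlet_norm \<alpha> (\<lambda>z. a * f z))\<^sup>2 = (cmod a * dirichlet_norm \<alpha> f)\<^sup>2" by (simp only: of_real_eq_iff)
  then show ?thesis by (rule power2_eq_imp_eq) auto
qed

lemma dirichlet_norm_triangle:
  assumes f: "f \<in> dirichlet_space \<alpha>" and g: "g \<in> dirichlet_space \<alpha>"
  shows "dirichlet_norm \<alpha> (\<lambda>z. f z + g z) \<le> dirichlet_norm \<alpha> f + dirichlet_norm \<alpha> g"
proof (rule power2_le_imp_le)
  have fg: "(\<lambda>z. f z + g z) \<in> dirichlet_space \<alpha>" using dirichlet_lincomb[OF f g, of 1 1] by simp
  have l: "dirichlet_inner \<alpha> (\<lambda>z. f z + g z) h = dirichlet_inner \<alpha> f h + dirichlet_inner \<alpha> g h"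
    if "h \<in> dirichlet_space \<alpha>" for h using dirichlet_inner_lincomb_left[OF f g that, of 1 1] by simp
  have r: "dirichlet_inner \<alpha> h (\<lambda>z. f z + g z) = dirichlet_inner \<alpha> h f + dirichlet_inner \<alpha> h g"
    if "h \<in> dirichlet_space \<alpha>" for h using dirichlet_inner_lincomb_right[OF f g that, of 1 1] by simp
  have "complex_of_real ((dirichlet_norm \<alpha> (\<lambda>z. f z + g z))\<^sup>2) =
    dirichlet_inner \<alpha> f f + dirichlet_inner \<alpha> g g + (dirichlet_inner \<alpha> f g + dirichlet_inner \<alpha> g f)"
    unfolding dirichlet_inner_self[symmetric] l[OF fg] r[OF f] r[OF g] by simp
  then have "(dirichlet_norm \<alpha> (\<lambda>z. f z + g z))\<^sup>2 =
     Re (dirichlet_inner \<alpha> f f + dirichlet_inner \<alpha> g g + (dirichlet_inner \<alpha> f g + dirichlet_inner \<alpha> g f))"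
    by (metis Re_complex_of_real)
  also have "\<dots> = (dirichlet_norm \<alpha> f)\<^sup>2 + (dirichlet_norm \<alpha> g)\<^sup>2 + 2 * Re (dirichlet_inner \<alpha> f g)"
    by (simp add: dirichlet_inner_self dirichlet_inner_commute[of g f] del: of_real_power)
  also have "\<dots> \<le> (dirichlet_norm \<alpha> f)\<^sup>2 + (dirichlet_norm \<alpha> g)\<^sup>2 + 2 * (dirichlet_norm \<alpha> f * dirichlet_norm \<alpha> g)"
    using dirichlet_Cauchy_Schwarz[OF f g] complex_Re_le_cmod[of "dirichlet_inner \<alpha> f g"] by simp
  also have "\<dots> = (dirichlet_norm \<alpha> f + dirichlet_norm \<alpha> g)\<^sup>2" by (simp add: power2_sum)
  finally show "(dirichlet_norm \<alpha> (\<lambda>z. f z + g z))\<^sup>2 \<le> (dirichlet_norm \<alpha> f + dirichlet_norm \<alpha> g)\<^sup>2" .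
qed auto

lemma dirichlet_norm_triangle_diff:
  assumes f: "f \<in> dirichlet_space \<alpha>" and g: "g \<in> dirichlet_space \<alpha>"
  shows "dirichlet_norm \<alpha> (\<lambda>z. f z - g z) \<le> dirichlet_norm \<alpha> f + dirichlet_norm \<alpha> g"
  using dirichlet_norm_triangle[OF f dirichlet_scale[OF g, of "-1"]] dirichlet_norm_scale[OF g, of "-1"] by simp

section \<open>Reproducing the derivative\<close>

lemma derivative_kernel_exists:
  assumes w: "w \<in> unit_disk"
  shows "\<exists>k. k \<in> dirichlet_space \<alpha> \<and> k 0 = 0 \<and> (\<forall>z\<in>unit_disk. deriv k z = bergman_kernel \<alpha> w z)"
proof -
  have h: "bergman_kernel \<alpha> w holomorphic_on unit_disk" by (rule bergman_kernel_holomorphic[OF w])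
  obtain G where G: "\<And>z. z \<in> unit_disk \<Longrightarrow> (G has_field_derivative bergman_kernel \<alpha> w z) (at z)"
    using holomorphic_convex_primitive'[of unit_disk "bergman_kernel \<alpha> w"] h
    by (metis at_within_open convex_ball open_ball)
  define k where "k z = (if z \<in> unit_disk then G z - G 0 else 0)" for z
  have kd: "(k has_field_derivative bergman_kernel \<alpha> w z) (at z)" if "z \<in> unit_disk" for z
  proof -
    have "((\<lambda>z. G z - G 0) has_field_derivative bergman_kernel \<alpha> w z) (at z)"
      using G[OF that] by (auto intro!: derivative_eq_intros)
    then show ?thesis
      by (rule has_field_derivative_transform_within_open[OF _ open_ball that]) (simp add: k_def)
  qed
  then have kh: "k holomorphic_on unit_disk" unfolding holomorphic_on_open[OF open_ball] by blast
  have kd': "deriv k z = bergman_kernel \<alpha> w z" if "z \<in> unit_disk" for z using kd[OF that] by (rule DERIV_imp_deriv)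
  have "bergman_energy \<alpha> (deriv k) = bergman_energy \<alpha> (bergman_kernel \<alpha> w)" by (rule bergman_energy_cong) (rule kd')
  also have "\<dots> < \<infinity>"
    using set_integrable_square_iff(1)[OF holomorphic_on_imp_continuous_on[OF h]] set_integrable_square_bergman_kernel[OF \<alpha> w] by blast
  finally have "k \<in> dirichlet_space \<alpha>" unfolding dirichlet_space_iff using kh by (simp add: k_def)
  then show ?thesis using kd' by (intro exI[of _ k]) (simp add: k_def)
qed

lemma derivative_kernel:
  assumes "w \<in> unit_disk"
  shows "derivative_kernel \<alpha> w \<in> dirichlet_space \<alpha>" "derivative_kernel \<alpha> w 0 = 0"
    "\<And>z. z \<in> unit_disk \<Longrightarrow> deriv (derivative_kernel \<alpha> w) z = bergman_kernel \<alpha> w z"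
  using someI_ex[OF derivative_kernel_exists[OF assms]] unfolding derivative_kernel_def by blast+

lemma inner_derivative_kernel:
  assumes f: "f \<in> dirichlet_space \<alpha>" and w: "w \<in> unit_disk"
  shows "dirichlet_inner \<alpha> f (derivative_kernel \<alpha> w) = deriv f w"
proof -
  have "(LINT z:unit_disk|weighted_area \<alpha>. deriv f z * cnj (deriv (derivative_kernel \<alpha> w) z)) =
        (LINT z:unit_disk|weighted_area \<alpha>. deriv f z * cnj (bergman_kernel \<alpha> w z))"
    by (intro set_lebesgue_integral_cong) (auto simp: derivative_kernel(3)[OF w])
  then show ?thesis
    using bergman_reproducing[OF \<alpha> dirichlet_spaceD(5)[OF f] w dirichlet_spaceD(6)[OF f]]
    by (simp add: dirichlet_inner_def derivative_kernel(2)[OF w])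
qed

lemma norm_derivative_kernel:
  assumes w: "w \<in> unit_disk"
  shows "(dirichlet_norm \<alpha> (derivative_kernel \<alpha> w))\<^sup>2 = (1 - (cmod w)\<^sup>2) powr (- (\<alpha> + 2))"
proof -
  have "(square_integral \<alpha> (deriv (derivative_kernel \<alpha> w))) =
        (square_integral \<alpha> (bergman_kernel \<alpha> w))"
    by (intro set_lebesgue_integral_cong) (auto simp: derivative_kernel(3)[OF w])
  then show ?thesis unfolding dirichlet_norm_square
    using bergman_kernel_square_integral[OF \<alpha> w] derivative_kernel(2)[OF w] by simp
qed

lemma norm_deriv_le:
  assumes f: "f \<in> dirichlet_space \<alpha>" and w: "w \<in> unit_disk"
  shows "cmod (deriv f w) \<le> dirichlet_norm \<alpha> f * dirichlet_norm \<alpha> (derivative_kernel \<alpha> w)"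
  using dirichlet_Cauchy_Schwarz[OF f derivative_kernel(1)[OF w]] inner_derivative_kernel[OF f w] by simp

lemma disk_one: "disk_one \<in> dirichlet_space \<alpha>" "disk_one 0 = 1"
  "\<And>z. z \<in> unit_disk \<Longrightarrow> deriv disk_one z = 0"
proof -
  show d: "deriv disk_one z = 0" if "z \<in> unit_disk" for z
    using deriv_cong_disk[of disk_one "\<lambda>_. 1" z] that by (simp add: disk_one_def)
  have "disk_one holomorphic_on unit_disk"
    by (rule holomorphic_transform[of "\<lambda>_. 1"]) (auto simp: disk_one_def)
  moreover have "bergman_energy \<alpha> (deriv disk_one) = bergman_energy \<alpha> (\<lambda>_. 0)"
    by (rule bergman_energy_cong) (rule d)
  moreover have "bergman_energy \<alpha> (\<lambda>_. 0) = 0" by (simp add: bergman_energy_def)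
  ultimately show "disk_one \<in> dirichlet_space \<alpha>" unfolding dirichlet_space_iff by (simp add: disk_one_def)
qed (simp add: disk_one_def)

lemma inner_disk_one: "dirichlet_inner \<alpha> f disk_one = f 0"
proof -
  have "(LINT z:unit_disk|weighted_area \<alpha>. deriv f z * cnj (deriv disk_one z)) = (LINT z:unit_disk|weighted_area \<alpha>. 0)"
    by (intro set_lebesgue_integral_cong) (auto simp: disk_one(3))
  then show ?thesis by (simp add: dirichlet_inner_def disk_one(2) set_lebesgue_integral_def)
qed

lemma dirichlet_eqI:
  assumes f: "f \<in> dirichlet_space \<alpha>" and g: "g \<in> dirichlet_space \<alpha>"
    and 0: "f 0 = g 0" and d: "\<And>z. z \<in> unit_disk \<Longrightarrow> deriv f z = deriv g z"
  shows "f = g"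
proof
  fix z
  show "f z = g z"
  proof (cases "z \<in> unit_disk")
    case True
    have "\<exists>c. \<forall>x\<in>unit_disk. f x - g x = c"
    proof (rule has_field_derivative_zero_constant)
      show "((\<lambda>x. f x - g x) has_field_derivative 0) (at x within unit_disk)" if "x \<in> unit_disk" for x
        using holomorphic_disk_has_deriv[OF dirichlet_spaceD(1)[OF f] that]
          holomorphic_disk_has_deriv[OF dirichlet_spaceD(1)[OF g] that] d[OF that]
        by (auto intro!: derivative_eq_intros intro: has_field_derivative_at_within)
    qed simp
    then obtain c where "\<forall>x\<in>unit_disk. f x - g x = c" by blast
    then have "f z - g z = c" "f 0 - g 0 = c" using True by auto
    then show ?thesis using 0 by simp
  next
    case False
    then show ?thesis using dirichlet_spaceD(2)[OF f] dirichlet_spaceD(2)[OF g] by simp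
  qed
qed

text \<open>Constants detect the value at the origin, and the derivative kernels detect the derivative.\<close>

lemma dirichlet_inner_separates:
  assumes g: "g \<in> dirichlet_space \<alpha>" and h: "h \<in> dirichlet_space \<alpha>"
    and eq: "\<And>f. f \<in> dirichlet_space \<alpha> \<Longrightarrow> dirichlet_inner \<alpha> f g = dirichlet_inner \<alpha> f h"
  shows "g = h"
proof (rule dirichlet_eqI[OF g h])
  have eq': "dirichlet_inner \<alpha> g f = dirichlet_inner \<alpha> h f" if "f \<in> dirichlet_space \<alpha>" for f
    using eq[OF that] by (metis dirichlet_inner_commute)
  show "g 0 = h 0" using eq'[OF disk_one(1)] by (simp add: inner_disk_one)
  show "deriv g z = deriv h z" if "z \<in> unit_disk" for z
    using eq'[OF derivative_kernel(1)[OF that]] inner_derivative_kernel[OF g that] inner_derivative_kernel[OF h that] by simp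
qed

section \<open>Power series in the Dirichlet space\<close>

lemma dirichlet_weight_pos: "0 < dirichlet_weight \<alpha> n"
  using bergman_moment_pos[OF \<alpha>] by (auto simp: dirichlet_weight_def split: nat.split)

lemma dirichlet_power_series:
  assumes s: "\<And>z. z \<in> unit_disk \<Longrightarrow> (\<lambda>n. a n * z ^ n) sums f z"
  shows "ennreal ((cmod (f 0))\<^sup>2) + bergman_energy \<alpha> (deriv f) = (\<Sum>n. ennreal ((cmod (a n))\<^sup>2 * dirichlet_weight \<alpha> n))"
proof -
  have "bergman_energy \<alpha> (deriv f) = (\<Sum>n. ennreal ((cmod (of_nat (Suc n) * a (Suc n)))\<^sup>2 * bergman_moment \<alpha> n))"
    by (rule bergman_energy_power_series[OF power_series_disk_deriv[OF s] \<alpha>])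
  also have "\<dots> = (\<Sum>n. ennreal ((cmod (a (Suc n)))\<^sup>2 * dirichlet_weight \<alpha> (Suc n)))"
    by (intro suminf_cong) (simp add: dirichlet_weight_def norm_mult power_mult_distrib mult_ac del: of_nat_Suc)
  finally have e: "bergman_energy \<alpha> (deriv f) = (\<Sum>n. ennreal ((cmod (a (Suc n)))\<^sup>2 * dirichlet_weight \<alpha> (Suc n)))" .
  have "f 0 = a 0"
    using sums_unique2[OF s[of 0]] powser_sums_zero[of a] by simp
  then show ?thesis unfolding e
    by (subst (2) suminf_offset[where i=1]) (auto simp: dirichlet_weight_def add.commute)
qed

lemma dirichlet_norm_power_series:
  assumes f: "f \<in> dirichlet_space \<alpha>" and s: "\<And>z. z \<in> unit_disk \<Longrightarrow> (\<lambda>n. a n * z ^ n) sums f z"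
  shows "(\<lambda>n. (cmod (a n))\<^sup>2 * dirichlet_weight \<alpha> n) sums (dirichlet_norm \<alpha> f)\<^sup>2"
proof -
  have "ennreal ((dirichlet_norm \<alpha> f)\<^sup>2) = ennreal ((cmod (f 0))\<^sup>2) + bergman_energy \<alpha> (deriv f)"
    unfolding dirichlet_norm_square set_integrable_square_iff(2)[OF dirichlet_spaceD(4,3)[OF f]]
    by (simp add: energy_nonneg)
  also have "\<dots> = (\<Sum>n. ennreal ((cmod (a n))\<^sup>2 * dirichlet_weight \<alpha> n))"
    by (rule dirichlet_power_series[OF s])
  finally have e: "ennreal ((dirichlet_norm \<alpha> f)\<^sup>2) = (\<Sum>n. ennreal ((cmod (a n))\<^sup>2 * dirichlet_weight \<alpha> n))" .
  have nn: "0 \<le> (cmod (a n))\<^sup>2 * dirichlet_weight \<alpha> n" for n using dirichlet_weight_pos[of n] by simp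
  have sm: "summable (\<lambda>n. (cmod (a n))\<^sup>2 * dirichlet_weight \<alpha> n)"
    by (rule summable_suminf_not_top[OF nn]) (simp add: e[symmetric])
  have "ennreal ((dirichlet_norm \<alpha> f)\<^sup>2) = ennreal (\<Sum>n. (cmod (a n))\<^sup>2 * dirichlet_weight \<alpha> n)"
    unfolding e by (rule suminf_ennreal2[OF nn sm])
  then have "(dirichlet_norm \<alpha> f)\<^sup>2 = (\<Sum>n. (cmod (a n))\<^sup>2 * dirichlet_weight \<alpha> n)"
    using suminf_nonneg[OF sm nn] by (simp add: ennreal_inj)
  then show ?thesis using sm by (simp add: sums_iff)
qed

lemma disk_monomial_mem: "disk_monomial n \<in> dirichlet_space \<alpha>"
proof -
  have s: "(\<lambda>k. (if k = n then 1 else 0) * z ^ k) sums disk_monomial n z" if "z \<in> unit_disk" for z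
  proof -
    have "(\<lambda>k. (if k = n then 1 else 0) * z ^ k) = (\<lambda>k. if k = n then z ^ k else 0)" by auto
    then show ?thesis using sums_single[of n "\<lambda>k. z ^ k"] that by (simp add: disk_monomial_def)
  qed
  have "bergman_energy \<alpha> (deriv (disk_monomial n)) \<le> (\<Sum>k. ennreal ((cmod (if k = n then 1 else 0))\<^sup>2 * dirichlet_weight \<alpha> k))"
    by (subst dirichlet_power_series[OF s, symmetric]) simp_all
  also have "\<dots> = (\<Sum>k. if k = n then ennreal (dirichlet_weight \<alpha> n) else 0)" by (intro suminf_cong) auto
  also have "\<dots> = ennreal (dirichlet_weight \<alpha> n)" using sums_single[of n "\<lambda>k. ennreal (dirichlet_weight \<alpha> n)"] by (simp add: sums_iff)
  finally have "bergman_energy \<alpha> (deriv (disk_monomial n)) < \<infinity>" by (auto intro: le_less_trans)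
  moreover have "disk_monomial n holomorphic_on unit_disk"
    by (rule holomorphic_transform[of "\<lambda>z. z ^ n"]) (auto simp: disk_monomial_def intro!: holomorphic_intros)
  ultimately show ?thesis unfolding dirichlet_space_iff by (simp add: disk_monomial_def)
qed

lemma inner_disk_monomial:
  assumes h: "h \<in> dirichlet_space \<alpha>" and s: "\<And>z. z \<in> unit_disk \<Longrightarrow> (\<lambda>n. a n * z ^ n) sums h z"
  shows "dirichlet_inner \<alpha> h (disk_monomial n) = a n * dirichlet_weight \<alpha> n"
proof -
  have h0: "h 0 = a 0" using sums_unique2[OF s[of 0]] powser_sums_zero[of a] by simp
  note dm = deriv_disk_monomial[where n=n]
  show ?thesis
  proof (cases n)
    case 0
    then have "disk_monomial n = disk_one" by (auto simp: disk_monomial_def disk_one_def)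
    then show ?thesis using 0 h0 by (simp add: inner_disk_one dirichlet_weight_def)
  next
    case (Suc k)
    have "(LINT z:unit_disk|weighted_area \<alpha>. deriv h z * cnj (deriv (disk_monomial n) z)) =
       (LINT z:unit_disk|weighted_area \<alpha>. of_nat n * (deriv h z * cnj z ^ k))"
      by (intro set_lebesgue_integral_cong) (auto simp: Suc dm[unfolded Suc])
    also have "\<dots> = of_nat n * (LINT z:unit_disk|weighted_area \<alpha>. deriv h z * cnj z ^ k)"
      by simp
    finally have "(LINT z:unit_disk|weighted_area \<alpha>. deriv h z * cnj (deriv (disk_monomial n) z)) =
      of_nat n * (LINT z:unit_disk|weighted_area \<alpha>. deriv h z * cnj z ^ k)" .
    moreover have "(LINT z:unit_disk|weighted_area \<alpha>. deriv h z * cnj z ^ k) = of_nat (Suc k) * a (Suc k) * bergman_moment \<alpha> k"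
      by (rule bergman_coefficient[OF power_series_disk_deriv[OF s] \<alpha> dirichlet_spaceD(6)[OF h]])
    moreover have "disk_monomial n 0 = 0" by (simp add: disk_monomial_def Suc)
    ultimately show ?thesis using Suc
      by (simp add: dirichlet_inner_def dirichlet_weight_def power2_eq_square mult_ac)
  qed
qed

lemma disk_polynomial_mem: "disk_polynomial a N \<in> dirichlet_space \<alpha>"
proof (induction N)
  case 0
  have "disk_polynomial a 0 = (\<lambda>z. 0 * disk_one z)" by (auto simp: disk_polynomial_def)
  then show ?case using dirichlet_scale[OF disk_one(1), of 0] by simp
next
  case (Suc N)
  then show ?case unfolding disk_polynomial_Suc by (intro dirichlet_lincomb disk_monomial_mem)
qed

lemma dirichlet_norm_polynomial:
  "(dirichlet_norm \<alpha> (disk_polynomial a N))\<^sup>2 = (\<Sum>n<N. (cmod (a n))\<^sup>2 * dirichlet_weight \<alpha> n)"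
proof -
  have 1: "(\<lambda>n. (cmod (if n < N then a n else 0))\<^sup>2 * dirichlet_weight \<alpha> n) sums (dirichlet_norm \<alpha> (disk_polynomial a N))\<^sup>2"
    by (rule dirichlet_norm_power_series[OF disk_polynomial_mem disk_polynomial_sums])
  have 2: "(\<lambda>n. if n \<in> {..<N} then (cmod (a n))\<^sup>2 * dirichlet_weight \<alpha> n else 0) sums (\<Sum>n<N. (cmod (a n))\<^sup>2 * dirichlet_weight \<alpha> n)"
    by (rule sums_If_finite_set) simp
  have 3: "(\<lambda>n. (cmod (if n < N then a n else 0))\<^sup>2 * dirichlet_weight \<alpha> n) = (\<lambda>n. if n \<in> {..<N} then (cmod (a n))\<^sup>2 * dirichlet_weight \<alpha> n else 0)"
    by auto
  show ?thesis by (rule sums_unique2[OF 1 2[folded 3]])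
qed

text \<open>By Parseval's identity the remainder is the tail of a convergent series.\<close>

lemma disk_polynomial_tendsto:
  assumes f: "f \<in> dirichlet_space \<alpha>" and s: "\<And>z. z \<in> unit_disk \<Longrightarrow> (\<lambda>n. a n * z ^ n) sums f z"
  shows "(\<lambda>N. dirichlet_norm \<alpha> (\<lambda>z. f z - disk_polynomial a N z)) \<longlonglongrightarrow> 0"
proof -
  let ?x = "\<lambda>n. (cmod (a n))\<^sup>2 * dirichlet_weight \<alpha> n"
  have fs: "?x sums (dirichlet_norm \<alpha> f)\<^sup>2" by (rule dirichlet_norm_power_series[OF f s])
  have e: "(dirichlet_norm \<alpha> (\<lambda>z. f z - disk_polynomial a N z))\<^sup>2 = (dirichlet_norm \<alpha> f)\<^sup>2 - (\<Sum>n<N. ?x n)" for N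
  proof -
    have "(\<lambda>n. a n * z ^ n - (if n < N then a n else 0) * z ^ n) sums (f z - disk_polynomial a N z)" if "z \<in> unit_disk" for z
      by (rule sums_diff[OF s[OF that] disk_polynomial_sums[OF that]])
    then have s': "(\<lambda>n. (a n - (if n < N then a n else 0)) * z ^ n) sums (f z - disk_polynomial a N z)" if "z \<in> unit_disk" for z
      using that by (simp add: left_diff_distrib)
    have 1: "(\<lambda>n. (cmod (a n - (if n < N then a n else 0)))\<^sup>2 * dirichlet_weight \<alpha> n) sums (dirichlet_norm \<alpha> (\<lambda>z. f z - disk_polynomial a N z))\<^sup>2"
      by (rule dirichlet_norm_power_series[OF dirichlet_diff[OF f disk_polynomial_mem] s'])
    have "(\<lambda>n. if n \<in> {..<N} then ?x n else 0) sums (\<Sum>n<N. ?x n)" by (rule sums_If_finite_set) simp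
    from sums_diff[OF fs this]
    have 2: "(\<lambda>n. ?x n - (if n \<in> {..<N} then ?x n else 0)) sums ((dirichlet_norm \<alpha> f)\<^sup>2 - (\<Sum>n<N. ?x n))" .
    have 3: "(\<lambda>n. ?x n - (if n \<in> {..<N} then ?x n else 0)) = (\<lambda>n. (cmod (a n - (if n < N then a n else 0)))\<^sup>2 * dirichlet_weight \<alpha> n)"
      by auto
    show ?thesis by (rule sums_unique2[OF 1 2[unfolded 3]])
  qed
  have "(\<lambda>N. (dirichlet_norm \<alpha> f)\<^sup>2 - (\<Sum>n<N. ?x n)) \<longlonglongrightarrow> (dirichlet_norm \<alpha> f)\<^sup>2 - (dirichlet_norm \<alpha> f)\<^sup>2"
    using fs unfolding sums_def by (intro tendsto_intros)
  then have "(\<lambda>N. (dirichlet_norm \<alpha> (\<lambda>z. f z - disk_polynomial a N z))\<^sup>2) \<longlonglongrightarrow> 0" unfolding e by simp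
  from tendsto_real_sqrt[OF this] show ?thesis by simp
qed

end

section \<open>Bounded operators and adjoints\<close>

lemma le_of_mult_self_le:
  fixes x n :: real
  assumes "n * n \<le> n * x" "0 \<le> n" "0 \<le> x"
  shows "n \<le> x"
  using assms by (cases "n = 0") (simp_all add: mult_le_cancel_left)

context
  fixes \<alpha> :: real
  assumes \<alpha>: "-1 < \<alpha>"
begin

lemma bounded_operator_mem: "bounded_operator \<alpha> T \<Longrightarrow> f \<in> dirichlet_space \<alpha> \<Longrightarrow> T f \<in> dirichlet_space \<alpha>"
  unfolding bounded_operator_def by blast

lemma bounded_operator_linear:
  "bounded_operator \<alpha> T \<Longrightarrow> f \<in> dirichlet_space \<alpha> \<Longrightarrow> g \<in> dirichlet_space \<alpha> \<Longrightarrow>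
     T (\<lambda>z. a * f z + b * g z) = (\<lambda>z. a * T f z + b * T g z)"
  unfolding bounded_operator_def by blast

lemma bounded_operator_diff:
  assumes "bounded_operator \<alpha> T" "f \<in> dirichlet_space \<alpha>" "g \<in> dirichlet_space \<alpha>"
  shows "T (\<lambda>z. f z - g z) = (\<lambda>z. T f z - T g z)"
  using bounded_operator_linear[OF assms, of 1 "-1"] by simp

lemma bounded_operator_bound:
  assumes "bounded_operator \<alpha> T"
  obtains B where "0 \<le> B" "\<And>f. f \<in> dirichlet_space \<alpha> \<Longrightarrow> dirichlet_norm \<alpha> (T f) \<le> B * dirichlet_norm \<alpha> f"
proof -
  obtain B where B: "\<And>f. f \<in> dirichlet_space \<alpha> \<Longrightarrow> dirichlet_norm \<alpha> (T f) \<le> B * dirichlet_norm \<alpha> f"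
    using assms unfolding bounded_operator_def by blast
  have "dirichlet_norm \<alpha> (T f) \<le> \<bar>B\<bar> * dirichlet_norm \<alpha> f" if "f \<in> dirichlet_space \<alpha>" for f
    using B[OF that] mult_right_mono[OF abs_ge_self[of B] dirichlet_norm_nonneg[of \<alpha> f]] by linarith
  then show thesis using that[of "\<bar>B\<bar>"] by simp
qed

lemma bounded_operator_compose:
  assumes S: "bounded_operator \<alpha> S" and T: "bounded_operator \<alpha> T"
  shows "bounded_operator \<alpha> (S \<circ> T)"
proof -
  obtain B where B: "0 \<le> B" "\<And>f. f \<in> dirichlet_space \<alpha> \<Longrightarrow> dirichlet_norm \<alpha> (S f) \<le> B * dirichlet_norm \<alpha> f"
    by (rule bounded_operator_bound[OF S]) blast
  obtain C where C: "0 \<le> C" "\<And>f. f \<in> dirichlet_space \<alpha> \<Longrightarrow> dirichlet_norm \<alpha> (T f) \<le> C * dirichlet_norm \<alpha> f"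
    by (rule bounded_operator_bound[OF T]) blast
  have "dirichlet_norm \<alpha> ((S \<circ> T) f) \<le> (B * C) * dirichlet_norm \<alpha> f" if f: "f \<in> dirichlet_space \<alpha>" for f
  proof -
    have "dirichlet_norm \<alpha> (S (T f)) \<le> B * dirichlet_norm \<alpha> (T f)" by (rule B(2)[OF bounded_operator_mem[OF T f]])
    also have "\<dots> \<le> B * (C * dirichlet_norm \<alpha> f)" by (rule mult_left_mono[OF C(2)[OF f] B(1)])
    finally show ?thesis by (simp add: mult.assoc)
  qed
  then show ?thesis unfolding bounded_operator_def
    using bounded_operator_mem[OF S] bounded_operator_mem[OF T]
      bounded_operator_linear[OF S] bounded_operator_linear[OF T] by auto
qed

lemma bounded_operator_minus:
  assumes S: "bounded_operator \<alpha> S" and T: "bounded_operator \<alpha> T"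
  shows "bounded_operator \<alpha> (\<lambda>f z. S f z - T f z)"
proof -
  obtain B where B: "0 \<le> B" "\<And>f. f \<in> dirichlet_space \<alpha> \<Longrightarrow> dirichlet_norm \<alpha> (S f) \<le> B * dirichlet_norm \<alpha> f"
    by (rule bounded_operator_bound[OF S]) blast
  obtain C where C: "0 \<le> C" "\<And>f. f \<in> dirichlet_space \<alpha> \<Longrightarrow> dirichlet_norm \<alpha> (T f) \<le> C * dirichlet_norm \<alpha> f"
    by (rule bounded_operator_bound[OF T]) blast
  have "dirichlet_norm \<alpha> (\<lambda>z. S f z - T f z) \<le> (B + C) * dirichlet_norm \<alpha> f" if f: "f \<in> dirichlet_space \<alpha>" for f
    using dirichlet_norm_triangle_diff[OF \<alpha> bounded_operator_mem[OF S f] bounded_operator_mem[OF T f]] B(2)[OF f] C(2)[OF f]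
    by (simp add: distrib_right)
  moreover have "(\<lambda>z. S f z - T f z) \<in> dirichlet_space \<alpha>" if f: "f \<in> dirichlet_space \<alpha>" for f
    by (rule dirichlet_diff[OF \<alpha> bounded_operator_mem[OF S f] bounded_operator_mem[OF T f]])
  moreover have "(\<lambda>z. S (\<lambda>z. a * f z + b * g z) z - T (\<lambda>z. a * f z + b * g z) z) =
      (\<lambda>z. a * (S f z - T f z) + b * (S g z - T g z))"
    if "f \<in> dirichlet_space \<alpha>" "g \<in> dirichlet_space \<alpha>" for f g a b
    using bounded_operator_linear[OF S that, of a b] bounded_operator_linear[OF T that, of a b]
    by (simp add: fun_eq_iff algebra_simps)
  ultimately show ?thesis unfolding bounded_operator_def by blast
qed

lemma operator_norm_ge:
  assumes T: "bounded_operator \<alpha> T" and f: "f \<in> dirichlet_space \<alpha>" "dirichlet_norm \<alpha> f \<le> 1"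
  shows "dirichlet_norm \<alpha> (T f) \<le> operator_norm \<alpha> T"
proof -
  obtain B where B: "0 \<le> B" "\<And>f. f \<in> dirichlet_space \<alpha> \<Longrightarrow> dirichlet_norm \<alpha> (T f) \<le> B * dirichlet_norm \<alpha> f"
    by (rule bounded_operator_bound[OF T]) blast
  have "bdd_above ((\<lambda>f. dirichlet_norm \<alpha> (T f)) ` {f \<in> dirichlet_space \<alpha>. dirichlet_norm \<alpha> f \<le> 1})"
  proof (rule bdd_aboveI2)
    fix f assume "f \<in> {f \<in> dirichlet_space \<alpha>. dirichlet_norm \<alpha> f \<le> 1}"
    then show "dirichlet_norm \<alpha> (T f) \<le> B"
      using B(2)[of f] mult_left_le[OF _ B(1), of "dirichlet_norm \<alpha> f"] by auto
  qed
  then show ?thesis unfolding operator_norm_def by (rule cSUP_upper2) (use f in auto)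
qed

lemma dirichlet_zero: "(\<lambda>z. 0) \<in> dirichlet_space \<alpha>" "dirichlet_norm \<alpha> (\<lambda>z. 0) = 0"
proof -
  show z: "(\<lambda>z. 0) \<in> dirichlet_space \<alpha>" using dirichlet_scale[OF \<alpha> disk_one(1)[OF \<alpha>], of 0] by simp
  show "dirichlet_norm \<alpha> (\<lambda>z. 0) = 0" using dirichlet_norm_scale[OF \<alpha> z, of 0] by simp
qed

lemma operator_norm_nonneg: "bounded_operator \<alpha> T \<Longrightarrow> 0 \<le> operator_norm \<alpha> T"
  using operator_norm_ge[OF _ dirichlet_zero(1)] dirichlet_zero(2) dirichlet_norm_nonneg
  by (metis order_trans zero_le_one)

lemma operator_norm_zero: "operator_norm \<alpha> (\<lambda>f z. 0) = 0"
proof -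
  have "{f \<in> dirichlet_space \<alpha>. dirichlet_norm \<alpha> f \<le> 1} \<noteq> {}" using dirichlet_zero by auto
  then show ?thesis unfolding operator_norm_def by (simp add: dirichlet_zero(2))
qed

lemma compact_operator_zero: "compact_operator \<alpha> (\<lambda>f z. 0)"
proof -
  have "bounded_operator \<alpha> (\<lambda>f z. 0)" unfolding bounded_operator_def
    using dirichlet_zero by (auto intro!: exI[of _ 0])
  moreover have "strict_mono (\<lambda>n::nat. n)" by (simp add: strict_mono_def)
  ultimately show ?thesis unfolding compact_operator_def using dirichlet_zero
    by (auto intro!: bexI[of _ "\<lambda>z. 0"] exI[of _ "\<lambda>n. n"])
qed

lemma essential_norm_compact:
  assumes T: "bounded_operator \<alpha> T" and K: "compact_operator \<alpha> T"
  shows "essential_norm \<alpha> T = 0"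
proof (rule antisym)
  have ge: "0 \<le> operator_norm \<alpha> (\<lambda>f z. T f z - K f z)" if "compact_operator \<alpha> K" for K
    using that T by (intro operator_norm_nonneg bounded_operator_minus) (simp_all add: compact_operator_def)
  have "bdd_below ((\<lambda>K. operator_norm \<alpha> (\<lambda>f z. T f z - K f z)) ` {K. compact_operator \<alpha> K})"
    by (rule bdd_belowI2[where m=0]) (use ge in auto)
  then have "essential_norm \<alpha> T \<le> operator_norm \<alpha> (\<lambda>f z. T f z - T f z)"
    unfolding essential_norm_def by (rule cINF_lower) (use K in auto)
  then show "essential_norm \<alpha> T \<le> 0" by (simp add: operator_norm_zero)
  show "0 \<le> essential_norm \<alpha> T"
    unfolding essential_norm_def by (rule cINF_greatest) (use ge K in auto)
qed

lemma essential_norm_ge: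
  assumes "\<And>K. compact_operator \<alpha> K \<Longrightarrow> c \<le> operator_norm \<alpha> (\<lambda>f z. T f z - K f z)"
  shows "c \<le> essential_norm \<alpha> T"
  unfolding essential_norm_def by (rule cINF_greatest) (use assms compact_operator_zero in auto)

text \<open>It follows that the Taylor coefficients of a function are bounded by its norm.\<close>

lemma dirichlet_weight_ge_1:
  assumes "\<alpha> \<le> 0"
  shows "1 \<le> dirichlet_weight \<alpha> n"
proof (cases n)
  case (Suc k)
  have "pochhammer (\<alpha> + 2) k \<le> pochhammer 2 k"
    unfolding pochhammer_prod using \<alpha> assms by (intro prod_mono) auto
  also have "\<dots> = fact (Suc k)"
    using pochhammer_rec[of "1::real" k] pochhammer_fact[of "Suc k", where 'a=real] by simp
  finally have p: "pochhammer (\<alpha> + 2) k \<le> fact (Suc k)" .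
  have p0: "0 < pochhammer (\<alpha> + 2) k" using \<alpha> by (intro pochhammer_pos) auto
  have "pochhammer (\<alpha> + 2) k \<le> real (Suc k) * fact (Suc k)"
  proof -
    have "1 * fact (Suc k) \<le> real (Suc k) * (fact (Suc k) :: real)" by (intro mult_right_mono) auto
    then show ?thesis using p by linarith
  qed
  also have "\<dots> = (real (Suc k))\<^sup>2 * fact k" by (simp add: power2_eq_square mult_ac)
  finally show ?thesis using Suc p0 by (simp add: dirichlet_weight_def bergman_moment_def le_divide_eq)
qed (simp add: dirichlet_weight_def)

text \<open>The coefficients of the representing function with respect to the orthogonal basis of monomials are
  prescribed. Testing with its own partial sums bounds their norms uniformly, so the series defines
  an element of the space, and the density of the polynomials extends the identity from monomials to
  all functions.\<close>

lemma adjoint_exists: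
  assumes \<alpha>0: "\<alpha> \<le> 0" and T: "bounded_operator \<alpha> T" and g: "g \<in> dirichlet_space \<alpha>"
  shows "\<exists>h\<in>dirichlet_space \<alpha>. \<forall>f\<in>dirichlet_space \<alpha>. dirichlet_inner \<alpha> (T f) g = dirichlet_inner \<alpha> f h"
proof -
  let ?w = "dirichlet_weight \<alpha>" and ?e = disk_monomial and ?N = "dirichlet_norm \<alpha>"
  obtain B where B: "0 \<le> B" "\<And>f. f \<in> dirichlet_space \<alpha> \<Longrightarrow> ?N (T f) \<le> B * ?N f"
    by (rule bounded_operator_bound[OF T]) blast
  define a where "a n = cnj (dirichlet_inner \<alpha> (T (?e n)) g) / ?w n" for n
  have wp: "0 < ?w n" for n by (rule dirichlet_weight_pos[OF \<alpha>])
  have nn: "0 \<le> (cmod (a n))\<^sup>2 * ?w n" for n using wp[of n] by simp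
  have pm: "disk_polynomial a N \<in> dirichlet_space \<alpha>" for N by (rule disk_polynomial_mem[OF \<alpha>])
  have em: "?e n \<in> dirichlet_space \<alpha>" for n by (rule disk_monomial_mem[OF \<alpha>])
  have Te: "dirichlet_inner \<alpha> (T (?e n)) g = cnj (a n) * ?w n" for n
    using wp[of n] by (simp add: a_def)
  have Tp: "dirichlet_inner \<alpha> (T (disk_polynomial a N)) g = complex_of_real (\<Sum>n<N. (cmod (a n))\<^sup>2 * ?w n)" for N
  proof (induction N)
    case 0
    have "disk_polynomial a 0 = (\<lambda>z. 0 * disk_one z + 0 * disk_one z)" by (auto simp: disk_polynomial_def)
    then have "T (disk_polynomial a 0) = (\<lambda>z. 0 * T disk_one z + 0 * T disk_one z)"
      using bounded_operator_linear[OF T disk_one(1)[OF \<alpha>] disk_one(1)[OF \<alpha>], of 0 0] by simp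
    moreover have "dirichlet_inner \<alpha> (\<lambda>z. 0 * T disk_one z + 0 * T disk_one z) g = 0"
      using bounded_operator_mem[OF T disk_one(1)[OF \<alpha>]] g by (subst dirichlet_inner_lincomb_left[OF \<alpha>]) auto
    ultimately show ?case by simp
  next
    case (Suc N)
    have "T (disk_polynomial a (Suc N)) = (\<lambda>z. 1 * T (disk_polynomial a N) z + a N * T (?e N) z)"
      unfolding disk_polynomial_Suc by (rule bounded_operator_linear[OF T pm em])
    then have "dirichlet_inner \<alpha> (T (disk_polynomial a (Suc N))) g =
        1 * dirichlet_inner \<alpha> (T (disk_polynomial a N)) g + a N * dirichlet_inner \<alpha> (T (?e N)) g"
      by (simp only: dirichlet_inner_lincomb_left[OF \<alpha> bounded_operator_mem[OF T pm] bounded_operator_mem[OF T em] g])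
    then show ?case using Suc.IH Te by (simp add: mult.assoc[symmetric] complex_norm_square[symmetric])
  qed
  have pN: "?N (disk_polynomial a N) \<le> B * ?N g" for N
  proof -
    let ?p = "disk_polynomial a N"
    have "(?N ?p)\<^sup>2 = cmod (dirichlet_inner \<alpha> (T ?p) g)"
      unfolding Tp dirichlet_norm_polynomial[OF \<alpha>, symmetric] by (simp only: norm_of_real) simp
    also have "\<dots> \<le> ?N (T ?p) * ?N g" by (rule dirichlet_Cauchy_Schwarz[OF \<alpha> bounded_operator_mem[OF T pm] g])
    also have "\<dots> \<le> (B * ?N ?p) * ?N g" by (intro mult_right_mono B(2) pm) simp
    finally have "?N ?p * ?N ?p \<le> ?N ?p * (B * ?N g)" by (simp add: power2_eq_square mult_ac)
    then show ?thesis using B(1) by (intro le_of_mult_self_le[of "?N ?p"]) simp_all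
  qed
  have sumle: "(\<Sum>n<N. (cmod (a n))\<^sup>2 * ?w n) \<le> (B * ?N g)\<^sup>2" for N
    unfolding dirichlet_norm_polynomial[OF \<alpha>, symmetric] by (intro power_mono pN) simp
  have ale: "cmod (a n) \<le> B * ?N g" for n
  proof (rule power2_le_imp_le)
    have "(cmod (a n))\<^sup>2 * 1 \<le> (cmod (a n))\<^sup>2 * ?w n"
      by (intro mult_left_mono dirichlet_weight_ge_1 \<alpha>0) simp
    also have "\<dots> \<le> (\<Sum>n<Suc n. (cmod (a n))\<^sup>2 * ?w n)"
      by (rule member_le_sum) (use nn in auto)
    also have "\<dots> \<le> (B * ?N g)\<^sup>2" by (rule sumle)
    finally show "(cmod (a n))\<^sup>2 \<le> (B * ?N g)\<^sup>2" by simp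
  qed (use B in simp)
  define h where "h z = (if z \<in> unit_disk then \<Sum>n. a n * z ^ n else 0)" for z
  have hs: "(\<lambda>n. a n * z ^ n) sums h z" if z: "z \<in> unit_disk" for z
  proof -
    have "summable (\<lambda>n. (B * ?N g) * cmod z ^ n)" using z by (intro summable_mult summable_geometric) simp
    then have "summable (\<lambda>n. a n * z ^ n)"
      by (rule summable_comparison_test'[where N=0]) (auto simp: norm_mult norm_power intro!: mult_right_mono ale)
    then show ?thesis using z by (simp add: h_def summable_sums)
  qed
  have "bergman_energy \<alpha> (deriv h) \<le> ennreal ((cmod (h 0))\<^sup>2) + bergman_energy \<alpha> (deriv h)" by simp
  also have "\<dots> = (\<Sum>n. ennreal ((cmod (a n))\<^sup>2 * ?w n))" by (rule dirichlet_power_series[OF \<alpha> hs])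
  also have "\<dots> \<le> ennreal ((B * ?N g)\<^sup>2)"
  proof (rule suminf_le_const)
    show "(\<Sum>n<N. ennreal ((cmod (a n))\<^sup>2 * ?w n)) \<le> ennreal ((B * ?N g)\<^sup>2)" for N
      using sumle[of N] nn by (subst sum_ennreal) (auto intro!: ennreal_leI)
  qed simp
  finally have "bergman_energy \<alpha> (deriv h) < \<infinity>" by (auto intro: le_less_trans)
  then have h: "h \<in> dirichlet_space \<alpha>"
    unfolding dirichlet_space_iff[OF \<alpha>]
    by (intro conjI power_series_disk_holomorphic[OF hs \<alpha>]) (simp_all add: h_def)
  have Ae: "dirichlet_inner \<alpha> (T (?e n)) g = dirichlet_inner \<alpha> (?e n) h" for n
    using inner_disk_monomial[OF \<alpha> h hs, of n] unfolding Te
    by (subst dirichlet_inner_commute[OF \<alpha>]) simp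
  have Ap: "dirichlet_inner \<alpha> (T (disk_polynomial c N)) g = dirichlet_inner \<alpha> (disk_polynomial c N) h" for c N
  proof (induction N)
    case 0
    have "disk_polynomial c 0 = (\<lambda>z. 0 * disk_one z + 0 * disk_one z)" by (auto simp: disk_polynomial_def)
    moreover have "T (\<lambda>z. 0 * disk_one z + 0 * disk_one z) = (\<lambda>z. 0 * T disk_one z + 0 * T disk_one z)"
      by (rule bounded_operator_linear[OF T disk_one(1)[OF \<alpha>] disk_one(1)[OF \<alpha>]])
    moreover have "dirichlet_inner \<alpha> (\<lambda>z. 0 * T disk_one z + 0 * T disk_one z) g = 0"
      using bounded_operator_mem[OF T disk_one(1)[OF \<alpha>]] g by (subst dirichlet_inner_lincomb_left[OF \<alpha>]) auto
    moreover have "dirichlet_inner \<alpha> (\<lambda>z. 0 * disk_one z + 0 * disk_one z) h = 0"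
      using disk_one(1)[OF \<alpha>] h by (subst dirichlet_inner_lincomb_left[OF \<alpha>]) auto
    ultimately show ?case by simp
  next
    case (Suc N)
    have p: "disk_polynomial c N \<in> dirichlet_space \<alpha>" by (rule disk_polynomial_mem[OF \<alpha>])
    show ?case
      unfolding disk_polynomial_Suc bounded_operator_linear[OF T p em]
        dirichlet_inner_lincomb_left[OF \<alpha> bounded_operator_mem[OF T p] bounded_operator_mem[OF T em] g]
        dirichlet_inner_lincomb_left[OF \<alpha> p em h] Suc.IH Ae ..
  qed
  have "dirichlet_inner \<alpha> (T f) g = dirichlet_inner \<alpha> f h" if f: "f \<in> dirichlet_space \<alpha>" for f
  proof -
    define c where "c n = (deriv ^^ n) f 0 / fact n" for n
    have cs: "(\<lambda>n. c n * z ^ n) sums f z" if "z \<in> unit_disk" for z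
      unfolding c_def by (rule taylor_disk[OF dirichlet_spaceD(1)[OF \<alpha> f] that])
    let ?d = "\<lambda>N z. f z - disk_polynomial c N z"
    have p: "disk_polynomial c N \<in> dirichlet_space \<alpha>" for N by (rule disk_polynomial_mem[OF \<alpha>])
    have d: "?d N \<in> dirichlet_space \<alpha>" for N by (rule dirichlet_diff[OF \<alpha> f p])
    have le: "cmod (dirichlet_inner \<alpha> (T f) g - dirichlet_inner \<alpha> f h) \<le> (B * ?N g + ?N h) * ?N (?d N)" for N
    proof -
      have Td: "T (?d N) = (\<lambda>z. 1 * T f z + (-1) * T (disk_polynomial c N) z)"
        using bounded_operator_diff[OF T f p] by simp
      have "dirichlet_inner \<alpha> (T (?d N)) g = dirichlet_inner \<alpha> (T f) g - dirichlet_inner \<alpha> (T (disk_polynomial c N)) g"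
        unfolding Td using dirichlet_inner_lincomb_left[OF \<alpha> bounded_operator_mem[OF T f] bounded_operator_mem[OF T p] g, of 1 "-1"] by simp
      moreover have "dirichlet_inner \<alpha> (?d N) h = dirichlet_inner \<alpha> f h - dirichlet_inner \<alpha> (disk_polynomial c N) h"
        using dirichlet_inner_lincomb_left[OF \<alpha> f p h, of 1 "-1"] by simp
      ultimately have "dirichlet_inner \<alpha> (T f) g - dirichlet_inner \<alpha> f h = dirichlet_inner \<alpha> (T (?d N)) g - dirichlet_inner \<alpha> (?d N) h"
        using Ap[of c N] by simp
      then have "cmod (dirichlet_inner \<alpha> (T f) g - dirichlet_inner \<alpha> f h) \<le>
          cmod (dirichlet_inner \<alpha> (T (?d N)) g) + cmod (dirichlet_inner \<alpha> (?d N) h)"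
        by (simp only: norm_triangle_ineq4)
      also have "\<dots> \<le> ?N (T (?d N)) * ?N g + ?N (?d N) * ?N h"
        by (intro add_mono dirichlet_Cauchy_Schwarz \<alpha> bounded_operator_mem[OF T] d g h)
      also have "\<dots> \<le> (B * ?N (?d N)) * ?N g + ?N (?d N) * ?N h"
        by (intro add_right_mono mult_right_mono B(2) d) simp
      finally show ?thesis by (simp add: algebra_simps)
    qed
    have "(\<lambda>N. (B * ?N g + ?N h) * ?N (?d N)) \<longlonglongrightarrow> (B * ?N g + ?N h) * 0"
      by (intro tendsto_intros disk_polynomial_tendsto[OF \<alpha> f cs])
    then have "cmod (dirichlet_inner \<alpha> (T f) g - dirichlet_inner \<alpha> f h) \<le> (B * ?N g + ?N h) * 0"
      by (rule LIMSEQ_le_const) (use le in blast)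
    then show ?thesis by simp
  qed
  with h show ?thesis by blast
qed

lemma hilbert_adjoint_eqI:
  assumes "h \<in> dirichlet_space \<alpha>"
    and "\<And>f. f \<in> dirichlet_space \<alpha> \<Longrightarrow> dirichlet_inner \<alpha> (T f) g = dirichlet_inner \<alpha> f h"
  shows "hilbert_adjoint \<alpha> T g = h"
  unfolding hilbert_adjoint_def
proof (rule the_equality)
  fix k assume k: "k \<in> dirichlet_space \<alpha> \<and> (\<forall>f\<in>dirichlet_space \<alpha>. dirichlet_inner \<alpha> (T f) g = dirichlet_inner \<alpha> f k)"
  show "k = h" by (rule dirichlet_inner_separates[OF \<alpha>]) (use k assms in auto)
qed (use assms in blast)

lemma hilbert_adjoint:
  assumes "\<alpha> \<le> 0" "bounded_operator \<alpha> T" "g \<in> dirichlet_space \<alpha>"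
  shows "hilbert_adjoint \<alpha> T g \<in> dirichlet_space \<alpha>"
    and "f \<in> dirichlet_space \<alpha> \<Longrightarrow> dirichlet_inner \<alpha> (T f) g = dirichlet_inner \<alpha> f (hilbert_adjoint \<alpha> T g)"
proof -
  obtain h where h: "h \<in> dirichlet_space \<alpha>" "\<And>f. f \<in> dirichlet_space \<alpha> \<Longrightarrow> dirichlet_inner \<alpha> (T f) g = dirichlet_inner \<alpha> f h"
    using adjoint_exists[OF assms] by blast
  have "hilbert_adjoint \<alpha> T g = h" by (rule hilbert_adjoint_eqI[OF h])
  then show "hilbert_adjoint \<alpha> T g \<in> dirichlet_space \<alpha>"
    "f \<in> dirichlet_space \<alpha> \<Longrightarrow> dirichlet_inner \<alpha> (T f) g = dirichlet_inner \<alpha> f (hilbert_adjoint \<alpha> T g)"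
    using h by auto
qed

lemma bounded_operator_adjoint:
  assumes \<alpha>0: "\<alpha> \<le> 0" and T: "bounded_operator \<alpha> T"
  shows "bounded_operator \<alpha> (hilbert_adjoint \<alpha> T)"
proof -
  let ?A = "hilbert_adjoint \<alpha> T"
  note A = hilbert_adjoint[OF \<alpha>0 T]
  obtain B where B: "0 \<le> B" "\<And>f. f \<in> dirichlet_space \<alpha> \<Longrightarrow> dirichlet_norm \<alpha> (T f) \<le> B * dirichlet_norm \<alpha> f"
    by (rule bounded_operator_bound[OF T]) blast
  have "dirichlet_norm \<alpha> (?A g) \<le> B * dirichlet_norm \<alpha> g" if g: "g \<in> dirichlet_space \<alpha>" for g
  proof -
    let ?n = "dirichlet_norm \<alpha> (?A g)"
    have "?n\<^sup>2 = cmod (dirichlet_inner \<alpha> (?A g) (?A g))"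
      unfolding dirichlet_inner_self[OF \<alpha>] by (simp only: norm_of_real) simp
    also have "\<dots> = cmod (dirichlet_inner \<alpha> (T (?A g)) g)" using A(2)[OF g A(1)[OF g]] by simp
    also have "\<dots> \<le> dirichlet_norm \<alpha> (T (?A g)) * dirichlet_norm \<alpha> g"
      by (rule dirichlet_Cauchy_Schwarz[OF \<alpha> bounded_operator_mem[OF T A(1)[OF g]] g])
    also have "\<dots> \<le> (B * ?n) * dirichlet_norm \<alpha> g"
      by (intro mult_right_mono B(2) A(1) g) simp
    finally have "?n * ?n \<le> ?n * (B * dirichlet_norm \<alpha> g)" by (simp add: power2_eq_square mult_ac)
    then show ?thesis using B(1) by (intro le_of_mult_self_le[of ?n]) simp_all
  qed
  moreover have "?A (\<lambda>z. a * f z + b * g z) = (\<lambda>z. a * ?A f z + b * ?A g z)"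
    if f: "f \<in> dirichlet_space \<alpha>" and g: "g \<in> dirichlet_space \<alpha>" for f g a b
  proof (rule hilbert_adjoint_eqI)
    show "(\<lambda>z. a * ?A f z + b * ?A g z) \<in> dirichlet_space \<alpha>"
      by (intro dirichlet_lincomb \<alpha> A f g)
    show "dirichlet_inner \<alpha> (T u) (\<lambda>z. a * f z + b * g z) = dirichlet_inner \<alpha> u (\<lambda>z. a * ?A f z + b * ?A g z)"
      if u: "u \<in> dirichlet_space \<alpha>" for u
      unfolding dirichlet_inner_lincomb_right[OF \<alpha> f g bounded_operator_mem[OF T u]]
        dirichlet_inner_lincomb_right[OF \<alpha> A(1)[OF f] A(1)[OF g] u] A(2)[OF f u] A(2)[OF g u] ..
  qed
  ultimately show ?thesis unfolding bounded_operator_def using A(1) by blast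
qed

section \<open>Composition operators\<close>

lemma norm_diff_le_of_deriv_bound:
  assumes f: "f holomorphic_on unit_disk" and p: "p \<in> unit_disk"
    and S: "\<And>u. cmod u \<le> cmod p \<Longrightarrow> cmod (deriv f u) \<le> S"
  shows "cmod (f p - f 0) \<le> S"
proof -
  have "cmod (f p - f 0) \<le> S * cmod (p - 0)"
  proof (rule field_differentiable_bound[of "cball 0 (cmod p)" f "deriv f"])
    show "(f has_field_derivative deriv f z) (at z within cball 0 (cmod p))" if "z \<in> cball 0 (cmod p)" for z
      using holomorphic_disk_has_deriv[OF f, of z] that p by (auto intro: has_field_derivative_at_within)
  qed (use S in auto)
  also have "\<dots> \<le> S * 1"
    using p order_trans[OF norm_ge_zero S[of 0]] by (intro mult_left_mono) auto
  finally show ?thesis by simp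
qed

text \<open>The value at \<open>p\<close> is reached from the value at the origin along the segment, on which the reproducing
  property bounds the derivative.\<close>

lemma norm_point_le:
  assumes f: "f \<in> dirichlet_space \<alpha>" and p: "p \<in> unit_disk"
  shows "cmod (f p) \<le> (1 + sqrt ((1 - (cmod p)\<^sup>2) powr (- (\<alpha> + 2)))) * dirichlet_norm \<alpha> f"
proof -
  let ?n = "dirichlet_norm \<alpha> f" and ?R = "(1 - (cmod p)\<^sup>2) powr (- (\<alpha> + 2))"
  have "cmod (f p - f 0) \<le> ?n * sqrt ?R"
  proof (rule norm_diff_le_of_deriv_bound[OF dirichlet_spaceD(1)[OF \<alpha> f] p])
    fix u assume u: "cmod u \<le> cmod p"
    then have uD: "u \<in> unit_disk" using p by simp
    have "(cmod u)\<^sup>2 \<le> (cmod p)\<^sup>2" using u by (rule power_mono) simp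
    then have "(1 - (cmod u)\<^sup>2) powr (- (\<alpha> + 2)) \<le> ?R"
      using \<alpha> one_minus_norm_square_pos[OF p] by (intro powr_mono2') auto
    then have "dirichlet_norm \<alpha> (derivative_kernel \<alpha> u) \<le> sqrt ?R"
      using norm_derivative_kernel[OF \<alpha> uD] by (intro real_le_rsqrt) simp
    then have "?n * dirichlet_norm \<alpha> (derivative_kernel \<alpha> u) \<le> ?n * sqrt ?R"
      by (intro mult_left_mono) simp_all
    then show "cmod (deriv f u) \<le> ?n * sqrt ?R" using norm_deriv_le[OF \<alpha> f uD] by linarith
  qed
  moreover have "cmod (f p) \<le> cmod (f p - f 0) + cmod (f 0)" using norm_triangle_sub[of "f p" "f 0"] by simp
  ultimately show ?thesis using norm_at_0_le[of f \<alpha>] by (simp add: algebra_simps)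
qed

lemma composition_operator_bounded:
  assumes lf: "nonconst_lf_self_map a b c d" and \<phi>: "\<phi> = linear_fractional a b c d"
  shows "bounded_operator \<alpha> (composition_operator \<phi>)"
    and "f \<in> dirichlet_space \<alpha> \<Longrightarrow> z \<in> unit_disk \<Longrightarrow>
      deriv (composition_operator \<phi> f) z = deriv f (\<phi> z) * deriv \<phi> z"
proof -
  have h: "\<phi> holomorphic_on unit_disk" using lf_holomorphic[OF lf] \<phi> by simp
  have sub: "\<phi> z \<in> unit_disk" if "z \<in> unit_disk" for z using lf_maps_disk[OF lf that] \<phi> by simp
  have comp: "(\<lambda>z. f (\<phi> z)) holomorphic_on unit_disk" if "f holomorphic_on unit_disk" for f
    using holomorphic_on_compose_gen[OF h that] sub by (force simp: o_def)
  have der: "deriv (composition_operator \<phi> f) z = deriv f (\<phi> z) * deriv \<phi> z"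
    if f: "f holomorphic_on unit_disk" and z: "z \<in> unit_disk" for f z
  proof -
    have "((\<lambda>z. f (\<phi> z)) has_field_derivative deriv f (\<phi> z) * deriv \<phi> z) (at z)"
      using DERIV_chain2[OF holomorphic_disk_has_deriv[OF f sub[OF z]] holomorphic_disk_has_deriv[OF h z]] .
    then have "(composition_operator \<phi> f has_field_derivative deriv f (\<phi> z) * deriv \<phi> z) (at z)"
      by (rule has_field_derivative_transform_within_open[OF _ open_ball z]) (simp add: composition_operator_def)
    then show ?thesis by (rule DERIV_imp_deriv)
  qed
  show "f \<in> dirichlet_space \<alpha> \<Longrightarrow> z \<in> unit_disk \<Longrightarrow>
      deriv (composition_operator \<phi> f) z = deriv f (\<phi> z) * deriv \<phi> z"
    using der dirichlet_spaceD(1)[OF \<alpha>] by blast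
  obtain C where C: "0 < C" "\<And>g. g holomorphic_on unit_disk \<Longrightarrow>
      bergman_energy \<alpha> (\<lambda>z. g (\<phi> z) * deriv \<phi> z) \<le> ennreal C * bergman_energy \<alpha> g"
    using lf_bergman_energy_compose_le[OF \<alpha> lf \<phi>] by blast
  have en: "bergman_energy \<alpha> (deriv (composition_operator \<phi> f)) \<le> ennreal C * bergman_energy \<alpha> (deriv f)"
    if f: "f \<in> dirichlet_space \<alpha>" for f
  proof -
    have "bergman_energy \<alpha> (deriv (composition_operator \<phi> f)) = bergman_energy \<alpha> (\<lambda>z. deriv f (\<phi> z) * deriv \<phi> z)"
      by (rule bergman_energy_cong) (rule der[OF dirichlet_spaceD(1)[OF \<alpha> f]])
    then show ?thesis using C(2)[OF dirichlet_spaceD(5)[OF \<alpha> f]] by simp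
  qed
  have mem: "composition_operator \<phi> f \<in> dirichlet_space \<alpha>" if f: "f \<in> dirichlet_space \<alpha>" for f
  proof -
    have "composition_operator \<phi> f holomorphic_on unit_disk"
      by (rule holomorphic_transform[OF comp[OF dirichlet_spaceD(1)[OF \<alpha> f]]]) (simp add: composition_operator_def)
    moreover have "bergman_energy \<alpha> (deriv (composition_operator \<phi> f)) < \<infinity>"
      using en[OF f] f unfolding dirichlet_space_iff[OF \<alpha>]
      by (auto intro!: le_less_trans[OF en[OF f]] simp: ennreal_mult_less_top)
    ultimately show ?thesis unfolding dirichlet_space_iff[OF \<alpha>] by (simp add: composition_operator_def)
  qed
  have p: "\<phi> 0 \<in> unit_disk" using sub[of 0] by simp
  define R where "R = 1 + sqrt ((1 - (cmod (\<phi> 0))\<^sup>2) powr (- (\<alpha> + 2)))"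
  have "dirichlet_norm \<alpha> (composition_operator \<phi> f) \<le> sqrt (R\<^sup>2 + C) * dirichlet_norm \<alpha> f"
    if f: "f \<in> dirichlet_space \<alpha>" for f
  proof (rule power2_le_imp_le)
    let ?n = "dirichlet_norm \<alpha> f"
    have "cmod (composition_operator \<phi> f 0) \<le> R * ?n"
      using norm_point_le[OF f p] by (simp add: composition_operator_def R_def)
    then have 1: "(cmod (composition_operator \<phi> f 0))\<^sup>2 \<le> (R * ?n)\<^sup>2" by (rule power_mono) simp
    let ?E = "\<lambda>f. LINT z:unit_disk|weighted_area \<alpha>. (cmod (deriv f z))\<^sup>2"
    have e: "bergman_energy \<alpha> (deriv u) = ennreal (?E u)" if "u \<in> dirichlet_space \<alpha>" for u
      by (rule set_integrable_square_iff(2)[OF dirichlet_spaceD(4,3)[OF \<alpha> that]])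
    have "ennreal (?E (composition_operator \<phi> f)) \<le> ennreal (C * ?E f)"
      using en[OF f] C(1) unfolding e[OF f] e[OF mem[OF f]] by (simp add: ennreal_mult energy_nonneg)
    then have "?E (composition_operator \<phi> f) \<le> C * ?E f"
      using C(1) by (subst (asm) ennreal_le_iff) (auto simp: energy_nonneg)
    also have "\<dots> \<le> C * ?n\<^sup>2" using C(1) energy_le_norm by (intro mult_left_mono) auto
    finally have 2: "?E (composition_operator \<phi> f) \<le> C * ?n\<^sup>2" .
    have "(dirichlet_norm \<alpha> (composition_operator \<phi> f))\<^sup>2 \<le> (R * ?n)\<^sup>2 + C * ?n\<^sup>2"
      proof -
      have "(dirichlet_norm \<alpha> (composition_operator \<phi> f))\<^sup>2 =
          (cmod (composition_operator \<phi> f 0))\<^sup>2 + ?E (composition_operator \<phi> f)"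
        by (rule dirichlet_norm_square)
      then show ?thesis using 1 2 by linarith
    qed
    also have "\<dots> = (sqrt (R\<^sup>2 + C) * ?n)\<^sup>2" using C(1) by (simp add: power_mult_distrib distrib_right)
    finally show "(dirichlet_norm \<alpha> (composition_operator \<phi> f))\<^sup>2 \<le> (sqrt (R\<^sup>2 + C) * ?n)\<^sup>2" .
  qed (use C(1) in simp)
  moreover have "composition_operator \<phi> (\<lambda>z. a * f z + b * g z) = (\<lambda>z. a * composition_operator \<phi> f z + b * composition_operator \<phi> g z)"
    for f g a b by (auto simp: composition_operator_def)
  ultimately show "bounded_operator \<alpha> (composition_operator \<phi>)"
    unfolding bounded_operator_def using mem by blast
qed

end

section \<open>Sequences that tend to zero\<close>

context
  fixes \<alpha> :: real
  assumes \<alpha>: "-1 < \<alpha>"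
begin

text \<open>A bound in \<open>L\<^sup>2\<close> of a finite measure makes the sequence uniformly integrable. This is expressed by
  the pointwise inequality \<open>x \<le> \<epsilon> x\<^sup>2 + min x (1 / \<epsilon>)\<close>.\<close>

lemma L1_tendsto_zero:
  fixes G :: "nat \<Rightarrow> complex \<Rightarrow> complex"
  assumes c: "\<And>n. continuous_on unit_disk (G n)"
    and i: "\<And>n. square_integrable \<alpha> (G n)"
    and M: "\<And>n. (square_integral \<alpha> (G n)) \<le> M"
    and lim: "\<And>z. z \<in> unit_disk \<Longrightarrow> (\<lambda>n. G n z) \<longlonglongrightarrow> 0"
  shows "(\<lambda>n. LINT z:unit_disk|weighted_area \<alpha>. cmod (G n z)) \<longlonglongrightarrow> 0"
proof -
  let ?M = "weighted_area \<alpha>"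
  interpret finite_measure ?M by (rule finite_measure_weighted_area[OF \<alpha>])
  have M0: "0 \<le> M" using order_trans[OF energy_nonneg M[of 0]] .
  have nonneg: "0 \<le> (LINT z:unit_disk|?M. cmod (G n z))" for n
    unfolding set_lebesgue_integral_def by (rule integral_nonneg_AE) (auto simp: indicator_def)
  have main: "\<exists>N. \<forall>n\<ge>N. (LINT z:unit_disk|?M. cmod (G n z)) < e" if e: "0 < e" for e
  proof -
    define \<epsilon> where "\<epsilon> = e / (2 * (M + 1))"
    have \<epsilon>: "0 < \<epsilon>" "\<epsilon> * M < e / 2" using e M0 by (auto simp: \<epsilon>_def field_simps)
    let ?m = "\<lambda>n z. indicator unit_disk z *\<^sub>R min (cmod (G n z)) (1 / \<epsilon>)"
    have mm: "?m n \<in> borel_measurable ?M" for n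
      by (intro measurable_continuous_on_weighted_area continuous_intros c)
    have im: "integrable ?M (?m n)" for n
      by (rule integrable_const_bound[where B="1 / \<epsilon>"])
        (use mm \<epsilon> in \<open>auto simp: indicator_def\<close>)
    have "(\<lambda>n. \<integral>z. ?m n z \<partial>?M) \<longlonglongrightarrow> (\<integral>z. 0 \<partial>?M)"
    proof (rule integral_dominated_convergence[where w="\<lambda>_. 1 / \<epsilon>"])
      show "AE z in ?M. (\<lambda>n. ?m n z) \<longlonglongrightarrow> 0"
      proof (intro always_eventually allI)
        fix z
        show "(\<lambda>n. ?m n z) \<longlonglongrightarrow> 0"
        proof (cases "z \<in> unit_disk")
          case True
          have "(\<lambda>n. min (cmod (G n z)) (1 / \<epsilon>)) \<longlonglongrightarrow> min (cmod 0) (1 / \<epsilon>)"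
            by (intro tendsto_intros lim True)
          then show ?thesis using True \<epsilon> by simp
        qed simp
      qed
      show "AE z in ?M. norm (?m n z) \<le> 1 / \<epsilon>" for n
        using \<epsilon> by (intro always_eventually) (auto simp: indicator_def)
    qed (use mm in auto)
    then have "(\<lambda>n. \<integral>z. ?m n z \<partial>?M) \<longlonglongrightarrow> 0" by simp
    then have "\<forall>\<^sub>F n in sequentially. (\<integral>z. ?m n z \<partial>?M) < e / 2"
      using e by (intro order_tendstoD(2)) auto
    then obtain N where N: "\<And>n. n \<ge> N \<Longrightarrow> (\<integral>z. ?m n z \<partial>?M) < e / 2"
      unfolding eventually_sequentially by blast
    have "(LINT z:unit_disk|?M. cmod (G n z)) < e" if n: "n \<ge> N" for n
    proof -
      have i2: "integrable ?M (\<lambda>z. \<epsilon> * (indicator unit_disk z *\<^sub>R (cmod (G n z))\<^sup>2))"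
        using i[of n] unfolding set_integrable_def by (rule integrable_mult_right)
      have i1: "integrable ?M (\<lambda>z. indicator unit_disk z *\<^sub>R cmod (G n z))"
        using integrable_norm[OF set_integrable_of_square[OF \<alpha> c i, unfolded set_integrable_def]]
        by simp
      have "(LINT z:unit_disk|?M. cmod (G n z)) \<le> (\<integral>z. \<epsilon> * (indicator unit_disk z *\<^sub>R (cmod (G n z))\<^sup>2) + ?m n z \<partial>?M)"
        unfolding set_lebesgue_integral_def
      proof (rule integral_mono[OF i1 Bochner_Integration.integrable_add[OF i2 im]])
        fix z
        have "x \<le> \<epsilon> * x\<^sup>2 + min x (1 / \<epsilon>)" if "0 \<le> x" for x
        proof (cases "x \<le> 1 / \<epsilon>")
          case False
          then have "1 \<le> \<epsilon> * x" using \<epsilon> by (simp add: field_simps)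
          then have "x * 1 \<le> x * (\<epsilon> * x)" using that by (intro mult_left_mono)
          then have "x \<le> \<epsilon> * x\<^sup>2" by (simp add: power2_eq_square mult_ac)
          moreover have "0 \<le> min x (1 / \<epsilon>)" using that \<epsilon> by simp
          ultimately show ?thesis by linarith
        qed (use \<epsilon> in simp)
        then show "indicator unit_disk z *\<^sub>R cmod (G n z) \<le> \<epsilon> * (indicator unit_disk z *\<^sub>R (cmod (G n z))\<^sup>2) + ?m n z"
          by (simp add: indicator_def)
      qed
      also have "\<dots> = \<epsilon> * (LINT z:unit_disk|?M. (cmod (G n z))\<^sup>2) + (\<integral>z. ?m n z \<partial>?M)"
        unfolding set_lebesgue_integral_def by (subst Bochner_Integration.integral_add[OF i2 im]) simp
      also have "\<dots> \<le> \<epsilon> * M + (\<integral>z. ?m n z \<partial>?M)"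
        using \<epsilon> M[of n] by simp
      also have "\<dots> < e" using \<epsilon>(2) N[OF n] by linarith
      finally show ?thesis .
    qed
    then show ?thesis by blast
  qed
  show ?thesis
  proof (rule LIMSEQ_I)
    fix e :: real assume "0 < e"
    then show "\<exists>N. \<forall>n\<ge>N. norm ((LINT z:unit_disk|?M. cmod (G n z)) - 0) < e"
      using main[of e] nonneg by auto
  qed
qed

text \<open>The unit ball of the space is a normal family, and Fatou's lemma keeps the limit in the
  space.\<close>

lemma dirichlet_ball_subsequence:
  assumes F: "\<And>n. F n \<in> dirichlet_space \<alpha>" "\<And>n. dirichlet_norm \<alpha> (F n) \<le> 1"
  shows "\<exists>f\<in>dirichlet_space \<alpha>. \<exists>r. strict_mono (r :: nat \<Rightarrow> nat) \<and> (\<lambda>n. F (r n) 0) \<longlonglongrightarrow> f 0 \<and>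
     (\<forall>z\<in>unit_disk. (\<lambda>n. deriv (F (r n)) z) \<longlonglongrightarrow> deriv f z)"
proof -
  have hF: "F n holomorphic_on unit_disk" for n by (rule dirichlet_spaceD(1)[OF \<alpha> F(1)])
  obtain g r where g: "g holomorphic_on unit_disk" and r: "strict_mono (r :: nat \<Rightarrow> nat)"
    and pt: "\<And>x. x \<in> unit_disk \<Longrightarrow> (\<lambda>n. F (r n) x) \<longlonglongrightarrow> g x"
    and unif: "\<And>K. compact K \<Longrightarrow> K \<subseteq> unit_disk \<Longrightarrow> uniform_limit K (F \<circ> r) g sequentially"
  proof (rule Montel[of unit_disk "range F" F])
    show "\<exists>B. \<forall>h\<in>range F. \<forall>z\<in>K. cmod (h z) \<le> B" if K: "compact K" "K \<subseteq> unit_disk" for K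
    proof (cases "K = {}")
      case False
      obtain z0 where z0: "z0 \<in> K" "\<And>z. z \<in> K \<Longrightarrow> cmod z \<le> cmod z0"
        using continuous_attains_sup[OF K(1) False, of cmod] by (auto intro: continuous_intros)
      define B where "B = 1 + sqrt ((1 - (cmod z0)\<^sup>2) powr (- (\<alpha> + 2)))"
      have "cmod (F n z) \<le> B" if z: "z \<in> K" for n z
      proof -
        have zD: "z \<in> unit_disk" "z0 \<in> unit_disk" using z z0 K by auto
        have "(cmod z)\<^sup>2 \<le> (cmod z0)\<^sup>2" using z0(2)[OF z] by (rule power_mono) simp
        then have "(1 - (cmod z)\<^sup>2) powr (- (\<alpha> + 2)) \<le> (1 - (cmod z0)\<^sup>2) powr (- (\<alpha> + 2))"
          using \<alpha> one_minus_norm_square_pos[OF zD(2)] by (intro powr_mono2') auto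
        then have "1 + sqrt ((1 - (cmod z)\<^sup>2) powr (- (\<alpha> + 2))) \<le> B" by (simp add: B_def)
        then have "(1 + sqrt ((1 - (cmod z)\<^sup>2) powr (- (\<alpha> + 2)))) * dirichlet_norm \<alpha> (F n) \<le> B * 1"
          by (intro mult_mono F(2)) (auto simp: B_def)
        then show ?thesis using norm_point_le[OF \<alpha> F(1) zD(1), of n] by linarith
      qed
      then show ?thesis by blast
    qed simp
  qed (use hF in auto)
  define f where "f z = (if z \<in> unit_disk then g z else 0)" for z
  have hf: "f holomorphic_on unit_disk" by (rule holomorphic_transform[OF g]) (simp add: f_def)
  have dlim: "(\<lambda>n. deriv (F (r n)) z) \<longlonglongrightarrow> deriv f z" if z: "z \<in> unit_disk" for z
  proof -
    obtain e where e: "0 < e" "cball z e \<subseteq> unit_disk"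
      using z open_ball[of "0::complex" 1] unfolding open_contains_cball by blast
    have ul: "uniform_limit (ball z e) (F \<circ> r) g sequentially"
      by (rule uniform_limit_on_subset[OF unif[OF compact_cball e(2)]]) auto
    have "(\<lambda>n. (deriv ^^ 1) ((F \<circ> r) n) z) \<longlonglongrightarrow> (deriv ^^ 1) g z"
    proof (rule higher_deriv_complex_uniform_limit[OF ul])
      show "\<forall>\<^sub>F n in sequentially. (F \<circ> r) n holomorphic_on ball z e"
        using holomorphic_on_subset[OF hF order_trans[OF ball_subset_cball e(2)]]
        by (intro always_eventually) simp
    qed (use e in auto)
    moreover have "deriv f z = deriv g z" by (rule deriv_cong_disk[OF _ z]) (simp add: f_def)
    ultimately show ?thesis by simp
  qed
  have "bergman_energy \<alpha> (deriv f) \<le> 1"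
  proof -
    let ?h = "\<lambda>u z. indicator unit_disk z * ennreal ((cmod (deriv u z))\<^sup>2)"
    have "bergman_energy \<alpha> (deriv f) \<le> (\<integral>\<^sup>+z. liminf (\<lambda>n. ?h (F (r n)) z) \<partial>weighted_area \<alpha>)"
      unfolding bergman_energy_def
    proof (intro nn_integral_mono)
      fix z
      show "?h f z \<le> liminf (\<lambda>n. ?h (F (r n)) z)"
      proof (cases "z \<in> unit_disk")
        case True
        have "(\<lambda>n. ennreal ((cmod (deriv (F (r n)) z))\<^sup>2)) \<longlonglongrightarrow> ennreal ((cmod (deriv f z))\<^sup>2)"
          by (intro tendsto_intros dlim True)
        then have "(\<lambda>n. ?h (F (r n)) z) \<longlonglongrightarrow> ?h f z" using True by simp
        then have "liminf (\<lambda>n. ?h (F (r n)) z) = ?h f z" by (rule lim_imp_Liminf[rotated]) simp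
        then show ?thesis by simp
      qed simp
    qed
    also have "\<dots> \<le> liminf (\<lambda>n. \<integral>\<^sup>+z. ?h (F (r n)) z \<partial>weighted_area \<alpha>)"
      by (rule nn_integral_liminf)
        (intro borel_imp_measurable_weighted_area measurable_energy_integrand dirichlet_spaceD(4)[OF \<alpha> F(1)])
    also have "\<dots> \<le> liminf (\<lambda>n. 1)"
    proof (intro Liminf_mono always_eventually allI)
      fix n
      have "bergman_energy \<alpha> (deriv (F (r n))) = ennreal (square_integral \<alpha> (deriv (F (r n))))"
        by (rule set_integrable_square_iff(2)[OF dirichlet_spaceD(4,3)[OF \<alpha> F(1)]])
      also have "\<dots> \<le> ennreal 1"
      proof (rule ennreal_leI)
        have "(dirichlet_norm \<alpha> (F (r n)))\<^sup>2 \<le> 1" using F(2)[of "r n"] by (simp add: power_le_one)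
        then show "(square_integral \<alpha> (deriv (F (r n)))) \<le> 1"
          using energy_le_norm[where f="F (r n)"] by (rule order_trans[rotated])
      qed
      finally show "(\<integral>\<^sup>+z. ?h (F (r n)) z \<partial>weighted_area \<alpha>) \<le> 1" by (simp add: bergman_energy_def)
    qed
    also have "\<dots> = 1" by (simp add: Liminf_const)
    finally show ?thesis .
  qed
  then have "f \<in> dirichlet_space \<alpha>"
    unfolding dirichlet_space_iff[OF \<alpha>] using hf by (auto simp: f_def intro: le_less_trans)
  moreover have "(\<lambda>n. F (r n) 0) \<longlonglongrightarrow> f 0" using pt[of 0] by (simp add: f_def)
  ultimately show ?thesis using r dlim by blast
qed

text \<open>By normality every sequence in the unit ball is reduced to a sequence of the kind considered here,
  after passing to a subsequence and subtracting its limit.\<close>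

lemma compact_operatorI:
  assumes T: "bounded_operator \<alpha> T"
    and small: "\<And>G M. (\<And>n. G n \<in> dirichlet_space \<alpha>) \<Longrightarrow> (\<And>n. dirichlet_norm \<alpha> (G n) \<le> M) \<Longrightarrow>
      (\<lambda>n. G n 0) \<longlonglongrightarrow> 0 \<Longrightarrow> (\<And>z. z \<in> unit_disk \<Longrightarrow> (\<lambda>n. deriv (G n) z) \<longlonglongrightarrow> 0) \<Longrightarrow>
      (\<lambda>n. dirichlet_norm \<alpha> (T (G n))) \<longlonglongrightarrow> 0"
  shows "compact_operator \<alpha> T"
  unfolding compact_operator_def
proof (intro conjI T allI impI)
  fix F :: "nat \<Rightarrow> complex \<Rightarrow> complex"
  assume "\<forall>n. F n \<in> dirichlet_space \<alpha> \<and> dirichlet_norm \<alpha> (F n) \<le> 1"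
  then have F: "\<And>n. F n \<in> dirichlet_space \<alpha>" "\<And>n. dirichlet_norm \<alpha> (F n) \<le> 1" by auto
  obtain f r where f: "f \<in> dirichlet_space \<alpha>" and r: "strict_mono (r :: nat \<Rightarrow> nat)"
    and l0: "(\<lambda>n. F (r n) 0) \<longlonglongrightarrow> f 0"
    and ld: "\<And>z. z \<in> unit_disk \<Longrightarrow> (\<lambda>n. deriv (F (r n)) z) \<longlonglongrightarrow> deriv f z"
    using dirichlet_ball_subsequence[of F, OF F] by blast
  let ?G = "\<lambda>n z. F (r n) z - f z"
  have "(\<lambda>n. dirichlet_norm \<alpha> (T (?G n))) \<longlonglongrightarrow> 0"
  proof (rule small)
    show "?G n \<in> dirichlet_space \<alpha>" for n by (rule dirichlet_diff[OF \<alpha> F(1) f])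
    show "dirichlet_norm \<alpha> (?G n) \<le> 1 + dirichlet_norm \<alpha> f" for n
      using dirichlet_norm_triangle_diff[OF \<alpha> F(1) f, of "r n"] F(2)[of "r n"] by linarith
    show "(\<lambda>n. ?G n 0) \<longlonglongrightarrow> 0" using tendsto_diff[OF l0 tendsto_const[of "f 0"]] by simp
    show "(\<lambda>n. deriv (?G n) z) \<longlonglongrightarrow> 0" if z: "z \<in> unit_disk" for z
    proof -
      have "deriv (?G n) z = deriv (F (r n)) z - deriv f z" for n
        using deriv_lincomb[OF dirichlet_spaceD(1)[OF \<alpha> F(1)] dirichlet_spaceD(1)[OF \<alpha> f] z, of 1 "r n" "-1"] by simp
      then show ?thesis using tendsto_diff[OF ld[OF z] tendsto_const[of "deriv f z"]] by simp
    qed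
  qed
  moreover have "T (?G n) = (\<lambda>z. T (F (r n)) z - T f z)" for n
    by (rule bounded_operator_diff[OF \<alpha> T F(1) f])
  ultimately have "(\<lambda>n. dirichlet_norm \<alpha> (\<lambda>z. T (F (r n)) z - T f z)) \<longlonglongrightarrow> 0" by simp
  then show "\<exists>g\<in>dirichlet_space \<alpha>. \<exists>s. strict_mono s \<and> (\<lambda>n. dirichlet_norm \<alpha> (\<lambda>z. T (F (s n)) z - g z)) \<longlonglongrightarrow> 0"
    using bounded_operator_mem[OF \<alpha> T f] r by blast
qed

lemma deriv_disk_polynomial_bounded: "\<exists>C. \<forall>z\<in>unit_disk. cmod (deriv (disk_polynomial a N) z) \<le> C"
proof (induction N)
  case 0
  have "deriv (disk_polynomial a 0) z = 0" if "z \<in> unit_disk" for z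
    using deriv_cong_disk[of "disk_polynomial a 0" "\<lambda>_. 0", OF _ that] by (simp add: disk_polynomial_def)
  then show ?case by (intro exI[of _ 0]) simp
next
  case (Suc N)
  then obtain C where C: "\<And>z. z \<in> unit_disk \<Longrightarrow> cmod (deriv (disk_polynomial a N) z) \<le> C" by blast
  have "cmod (deriv (disk_polynomial a (Suc N)) z) \<le> C + cmod (a N) * real N" if z: "z \<in> unit_disk" for z
  proof -
    have "deriv (disk_polynomial a (Suc N)) z = 1 * deriv (disk_polynomial a N) z + a N * deriv (disk_monomial N) z"
      unfolding disk_polynomial_Suc
      by (rule deriv_lincomb[OF _ _ z]) (intro dirichlet_spaceD(1)[OF \<alpha>] disk_polynomial_mem disk_monomial_mem \<alpha>)+
    then have "cmod (deriv (disk_polynomial a (Suc N)) z) \<le> cmod (deriv (disk_polynomial a N) z) + cmod (a N) * (real N * cmod z ^ (N - 1))"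
      using norm_triangle_ineq[of "deriv (disk_polynomial a N) z" "a N * (of_nat N * z ^ (N - 1))"]
      by (simp add: deriv_disk_monomial[OF z] norm_mult norm_power)
    also have "\<dots> \<le> C + cmod (a N) * (real N * 1)"
      using z by (intro add_mono C mult_left_mono power_le_one) auto
    finally show ?thesis by simp
  qed
  then show ?case by blast
qed

text \<open>The normalized derivative kernels tend weakly to zero at the circle, since their norms are unbounded
  there while polynomials, which are dense, have bounded derivatives.\<close>

lemma deriv_over_kernel_norm_tendsto_zero:
  assumes g: "g \<in> dirichlet_space \<alpha>" and z: "\<And>n. z n \<in> unit_disk" and lim: "(\<lambda>n. cmod (z n)) \<longlonglongrightarrow> 1"
  shows "(\<lambda>n. cmod (deriv g (z n)) / dirichlet_norm \<alpha> (derivative_kernel \<alpha> (z n))) \<longlonglongrightarrow> 0"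
proof (rule LIMSEQ_I)
  fix e :: real assume e: "0 < e"
  let ?N = "\<lambda>w. dirichlet_norm \<alpha> (derivative_kernel \<alpha> w)"
  have Nform: "?N w = (1 - (cmod w)\<^sup>2) powr (- ((\<alpha> + 2) / 2))" if "w \<in> unit_disk" for w
  proof (rule power2_eq_imp_eq)
    show "(?N w)\<^sup>2 = ((1 - (cmod w)\<^sup>2) powr (- ((\<alpha> + 2) / 2)))\<^sup>2"
      unfolding norm_derivative_kernel[OF \<alpha> that] using one_minus_norm_square_pos[OF that]
      by (simp add: power2_eq_square powr_add[symmetric])
  qed auto
  have Npos: "0 < ?N w" if "w \<in> unit_disk" for w
    unfolding Nform[OF that] using one_minus_norm_square_pos[OF that] by simp
  define a where "a n = (deriv ^^ n) g 0 / fact n" for n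
  have s: "(\<lambda>n. a n * w ^ n) sums g w" if "w \<in> unit_disk" for w
    unfolding a_def by (rule taylor_disk[OF dirichlet_spaceD(1)[OF \<alpha> g] that])
  have "\<forall>\<^sub>F N in sequentially. dirichlet_norm \<alpha> (\<lambda>z. g z - disk_polynomial a N z) < e / 2"
    using disk_polynomial_tendsto[OF \<alpha> g s] e by (intro order_tendstoD(2)) auto
  then obtain N where N: "dirichlet_norm \<alpha> (\<lambda>z. g z - disk_polynomial a N z) < e / 2"
    by (auto simp: eventually_sequentially)
  let ?p = "disk_polynomial a N"
  have p: "?p \<in> dirichlet_space \<alpha>" by (rule disk_polynomial_mem[OF \<alpha>])
  obtain C where C: "\<And>w. w \<in> unit_disk \<Longrightarrow> cmod (deriv ?p w) \<le> C" using deriv_disk_polynomial_bounded by blast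
  have "(\<lambda>n. C * (1 - (cmod (z n))\<^sup>2) powr ((\<alpha> + 2) / 2)) \<longlonglongrightarrow> C * (1 - 1\<^sup>2) powr ((\<alpha> + 2) / 2)"
    using \<alpha> z one_minus_norm_square_pos[of "z _"]
    by (intro tendsto_intros tendsto_powr' lim) (auto intro!: always_eventually less_imp_le)
  then have "\<forall>\<^sub>F n in sequentially. C * (1 - (cmod (z n))\<^sup>2) powr ((\<alpha> + 2) / 2) < e / 2"
    using e by (intro order_tendstoD(2)) auto
  then obtain n0 where n0: "\<And>n. n \<ge> n0 \<Longrightarrow> C * (1 - (cmod (z n))\<^sup>2) powr ((\<alpha> + 2) / 2) < e / 2"
    unfolding eventually_sequentially by blast
  have "cmod (deriv g (z n)) / ?N (z n) < e" if n: "n \<ge> n0" for n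
  proof -
    have "deriv (\<lambda>z. g z - ?p z) (z n) = deriv g (z n) - deriv ?p (z n)"
      using deriv_lincomb[OF dirichlet_spaceD(1)[OF \<alpha> g] dirichlet_spaceD(1)[OF \<alpha> p] z, of 1 "-1" n] by simp
    then have "cmod (deriv g (z n)) \<le> cmod (deriv (\<lambda>z. g z - ?p z) (z n)) + cmod (deriv ?p (z n))"
      using norm_triangle_sub[of "deriv g (z n)" "deriv ?p (z n)"] by simp
    also have "\<dots> \<le> dirichlet_norm \<alpha> (\<lambda>z. g z - ?p z) * ?N (z n) + C"
      by (intro add_mono norm_deriv_le \<alpha> dirichlet_diff g p z C)
    finally have "cmod (deriv g (z n)) / ?N (z n) \<le> (dirichlet_norm \<alpha> (\<lambda>z. g z - ?p z) * ?N (z n) + C) / ?N (z n)"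
      using Npos[OF z, of n] by (intro divide_right_mono) auto
    also have "\<dots> = dirichlet_norm \<alpha> (\<lambda>z. g z - ?p z) + C / ?N (z n)"
      using Npos[OF z, of n] by (simp add: add_divide_distrib)
    also have "C / ?N (z n) = C * (1 - (cmod (z n))\<^sup>2) powr ((\<alpha> + 2) / 2)"
      unfolding Nform[OF z] by (simp add: powr_minus_divide)
    finally show ?thesis using N n0[OF n] by linarith
  qed
  then show "\<exists>n0. \<forall>n\<ge>n0. norm (cmod (deriv g (z n)) / ?N (z n) - 0) < e"
    by auto
qed

end

section \<open>The operator as an integral operator\<close>

context
  fixes \<alpha> :: real and \<phi> \<psi> :: "complex \<Rightarrow> complex" and a b c d a' b' c' d' :: complex
  assumes \<alpha>: "-1 < \<alpha>" and \<alpha>0: "\<alpha> < 0"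
    and lf\<phi>: "nonconst_lf_self_map a' b' c' d'" and \<phi>: "\<phi> = linear_fractional a' b' c' d'"
    and lf\<psi>: "nonconst_lf_self_map a b c d" and \<psi>: "\<psi> = linear_fractional a b c d"
begin

abbreviation adj :: fun_operator where
  "adj \<equiv> hilbert_adjoint \<alpha> (composition_operator \<psi>)"

abbreviation product :: fun_operator where
  "product \<equiv> composition_operator \<phi> \<circ> adj"

lemma composition_phi_bounded: "bounded_operator \<alpha> (composition_operator \<phi>)"
  by (rule composition_operator_bounded(1)[OF \<alpha> lf\<phi> \<phi>])

lemma composition_psi_bounded: "bounded_operator \<alpha> (composition_operator \<psi>)"
  by (rule composition_operator_bounded(1)[OF \<alpha> lf\<psi> \<psi>])

lemma adj_bounded: "bounded_operator \<alpha> adj"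
  using bounded_operator_adjoint[OF \<alpha> _ composition_psi_bounded] \<alpha>0 by simp

lemma product_bounded: "bounded_operator \<alpha> product"
  by (rule bounded_operator_compose[OF \<alpha> composition_phi_bounded adj_bounded])

lemma adj_mem: "f \<in> dirichlet_space \<alpha> \<Longrightarrow> adj f \<in> dirichlet_space \<alpha>"
  by (rule bounded_operator_mem[OF \<alpha> adj_bounded])

lemma phi_disk: "z \<in> unit_disk \<Longrightarrow> \<phi> z \<in> unit_disk"
  using lf_maps_disk[OF lf\<phi>] \<phi> by simp

lemma psi_disk: "z \<in> unit_disk \<Longrightarrow> \<psi> z \<in> unit_disk"
  using lf_maps_disk[OF lf\<psi>] \<psi> by simp

text \<open>With constants and derivative kernels for \<open>k\<close>, this gives the value and the derivative of the
  adjoint.\<close>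

lemma inner_adj:
  assumes f: "f \<in> dirichlet_space \<alpha>" and k: "k \<in> dirichlet_space \<alpha>"
  shows "dirichlet_inner \<alpha> (adj f) k =
    dirichlet_inner \<alpha> f (composition_operator \<psi> k)"
proof -
  have "dirichlet_inner \<alpha> (composition_operator \<psi> k) f =
      dirichlet_inner \<alpha> k (adj f)"
    using hilbert_adjoint(2)[OF \<alpha> _ composition_psi_bounded f k] \<alpha>0 by simp
  then show ?thesis by (metis dirichlet_inner_commute[OF \<alpha>])
qed

lemma adj_at_0:
  assumes f: "f \<in> dirichlet_space \<alpha>"
  shows "adj f 0 = f 0"
proof -
  have "composition_operator \<psi> disk_one = disk_one"
    using psi_disk by (auto simp: composition_operator_def disk_one_def)
  then show ?thesis using inner_adj[OF f disk_one(1)[OF \<alpha>]] inner_disk_one[OF \<alpha>] by simp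
qed

text \<open>The derivative of the adjoint is an integral operator acting on the derivative, up to a term of rank
  one.\<close>

lemma deriv_adj:
  assumes f: "f \<in> dirichlet_space \<alpha>" and u: "u \<in> unit_disk"
  shows "deriv (adj f) u =
     f 0 * cnj (derivative_kernel \<alpha> u (\<psi> 0)) +
     (LINT w:unit_disk|weighted_area \<alpha>. deriv f w * cnj (bergman_kernel \<alpha> u (\<psi> w) * deriv \<psi> w))"
proof -
  have "deriv (adj f) u = dirichlet_inner \<alpha> f (composition_operator \<psi> (derivative_kernel \<alpha> u))"
    using inner_derivative_kernel[OF \<alpha> adj_mem[OF f] u] inner_adj[OF f derivative_kernel(1)[OF \<alpha> u]] by simp
  also have "\<dots> = f 0 * cnj (derivative_kernel \<alpha> u (\<psi> 0)) +
     (LINT w:unit_disk|weighted_area \<alpha>. deriv f w * cnj (bergman_kernel \<alpha> u (\<psi> w) * deriv \<psi> w))"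
    unfolding dirichlet_inner_def
  proof (intro arg_cong2[where f="(+)"] set_lebesgue_integral_cong)
    show "f 0 * cnj (composition_operator \<psi> (derivative_kernel \<alpha> u) 0) = f 0 * cnj (derivative_kernel \<alpha> u (\<psi> 0))"
      by (simp add: composition_operator_def)
  qed (auto simp: composition_operator_bounded(2)[OF \<alpha> lf\<psi> \<psi> derivative_kernel(1)[OF \<alpha> u]]
        derivative_kernel(3)[OF \<alpha> u psi_disk])
  finally show ?thesis .
qed

lemma norm_deriv_adj_le:
  assumes f: "f \<in> dirichlet_space \<alpha>" and u: "u \<in> unit_disk" and \<delta>: "0 < \<delta>" "\<And>w. w \<in> unit_disk \<Longrightarrow> \<delta> \<le> cmod (1 - \<psi> w * cnj u)"
    and A: "\<And>w. w \<in> unit_disk \<Longrightarrow> cmod (deriv \<psi> w) \<le> A"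
  shows "cmod (deriv (adj f) u) \<le>
    (1 - cmod (\<psi> 0)) powr (- (\<alpha> + 2)) * cmod (f 0) +
    \<delta> powr (- (\<alpha> + 2)) * A * (LINT w:unit_disk|weighted_area \<alpha>. cmod (deriv f w))"
proof -
  let ?M = "weighted_area \<alpha>"
  have K: "cmod (derivative_kernel \<alpha> u (\<psi> 0)) \<le> (1 - cmod (\<psi> 0)) powr (- (\<alpha> + 2))"
  proof -
    have "cmod (derivative_kernel \<alpha> u (\<psi> 0) - derivative_kernel \<alpha> u 0) \<le> (1 - cmod (\<psi> 0)) powr (- (\<alpha> + 2))"
    proof (rule norm_diff_le_of_deriv_bound[OF \<alpha> dirichlet_spaceD(1)[OF \<alpha> derivative_kernel(1)[OF \<alpha> u]]])
      show p: "\<psi> 0 \<in> unit_disk" by (rule psi_disk) simp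
      fix v assume v: "cmod v \<le> cmod (\<psi> 0)"
      then have vD: "v \<in> unit_disk" using p by simp
      have "1 - cmod (\<psi> 0) \<le> 1 - cmod v" using v by simp
      also have "\<dots> \<le> cmod (1 - v * cnj u)"
        using norm_one_minus_mult_ge[OF u, of v] by (metis complex_cnj_cnj complex_cnj_diff complex_cnj_mult complex_cnj_one complex_mod_cnj mult.commute)
      finally have "1 - cmod (\<psi> 0) \<le> cmod (1 - v * cnj u)" .
      then show "cmod (deriv (derivative_kernel \<alpha> u) v) \<le> (1 - cmod (\<psi> 0)) powr (- (\<alpha> + 2))"
        unfolding derivative_kernel(3)[OF \<alpha> u vD] norm_bergman_kernel
        using \<alpha> p by (intro powr_mono2') auto
    qed
    then show ?thesis using derivative_kernel(2)[OF \<alpha> u] by simp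
  qed
  let ?I = "LINT w:unit_disk|?M. deriv f w * cnj (bergman_kernel \<alpha> u (\<psi> w) * deriv \<psi> w)"
  let ?C = "\<delta> powr (- (\<alpha> + 2)) * A"
  have intf: "integrable ?M (\<lambda>w. indicator unit_disk w *\<^sub>R cmod (deriv f w))"
    using integrable_norm[OF dirichlet_spaceD(6)[OF \<alpha> f, unfolded set_integrable_def]] by simp
  have k: "cmod (bergman_kernel \<alpha> u (\<psi> w) * deriv \<psi> w) \<le> ?C" if w: "w \<in> unit_disk" for w
  proof -
    have "cmod (bergman_kernel \<alpha> u (\<psi> w)) \<le> \<delta> powr (- (\<alpha> + 2))"
      unfolding norm_bergman_kernel using \<alpha> \<delta>(1) \<delta>(2)[OF w] by (intro powr_mono2') auto
    then show ?thesis unfolding norm_mult by (intro mult_mono A w) auto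
  qed
  have C0: "0 \<le> ?C" using k[of 0] norm_ge_zero order_trans by (metis centre_in_ball zero_less_one)
  have "cmod ?I \<le> (\<integral>w. ?C * (indicator unit_disk w *\<^sub>R cmod (deriv f w)) \<partial>?M)"
    unfolding set_lebesgue_integral_def
  proof (rule order_trans[OF integral_norm_bound integral_mono'])
    show "integrable ?M (\<lambda>w. ?C * (indicator unit_disk w *\<^sub>R cmod (deriv f w)))"
      using intf by (rule integrable_mult_right)
    fix w
    show "0 \<le> ?C * (indicator unit_disk w *\<^sub>R cmod (deriv f w))" using C0 by (simp add: indicator_def)
    show "cmod (indicator unit_disk w *\<^sub>R (deriv f w * cnj (bergman_kernel \<alpha> u (\<psi> w) * deriv \<psi> w))) \<le>
      ?C * (indicator unit_disk w *\<^sub>R cmod (deriv f w))"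
    proof (cases "w \<in> unit_disk")
      case True
      have "cmod (deriv f w * cnj (bergman_kernel \<alpha> u (\<psi> w) * deriv \<psi> w)) =
          cmod (deriv f w) * cmod (bergman_kernel \<alpha> u (\<psi> w) * deriv \<psi> w)"
        by (simp only: norm_mult[of "deriv f w"] complex_mod_cnj)
      also have "\<dots> \<le> cmod (deriv f w) * ?C" by (intro mult_left_mono k True) simp
      finally show ?thesis using True by (simp add: mult.commute)
    qed simp
  qed
  also have "\<dots> = ?C * (LINT w:unit_disk|?M. cmod (deriv f w))"
    by (simp add: set_lebesgue_integral_def)
  finally have I: "cmod ?I \<le> ?C * (LINT w:unit_disk|?M. cmod (deriv f w))" .
  have "cmod (deriv (adj f) u) \<le> cmod (f 0 * cnj (derivative_kernel \<alpha> u (\<psi> 0))) + cmod ?I"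
    unfolding deriv_adj[OF f u] by (rule norm_triangle_ineq)
  also have "cmod (f 0 * cnj (derivative_kernel \<alpha> u (\<psi> 0))) \<le> (1 - cmod (\<psi> 0)) powr (- (\<alpha> + 2)) * cmod (f 0)"
    using mult_left_mono[OF K norm_ge_zero[of "f 0"]] by (simp add: norm_mult mult.commute)
  finally show ?thesis using I by linarith
qed

section \<open>Compactness when the images do not meet on the circle\<close>

text \<open>By compactness of the closed bidisk the kernel of \<open>f \<mapsto> (product f)'\<close> is bounded, so this operator
  takes convergence of derivatives in \<open>L\<^sup>1\<close> to uniform convergence.\<close>

lemma product_compact:
  assumes apart: "\<And>z w. cmod z \<le> 1 \<Longrightarrow> cmod w \<le> 1 \<Longrightarrow> \<psi> w * cnj (\<phi> z) \<noteq> 1"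
  shows "compact_operator \<alpha> product"
proof (rule compact_operatorI[OF \<alpha> product_bounded])
  let ?M = "weighted_area \<alpha>" and ?A = "adj"
  fix G :: "nat \<Rightarrow> complex \<Rightarrow> complex" and M
  assume G: "\<And>n. G n \<in> dirichlet_space \<alpha>" and M: "\<And>n. dirichlet_norm \<alpha> (G n) \<le> M"
    and G0: "(\<lambda>n. G n 0) \<longlonglongrightarrow> 0" and Gd: "\<And>z. z \<in> unit_disk \<Longrightarrow> (\<lambda>n. deriv (G n) z) \<longlonglongrightarrow> 0"
  have "\<exists>\<delta>>0. \<forall>z\<in>cball 0 1. \<forall>w\<in>cball 0 1. \<delta> \<le> cmod (1 - \<psi> w * cnj (\<phi> z))"
  proof -
    let ?K = "cball (0::complex) 1 \<times> cball (0::complex) 1"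
    have c: "continuous_on (cball 0 1) \<phi>" "continuous_on (cball 0 1) \<psi>"
      using lf_continuous[OF lf\<phi>] lf_continuous[OF lf\<psi>] \<phi> \<psi> by simp_all
    have "continuous_on ?K (\<lambda>p. cmod (1 - \<psi> (snd p) * cnj (\<phi> (fst p))))"
      by (intro continuous_intros continuous_on_compose2[OF c(1)] continuous_on_compose2[OF c(2)]) auto
    then obtain p where p: "p \<in> ?K" "\<And>q. q \<in> ?K \<Longrightarrow>
        cmod (1 - \<psi> (snd p) * cnj (\<phi> (fst p))) \<le> cmod (1 - \<psi> (snd q) * cnj (\<phi> (fst q)))"
      using continuous_attains_inf[of ?K "\<lambda>p. cmod (1 - \<psi> (snd p) * cnj (\<phi> (fst p)))"]
      by (auto simp: compact_Times)
    have "0 < cmod (1 - \<psi> (snd p) * cnj (\<phi> (fst p)))"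
      using apart[of "fst p" "snd p"] p(1) by (auto simp: mem_Times_iff)
    then show ?thesis using p(2) by (intro exI[of _ "cmod (1 - \<psi> (snd p) * cnj (\<phi> (fst p)))"]) fastforce
  qed
  then obtain \<delta>0 where \<delta>0: "0 < \<delta>0" "\<And>z w. z \<in> unit_disk \<Longrightarrow> w \<in> unit_disk \<Longrightarrow> \<delta>0 \<le> cmod (1 - \<psi> w * cnj (\<phi> z))"
    by (metis less_imp_le mem_ball_0 mem_cball_0)
  define q where "q = \<phi> 0"
  have q: "q \<in> unit_disk" unfolding q_def by (rule phi_disk) simp
  \<comment> \<open>The second bound covers the disk of radius \<open>cmod q\<close>, where the derivative of the adjoint is needed
    to estimate the value of the product at the origin.\<close>
  define \<delta> where "\<delta> = min \<delta>0 (1 - cmod q)"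
  have \<delta>: "0 < \<delta>" using \<delta>0 q by (simp add: \<delta>_def)
  obtain A where A: "\<And>w. w \<in> unit_disk \<Longrightarrow> cmod (deriv \<psi> w) \<le> A"
    using lf_deriv_bounds[OF lf\<psi>] \<psi> by (metis less_imp_le mem_ball_0)
  obtain A' where A': "\<And>w. w \<in> unit_disk \<Longrightarrow> cmod (deriv \<phi> w) \<le> A'"
    using lf_deriv_bounds[OF lf\<phi>] \<phi> by (metis less_imp_le mem_ball_0)
  have A'0: "0 \<le> A'" using A'[of 0] norm_ge_zero order_trans by (metis centre_in_ball zero_less_one)
  define S where "S n = (1 - cmod (\<psi> 0)) powr (- (\<alpha> + 2)) * cmod (G n 0) +
    \<delta> powr (- (\<alpha> + 2)) * A * (LINT w:unit_disk|?M. cmod (deriv (G n) w))" for n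
  have Slim: "S \<longlonglongrightarrow> 0"
  proof -
    have "(\<lambda>n. LINT w:unit_disk|?M. cmod (deriv (G n) w)) \<longlonglongrightarrow> 0"
    proof (rule L1_tendsto_zero[OF \<alpha>])
      show "(LINT z:unit_disk|?M. (cmod (deriv (G n) z))\<^sup>2) \<le> M\<^sup>2" for n
        using energy_le_norm[where f="G n"] power_mono[OF M dirichlet_norm_nonneg, of n 2] by (rule order_trans)
    qed (use dirichlet_spaceD[OF \<alpha> G] Gd in auto)
    then have "S \<longlonglongrightarrow> (1 - cmod (\<psi> 0)) powr (- (\<alpha> + 2)) * cmod 0 + \<delta> powr (- (\<alpha> + 2)) * A * 0"
      unfolding S_def by (intro tendsto_intros G0)
    then show ?thesis by simp
  qed
  have S1: "cmod (deriv (?A (G n)) u) \<le> S n" if u: "u \<in> unit_disk" and "\<And>w. w \<in> unit_disk \<Longrightarrow> \<delta> \<le> cmod (1 - \<psi> w * cnj u)" for n u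
    unfolding S_def by (rule norm_deriv_adj_le[OF G u \<delta> that(2) A])
  have S2: "cmod (deriv (?A (G n)) (\<phi> z)) \<le> S n" if z: "z \<in> unit_disk" for n z
    by (rule S1[OF phi_disk[OF z]]) (use \<delta>0(2)[OF z] in \<open>force simp: \<delta>_def\<close>)
  have S3: "cmod (deriv (?A (G n)) u) \<le> S n" if u: "cmod u \<le> cmod q" for n u
  proof (rule S1)
    show "u \<in> unit_disk" using u q by simp
    show "\<delta> \<le> cmod (1 - \<psi> w * cnj u)" if "w \<in> unit_disk" for w
      using norm_one_minus_mult_ge[OF psi_disk[OF that], of u] u by (simp add: \<delta>_def)
  qed
  have S0: "0 \<le> S n" for n using S3[of 0 n] norm_ge_zero order_trans by (metis norm_zero)
  have bound: "dirichlet_norm \<alpha> ((composition_operator \<phi> \<circ> ?A) (G n)) \<le> cmod (G n 0) + S n + S n * A'" for n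
  proof (rule power2_le_imp_le)
    let ?T = "composition_operator \<phi> (?A (G n))"
    have Tm: "?T \<in> dirichlet_space \<alpha>" by (rule bounded_operator_mem[OF \<alpha> composition_phi_bounded adj_mem[OF G]])
    have "cmod (?A (G n) q - ?A (G n) 0) \<le> S n"
      by (rule norm_diff_le_of_deriv_bound[OF \<alpha> dirichlet_spaceD(1)[OF \<alpha> adj_mem[OF G]] q S3])
    then have "cmod (?A (G n) q) \<le> cmod (G n 0) + S n"
      using norm_triangle_sub[of "?A (G n) q" "G n 0"] by (simp add: adj_at_0[OF G])
    then have 1: "(cmod (?T 0))\<^sup>2 \<le> (cmod (G n 0) + S n)\<^sup>2"
      by (intro power_mono) (simp_all add: composition_operator_def q_def)
    have d: "cmod (deriv ?T z) \<le> S n * A'" if z: "z \<in> unit_disk" for z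
      unfolding composition_operator_bounded(2)[OF \<alpha> lf\<phi> \<phi> adj_mem[OF G] z] norm_mult
      by (intro mult_mono S2 A' z S0) auto
    have "norm (LINT z:unit_disk|?M. (cmod (deriv ?T z))\<^sup>2) \<le> (S n * A')\<^sup>2"
      by (rule norm_set_integral_le_const(1)[OF \<alpha> dirichlet_spaceD(3)[OF \<alpha> Tm]])
        (use d in \<open>auto intro!: power_mono\<close>)
    then have 2: "(LINT z:unit_disk|?M. (cmod (deriv ?T z))\<^sup>2) \<le> (S n * A')\<^sup>2" by simp
    have "(dirichlet_norm \<alpha> ((composition_operator \<phi> \<circ> ?A) (G n)))\<^sup>2 \<le> (cmod (G n 0) + S n)\<^sup>2 + (S n * A')\<^sup>2"
      unfolding dirichlet_norm_square o_def using 1 2 by (rule add_mono)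
    also have "\<dots> \<le> (cmod (G n 0) + S n + S n * A')\<^sup>2"
    proof -
      have "0 \<le> 2 * (cmod (G n 0) + S n) * (S n * A')" using S0[of n] A'0 by simp
      then show ?thesis by (simp only: power2_sum[of "cmod (G n 0) + S n" "S n * A'"])
    qed
    finally show "(dirichlet_norm \<alpha> ((composition_operator \<phi> \<circ> ?A) (G n)))\<^sup>2 \<le> (cmod (G n 0) + S n + S n * A')\<^sup>2" .
  qed (use S0[of n] A'0 in simp)
  have "(\<lambda>n. cmod (G n 0) + S n + S n * A') \<longlonglongrightarrow> cmod 0 + 0 + 0 * A'"
    by (intro tendsto_intros G0 Slim)
  then have "(\<lambda>n. cmod (G n 0) + S n + S n * A') \<longlonglongrightarrow> 0" by simp
  then show "(\<lambda>n. dirichlet_norm \<alpha> ((composition_operator \<phi> \<circ> ?A) (G n))) \<longlonglongrightarrow> 0"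
    by (rule tendsto_sandwich[OF _ _ tendsto_const, rotated 2]) (use bound in auto)
qed

section \<open>A lower bound when the images meet on the circle\<close>

text \<open>This is the chain rule for \<open>f \<circ> \<psi>\<close> at \<open>w\<close>, read through the reproducing property.\<close>

lemma adj_derivative_kernel:
  assumes w: "w \<in> unit_disk"
  shows "adj (derivative_kernel \<alpha> w) =
    (\<lambda>z. cnj (deriv \<psi> w) * derivative_kernel \<alpha> (\<psi> w) z)"
proof (rule hilbert_adjoint_eqI[OF \<alpha>])
  have k: "derivative_kernel \<alpha> (\<psi> w) \<in> dirichlet_space \<alpha>" by (rule derivative_kernel(1)[OF \<alpha> psi_disk[OF w]])
  show "(\<lambda>z. cnj (deriv \<psi> w) * derivative_kernel \<alpha> (\<psi> w) z) \<in> dirichlet_space \<alpha>" by (rule dirichlet_scale[OF \<alpha> k])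
  show "dirichlet_inner \<alpha> (composition_operator \<psi> f) (derivative_kernel \<alpha> w) =
     dirichlet_inner \<alpha> f (\<lambda>z. cnj (deriv \<psi> w) * derivative_kernel \<alpha> (\<psi> w) z)"
    if f: "f \<in> dirichlet_space \<alpha>" for f
    using dirichlet_inner_lincomb_right[OF \<alpha> k k f, of "cnj (deriv \<psi> w)" 0]
      inner_derivative_kernel[OF \<alpha> bounded_operator_mem[OF \<alpha> composition_psi_bounded f] w]
      inner_derivative_kernel[OF \<alpha> f psi_disk[OF w]]
      composition_operator_bounded(2)[OF \<alpha> lf\<psi> \<psi> f w]
    by simp
qed

lemma deriv_T_derivative_kernel:
  assumes w: "w \<in> unit_disk" and z: "z \<in> unit_disk"
  shows "cmod (deriv (product (derivative_kernel \<alpha> w)) z) =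
    cmod (deriv \<psi> w) * cmod (deriv \<phi> z) * cmod (1 - \<phi> z * cnj (\<psi> w)) powr (- (\<alpha> + 2))"
proof -
  let ?k = "derivative_kernel \<alpha> (\<psi> w)"
  have k: "?k \<in> dirichlet_space \<alpha>" by (rule derivative_kernel(1)[OF \<alpha> psi_disk[OF w]])
  have "deriv (\<lambda>z. cnj (deriv \<psi> w) * ?k z) (\<phi> z) = cnj (deriv \<psi> w) * bergman_kernel \<alpha> (\<psi> w) (\<phi> z)"
    using deriv_lincomb[OF dirichlet_spaceD(1)[OF \<alpha> k] dirichlet_spaceD(1)[OF \<alpha> k] phi_disk[OF z], of "cnj (deriv \<psi> w)" 0]
      derivative_kernel(3)[OF \<alpha> psi_disk[OF w] phi_disk[OF z]] by simp
  then show ?thesis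
    using composition_operator_bounded(2)[OF \<alpha> lf\<phi> \<phi> dirichlet_scale[OF \<alpha> k] z, of "cnj (deriv \<psi> w)"]
    by (simp add: adj_derivative_kernel[OF w] norm_mult norm_bergman_kernel)
qed

text \<open>The operator is tested with the normalized derivative kernels at \<open>t \<zeta>\<close> and \<open>t \<omega>\<close> as \<open>t\<close> tends to 1.
  The denominator \<open>1 - \<phi> (t \<zeta>) cnj (\<psi> (t \<omega>))\<close> is of order at most \<open>1 - t\<close>, which gives the lower bound
  \<open>m\<close>. For compact \<open>K\<close> a subsequence of the images of the kernels converges in norm to some \<open>g\<close>, and
  pairing \<open>g\<close> with the kernels at \<open>t \<zeta>\<close> gives zero in the limit.\<close>

lemma essential_norm_pos:
  assumes z1: "cmod \<zeta> = 1" and w1: "cmod \<omega> = 1" and meet: "\<phi> \<zeta> = \<psi> \<omega>" and c1: "cmod (\<phi> \<zeta>) = 1"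
  shows "0 < essential_norm \<alpha> product"
proof -
  let ?T = "product"
  let ?k = "derivative_kernel \<alpha>" and ?N = "dirichlet_norm \<alpha>" and ?s = "\<alpha> + 2"
  define t where "t n = 1 - 1 / (real n + 2)" for n
  have t: "0 < t n" "t n < 1" for n by (auto simp: t_def field_simps)
  have tlim: "t \<longlonglongrightarrow> 1" unfolding t_def by real_asymp
  define z where "z n = complex_of_real (t n) * \<zeta>" for n
  define w where "w n = complex_of_real (t n) * \<omega>" for n
  have nz: "cmod (z n) = t n" and nw: "cmod (w n) = t n" for n
    using t(1)[of n] z1 w1 by (auto simp: z_def w_def norm_mult)
  have zD: "z n \<in> unit_disk" and wD: "w n \<in> unit_disk" for n using nz nw t by simp_all
  obtain l1 u1 where l1: "0 < l1" "\<And>z. cmod z \<le> 1 \<Longrightarrow> l1 \<le> cmod (deriv \<phi> z)"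
    using lf_deriv_bounds[OF lf\<phi>] \<phi> by blast
  obtain l2 u2 where l2: "0 < l2" "\<And>z. cmod z \<le> 1 \<Longrightarrow> l2 \<le> cmod (deriv \<psi> z)"
    using lf_deriv_bounds[OF lf\<psi>] \<psi> by blast
  obtain L1 where L1: "0 < L1" "\<And>x y. cmod x \<le> 1 \<Longrightarrow> cmod y \<le> 1 \<Longrightarrow> cmod (\<phi> x - \<phi> y) \<le> L1 * cmod (x - y)"
    using lf_Lipschitz[OF lf\<phi>] \<phi> by blast
  obtain L2 where L2: "0 < L2" "\<And>x y. cmod x \<le> 1 \<Longrightarrow> cmod y \<le> 1 \<Longrightarrow> cmod (\<psi> x - \<psi> y) \<le> L2 * cmod (x - y)"
    using lf_Lipschitz[OF lf\<psi>] \<psi> by blast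
  define L where "L = L1 + L2"
  have L: "0 < L" using L1 L2 by (simp add: L_def)
  define m where "m = l2 * l1 * L powr (- ?s)"
  have m: "0 < m" using l1 l2 L by (simp add: m_def)
  have Nsq: "(?N (?k (z n)))\<^sup>2 = (1 - (t n)\<^sup>2) powr (- ?s)" "(?N (?k (w n)))\<^sup>2 = (1 - (t n)\<^sup>2) powr (- ?s)" for n
    using norm_derivative_kernel[OF \<alpha> zD] norm_derivative_kernel[OF \<alpha> wD] nz nw by simp_all
  have Neq: "?N (?k (z n)) = ?N (?k (w n))" for n
    by (rule power2_eq_imp_eq) (simp_all add: Nsq)
  have t2: "0 < 1 - (t n)\<^sup>2" for n using one_minus_norm_square_pos[OF zD[of n]] nz by simp
  have Npos: "0 < ?N (?k (w n))" for n
  proof -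
    have "?N (?k (w n)) \<noteq> 0" using Nsq(2)[of n] t2[of n] by auto
    then show ?thesis using dirichlet_norm_nonneg[of \<alpha> "?k (w n)"] by linarith
  qed
  have close: "cmod (1 - \<phi> (z n) * cnj (\<psi> (w n))) \<le> L * (1 - t n)" for n
  proof -
    let ?\<xi> = "\<phi> \<zeta>"
    have "cmod (\<zeta> - z n) = 1 - t n" "cmod (\<omega> - w n) = 1 - t n"
    proof -
      have "\<zeta> - z n = complex_of_real (1 - t n) * \<zeta>" "\<omega> - w n = complex_of_real (1 - t n) * \<omega>"
        by (simp_all add: z_def w_def algebra_simps)
      then show "cmod (\<zeta> - z n) = 1 - t n" "cmod (\<omega> - w n) = 1 - t n"
        using t(2)[of n] z1 w1 by (simp_all add: norm_mult del: of_real_diff)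
    qed
    then have d: "cmod (?\<xi> - \<phi> (z n)) \<le> L1 * (1 - t n)" "cmod (?\<xi> - \<psi> (w n)) \<le> L2 * (1 - t n)"
      using L1(2)[of \<zeta> "z n"] L2(2)[of \<omega> "w n"] z1 w1 nz[of n] nw[of n] t[of n] meet by simp_all
    have "?\<xi> * cnj ?\<xi> = 1" using c1 by (simp add: complex_norm_square[symmetric])
    then have "1 - \<phi> (z n) * cnj (\<psi> (w n)) = (?\<xi> - \<phi> (z n)) * cnj ?\<xi> + \<phi> (z n) * cnj (?\<xi> - \<psi> (w n))"
      by (simp add: algebra_simps)
    then have "cmod (1 - \<phi> (z n) * cnj (\<psi> (w n))) \<le> cmod ((?\<xi> - \<phi> (z n)) * cnj ?\<xi>) + cmod (\<phi> (z n) * cnj (?\<xi> - \<psi> (w n)))"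
      by (simp only: norm_triangle_ineq)
    also have "\<dots> = cmod (?\<xi> - \<phi> (z n)) + cmod (\<phi> (z n)) * cmod (?\<xi> - \<psi> (w n))"
      using c1 by (simp only: norm_mult complex_mod_cnj)
    also have "\<dots> \<le> L1 * (1 - t n) + 1 * (L2 * (1 - t n))"
      using phi_disk[OF zD, of n] by (intro add_mono mult_mono d) auto
    finally show ?thesis by (simp add: L_def distrib_right)
  qed
  have big: "m * (?N (?k (w n)) * ?N (?k (z n))) \<le> cmod (deriv (?T (?k (w n))) (z n))" for n
  proof -
    have "cmod (\<phi> (z n) * cnj (\<psi> (w n))) < 1" by (rule norm_mult_cnj_less_1[OF phi_disk[OF zD] psi_disk[OF wD]])
    then have p: "0 < cmod (1 - \<phi> (z n) * cnj (\<psi> (w n)))" by auto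
    have "1 - t n \<le> 1 - (t n)\<^sup>2" using t[of n] by (simp add: power2_eq_square mult_left_le)
    then have "cmod (1 - \<phi> (z n) * cnj (\<psi> (w n))) \<le> L * (1 - (t n)\<^sup>2)"
      using close[of n] L mult_left_mono[of "1 - t n" "1 - (t n)\<^sup>2" L] by linarith
    then have "(L * (1 - (t n)\<^sup>2)) powr (- ?s) \<le> cmod (1 - \<phi> (z n) * cnj (\<psi> (w n))) powr (- ?s)"
      using p \<alpha> by (intro powr_mono2') auto
    then have e: "L powr (- ?s) * (1 - (t n)\<^sup>2) powr (- ?s) \<le> cmod (1 - \<phi> (z n) * cnj (\<psi> (w n))) powr (- ?s)"
      by (simp add: powr_mult)
    have "m * (?N (?k (w n)) * ?N (?k (z n))) = l2 * l1 * (L powr (- ?s) * (1 - (t n)\<^sup>2) powr (- ?s))"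
      unfolding Neq using Nsq(2)[of n] by (simp add: m_def power2_eq_square mult_ac)
    also have "\<dots> \<le> cmod (deriv \<psi> (w n)) * cmod (deriv \<phi> (z n)) * cmod (1 - \<phi> (z n) * cnj (\<psi> (w n))) powr (- ?s)"
      using l1 l2 nz[of n] nw[of n] t[of n] by (intro mult_mono e l1(2) l2(2)) auto
    also have "\<dots> = cmod (deriv (?T (?k (w n))) (z n))"
      by (rule deriv_T_derivative_kernel[OF wD zD, symmetric])
    finally show ?thesis .
  qed
  define F where "F n = (\<lambda>x. complex_of_real (1 / ?N (?k (w n))) * ?k (w n) x)" for n
  have km: "?k (w n) \<in> dirichlet_space \<alpha>" "?k (z n) \<in> dirichlet_space \<alpha>" for n
    by (rule derivative_kernel(1)[OF \<alpha>], rule wD zD)+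
  have Fm: "F n \<in> dirichlet_space \<alpha>" for n unfolding F_def by (rule dirichlet_scale[OF \<alpha> km(1)])
  have F1: "?N (F n) = 1" for n
    unfolding F_def dirichlet_norm_scale[OF \<alpha> km(1)] using Npos[of n] by (simp add: norm_divide)
  have "m \<le> operator_norm \<alpha> (\<lambda>f z. ?T f z - K f z)" if K: "compact_operator \<alpha> K" for K
  proof -
    have Kb: "bounded_operator \<alpha> K" using K by (simp add: compact_operator_def)
    have "(\<forall>n. F n \<in> dirichlet_space \<alpha> \<and> ?N (F n) \<le> 1) \<longrightarrow>
        (\<exists>g\<in>dirichlet_space \<alpha>. \<exists>s. strict_mono s \<and> (\<lambda>n. ?N (\<lambda>z. K (F (s n)) z - g z)) \<longlonglongrightarrow> 0)"
      using K unfolding compact_operator_def by (rule conjunct2[THEN spec])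
    then obtain g s where g: "g \<in> dirichlet_space \<alpha>" and s: "strict_mono (s :: nat \<Rightarrow> nat)"
      and glim: "(\<lambda>n. ?N (\<lambda>x. K (F (s n)) x - g x)) \<longlonglongrightarrow> 0"
      using Fm F1 by auto
    have le: "m \<le> operator_norm \<alpha> (\<lambda>f z. ?T f z - K f z) + ?N (\<lambda>x. K (F (s n)) x - g x) +
        cmod (deriv g (z (s n))) / ?N (?k (z (s n)))" for n
    proof -
      define j where "j = s n"
      let ?Nz = "?N (?k (z j))"
      have Nz: "0 < ?Nz" unfolding Neq by (rule Npos)
      have TF: "?T (F j) \<in> dirichlet_space \<alpha>" by (rule bounded_operator_mem[OF \<alpha> product_bounded Fm])
      have KF: "K (F j) \<in> dirichlet_space \<alpha>" by (rule bounded_operator_mem[OF \<alpha> Kb Fm])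
      have D: "(\<lambda>x. ?T (F j) x - K (F j) x) \<in> dirichlet_space \<alpha>" by (rule dirichlet_diff[OF \<alpha> TF KF])
      have Kg: "(\<lambda>x. K (F j) x - g x) \<in> dirichlet_space \<alpha>" by (rule dirichlet_diff[OF \<alpha> KF g])
      have "?T (F j) = (\<lambda>x. complex_of_real (1 / ?N (?k (w j))) * ?T (?k (w j)) x)"
        using bounded_operator_linear[OF \<alpha> product_bounded km(1) km(1), of "complex_of_real (1 / ?N (?k (w j)))" j 0 j]
        by (simp add: F_def)
      then have "deriv (?T (F j)) (z j) = complex_of_real (1 / ?N (?k (w j))) * deriv (?T (?k (w j))) (z j)"
        using deriv_lincomb[OF dirichlet_spaceD(1)[OF \<alpha> bounded_operator_mem[OF \<alpha> product_bounded km(1)]]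
            dirichlet_spaceD(1)[OF \<alpha> bounded_operator_mem[OF \<alpha> product_bounded km(1)]] zD,
            of "complex_of_real (1 / ?N (?k (w j)))" j 0 j j] by simp
      then have dT: "cmod (deriv (?T (F j)) (z j)) = cmod (deriv (?T (?k (w j))) (z j)) / ?N (?k (w j))"
        by (simp add: norm_mult norm_divide)
      have "m * ?Nz \<le> cmod (deriv (?T (F j)) (z j))"
        unfolding dT using big[of j] Npos[of j] by (simp add: le_divide_eq mult_ac)
      also have "deriv (?T (F j)) (z j) = deriv (\<lambda>x. ?T (F j) x - K (F j) x) (z j) + deriv (\<lambda>x. K (F j) x - g x) (z j) + deriv g (z j)"
        using deriv_lincomb[OF dirichlet_spaceD(1)[OF \<alpha> TF] dirichlet_spaceD(1)[OF \<alpha> KF] zD, of 1 "-1" j]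
          deriv_lincomb[OF dirichlet_spaceD(1)[OF \<alpha> KF] dirichlet_spaceD(1)[OF \<alpha> g] zD, of 1 "-1" j] by simp
      also have "cmod \<dots> \<le> cmod (deriv (\<lambda>x. ?T (F j) x - K (F j) x) (z j)) + cmod (deriv (\<lambda>x. K (F j) x - g x) (z j)) + cmod (deriv g (z j))"
        by (rule order_trans[OF norm_triangle_ineq]) (intro add_right_mono norm_triangle_ineq)
      also have "\<dots> \<le> ?N (\<lambda>x. ?T (F j) x - K (F j) x) * ?Nz + ?N (\<lambda>x. K (F j) x - g x) * ?Nz + cmod (deriv g (z j))"
        by (intro add_mono norm_deriv_le \<alpha> D Kg zD) simp
      also have "\<dots> \<le> operator_norm \<alpha> (\<lambda>f z. ?T f z - K f z) * ?Nz + ?N (\<lambda>x. K (F j) x - g x) * ?Nz + cmod (deriv g (z j))"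
        using operator_norm_ge[OF \<alpha> bounded_operator_minus[OF \<alpha> product_bounded Kb] Fm, of j] F1[of j] Nz
        by (intro add_mono mult_right_mono) auto
      finally have "m * ?Nz \<le> (operator_norm \<alpha> (\<lambda>f z. ?T f z - K f z) + ?N (\<lambda>x. K (F j) x - g x) + cmod (deriv g (z j)) / ?Nz) * ?Nz"
        using Nz by (simp add: distrib_right)
      then show ?thesis using Nz unfolding j_def by (simp only: mult_le_cancel_right_pos)
    qed
    have zlim: "(\<lambda>n. cmod (z (s n))) \<longlonglongrightarrow> 1"
      unfolding nz using LIMSEQ_subseq_LIMSEQ[OF tlim s] by (simp add: o_def)
    have "(\<lambda>n. operator_norm \<alpha> (\<lambda>f z. ?T f z - K f z) + ?N (\<lambda>x. K (F (s n)) x - g x) +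
        cmod (deriv g (z (s n))) / ?N (?k (z (s n)))) \<longlonglongrightarrow> operator_norm \<alpha> (\<lambda>f z. ?T f z - K f z) + 0 + 0"
      by (intro tendsto_add tendsto_const glim deriv_over_kernel_norm_tendsto_zero[OF \<alpha> g zD zlim])
    then have "m \<le> operator_norm \<alpha> (\<lambda>f z. ?T f z - K f z) + 0 + 0"
      by (rule LIMSEQ_le_const) (use le in blast)
    then show ?thesis by simp
  qed
  then have "m \<le> essential_norm \<alpha> ?T" by (rule essential_norm_ge[OF \<alpha>])
  with m show ?thesis by linarith
qed

end

section \<open>Hyperbolic disks\<close>

text \<open>The hyperbolic radius \<open>r\<close> corresponds to the pseudohyperbolic radius \<open>tanh r\<close>.\<close>

lemma hyperbolic_disk_eq:
  assumes r: "0 < r" and z: "z \<in> unit_disk"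
  shows "hyperbolic_disk z r = {w \<in> unit_disk. cmod ((w - z) / (1 - cnj z * w)) < tanh r}"
proof -
  have "hyperbolic_dist z w < r \<longleftrightarrow> cmod ((w - z) / (1 - cnj z * w)) < tanh r" if w: "w \<in> unit_disk" for w
  proof -
    define \<rho> where "\<rho> = cmod ((w - z) / (1 - cnj z * w))"
    have \<rho>: "pseudo_hyperbolic_dist z w = \<rho>"
      by (simp add: pseudo_hyperbolic_dist_def \<rho>_def norm_divide norm_minus_commute)
    have "cmod (w * cnj z) < 1" by (rule norm_mult_cnj_less_1[OF w z])
    then have nz: "1 - cnj z * w \<noteq> 0" by (auto simp: mult.commute)
    have "0 < (1 - (cmod z)\<^sup>2) * (1 - (cmod w)\<^sup>2) / (cmod (1 - cnj z * w))\<^sup>2"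
      using one_minus_norm_square_pos[OF z] one_minus_norm_square_pos[OF w] nz by simp
    then have "0 < 1 - \<rho>\<^sup>2"
      unfolding \<rho>_def using one_minus_moebius_square[of z w] z w by simp
    then have \<rho>1: "\<rho> < 1" by (simp add: \<rho>_def power_less_one_iff abs_square_less_1)
    have \<rho>0: "0 \<le> \<rho>" by (simp add: \<rho>_def)
    have t: "0 < tanh r" "tanh r < 1" using r tanh_real_lt_1 by simp_all
    have "hyperbolic_dist z w = artanh \<rho>" by (simp add: hyperbolic_dist_def \<rho> artanh_def)
    then have "hyperbolic_dist z w < r \<longleftrightarrow> artanh \<rho> < artanh (tanh r)" by (simp add: artanh_tanh_real)
    also have "\<dots> \<longleftrightarrow> (1 + \<rho>) / (1 - \<rho>) < (1 + tanh r) / (1 - tanh r)"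
    proof -
      have "0 < (1 + \<rho>) / (1 - \<rho>)" "0 < (1 + tanh r) / (1 - tanh r)"
        using \<rho>0 \<rho>1 t by (auto intro!: divide_pos_pos add_pos_pos)
      then show ?thesis unfolding artanh_def by simp
    qed
    also have "\<dots> \<longleftrightarrow> \<rho> < tanh r" using \<rho>1 t by (simp add: divide_simps algebra_simps)
    finally show ?thesis by (simp add: \<rho>_def)
  qed
  then show ?thesis unfolding hyperbolic_disk_def by auto
qed

text \<open>All bounds follow from \<open>1 - \<rho>\<^sup>2 = (1 - |z|\<^sup>2) (1 - |w|\<^sup>2) / |1 - cnj z w|\<^sup>2\<close> for the pseudohyperbolic
  distance \<open>\<rho>\<close>: on the disk the three factors on the right have the same order of magnitude.\<close>

lemma hyperbolic_disk_estimates: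
  assumes r: "0 < r" and z: "z \<in> unit_disk" and w: "w \<in> hyperbolic_disk z r"
  defines "Q \<equiv> 1 - (tanh r)\<^sup>2"
  shows "0 < Q" "cmod (1 - cnj z * w) \<le> 2 * (1 - (cmod z)\<^sup>2) / Q"
    "1 - (cmod w)\<^sup>2 \<le> 4 * (1 - (cmod z)\<^sup>2) / Q" "Q * (1 - (cmod z)\<^sup>2) / 4 \<le> 1 - (cmod w)\<^sup>2"
    "cmod (w - z) \<le> 2 * (1 - (cmod z)\<^sup>2) / Q"
proof -
  define X where "X = cmod (1 - cnj z * w)"
  define p where "p = 1 - (cmod z)\<^sup>2"
  define q where "q = 1 - (cmod w)\<^sup>2"
  have wD: "w \<in> unit_disk" and \<rho>: "cmod ((w - z) / (1 - cnj z * w)) < tanh r"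
    using w unfolding hyperbolic_disk_eq[OF r z] by auto
  have t: "0 < tanh r" "tanh r < 1" using r tanh_real_lt_1 by simp_all
  then show Q: "0 < Q" by (simp add: Q_def power_less_one_iff)
  have p: "0 < p" and q: "0 < q" using one_minus_norm_square_pos z wD by (simp_all add: p_def q_def)
  have X1: "1 - cmod z \<le> X" "1 - cmod w \<le> X"
  proof -
    show "1 - cmod z \<le> X" using norm_one_minus_mult_ge[OF wD, of z] by (simp add: X_def mult.commute)
    have "1 - cmod w \<le> cmod (1 - z * cnj w)" by (rule norm_one_minus_mult_ge[OF z])
    also have "\<dots> = X" unfolding X_def by (subst complex_mod_cnj[symmetric]) simp
    finally show "1 - cmod w \<le> X" .
  qed
  have X0: "0 < X" using X1(1) z by auto
  have half: "1 - (cmod v)\<^sup>2 \<le> 2 * (1 - cmod v)" for v :: complex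
    by (rule one_minus_norm_square_le)
  have qX: "q \<le> 2 * X" using half[of w] X1(2) by (simp add: q_def)
  have pX: "p \<le> 2 * X" using half[of z] X1(1) by (simp add: p_def)
  have "(cmod ((w - z) / (1 - cnj z * w)))\<^sup>2 < (tanh r)\<^sup>2"
    using \<rho> by (intro power_strict_mono) auto
  then have "Q < p * q / X\<^sup>2"
    unfolding Q_def using one_minus_moebius_square[of z w] z wD by (simp add: p_def q_def X_def)
  then have main: "Q * X\<^sup>2 < p * q" using X0 by (simp add: less_divide_eq)
  have "p * q \<le> p * (2 * X)" using p qX by simp
  then have "(Q * X) * X \<le> (2 * p) * X" using main by (simp add: power2_eq_square mult_ac)
  then have QX: "Q * X \<le> 2 * p" using X0 by (simp only: mult_le_cancel_right_pos)
  then have XQ: "X \<le> 2 * p / Q" using Q by (simp add: le_divide_eq mult.commute)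
  then show "cmod (1 - cnj z * w) \<le> 2 * (1 - (cmod z)\<^sup>2) / Q" by (simp add: X_def p_def)
  have "q \<le> 2 * (2 * p / Q)" using qX XQ by linarith
  then show "1 - (cmod w)\<^sup>2 \<le> 4 * (1 - (cmod z)\<^sup>2) / Q" by (simp add: p_def q_def)
  have "(p / 2)\<^sup>2 \<le> X\<^sup>2" using pX p by (intro power_mono) auto
  then have "Q * (p / 2)\<^sup>2 \<le> p * q" using main Q mult_left_mono[of "(p/2)\<^sup>2" "X\<^sup>2" Q] by linarith
  then have "p * (Q * p / 4) \<le> p * q" by (simp add: power2_eq_square mult_ac)
  then have "Q * p / 4 \<le> q" using p by (simp only: mult_le_cancel_left_pos)
  then show "Q * (1 - (cmod z)\<^sup>2) / 4 \<le> 1 - (cmod w)\<^sup>2" by (simp add: p_def q_def)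
  have "cmod (w - z) / X < 1" using \<rho> t by (simp add: norm_divide X_def)
  then have "cmod (w - z) \<le> X" using X0 by simp
  then show "cmod (w - z) \<le> 2 * (1 - (cmod z)\<^sup>2) / Q" using XQ by (simp add: p_def)
qed

lemma ball_subset_hyperbolic_disk:
  assumes r: "0 < r" and z: "z \<in> unit_disk"
  shows "ball z (tanh r / (2 + tanh r) * (1 - (cmod z)\<^sup>2)) \<subseteq> hyperbolic_disk z r"
proof
  fix w assume "w \<in> ball z (tanh r / (2 + tanh r) * (1 - (cmod z)\<^sup>2))"
  define s where "s = tanh r"
  define \<delta> where "\<delta> = s / (2 + s)"
  define p where "p = 1 - (cmod z)\<^sup>2"
  have s: "0 < s" "s < 1" using r tanh_real_lt_1 by (simp_all add: s_def)
  have p: "0 < p" using one_minus_norm_square_pos[OF z] by (simp add: p_def)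
  have d: "cmod (w - z) < \<delta> * p"
    using \<open>w \<in> ball z _\<close> by (simp add: \<delta>_def s_def p_def dist_norm norm_minus_commute)
  have \<delta>: "0 < \<delta>" "\<delta> \<le> 1 / 2" using s by (auto simp: \<delta>_def field_simps)
  have "cmod w < 1"
  proof -
    have "cmod w \<le> cmod z + cmod (w - z)" using norm_triangle_sub[of w z] by simp
    also have "\<dots> < cmod z + \<delta> * p" using d by simp
    also have "\<dots> \<le> cmod z + 1 / 2 * p" using \<delta> p by (intro add_left_mono mult_right_mono) auto
    also have "\<dots> \<le> 1" using zero_le_power2[of "1 - cmod z"] by (simp add: p_def power2_eq_square algebra_simps)
    finally show ?thesis .
  qed
  then have wD: "w \<in> unit_disk" by simp
  have X: "(1 - \<delta>) * p \<le> cmod (1 - cnj z * w)"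
  proof -
    have "1 - cnj z * w = complex_of_real p - cnj z * (w - z)"
      by (simp add: p_def complex_norm_square[symmetric] algebra_simps mult.commute[of "cnj z" z])
    then have "cmod (complex_of_real p) - cmod (cnj z * (w - z)) \<le> cmod (1 - cnj z * w)"
      by (simp only: norm_triangle_ineq2)
    moreover have "cmod (cnj z * (w - z)) \<le> cmod (w - z)"
      using z by (auto simp: norm_mult intro: mult_left_le_one_le)
    ultimately show ?thesis using d p by (simp add: algebra_simps)
  qed
  \<comment> \<open>The radius is chosen so that the pseudohyperbolic distance is at most \<open>\<delta> / (1 - \<delta>) = s / 2\<close>.\<close>
  have "\<delta> = (1 - \<delta>) * (s / 2)" using s by (simp add: \<delta>_def field_simps)
  then have "\<delta> * p = ((1 - \<delta>) * p) * (s / 2)" by (metis mult.assoc mult.commute)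
  also have "\<dots> \<le> cmod (1 - cnj z * w) * (s / 2)" using X s by (intro mult_right_mono) auto
  finally have "cmod (w - z) < cmod (1 - cnj z * w) * (s / 2)" using d by linarith
  moreover have X0: "0 < cmod (1 - cnj z * w)" using X \<delta> p by (intro less_le_trans[OF _ X] mult_pos_pos) auto
  ultimately have "cmod ((w - z) / (1 - cnj z * w)) < s / 2"
    by (simp add: norm_divide divide_less_eq mult.commute)
  also have "\<dots> < tanh r" using s by (simp add: s_def)
  finally show "w \<in> hyperbolic_disk z r" unfolding hyperbolic_disk_eq[OF r z] using wD by simp
qed

lemma open_hyperbolic_disk:
  assumes r: "0 < r" and z: "z \<in> unit_disk"
  shows "open (hyperbolic_disk z r)"
proof -
  have "1 - cnj z * w \<noteq> 0" if "w \<in> unit_disk" for w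
    using norm_mult_cnj_less_1[OF that z] by (auto simp: mult.commute)
  then have "continuous_on unit_disk (\<lambda>w. cmod ((w - z) / (1 - cnj z * w)))"
    by (intro continuous_intros) auto
  then have "open (unit_disk \<inter> (\<lambda>w. cmod ((w - z) / (1 - cnj z * w))) -` {..<tanh r})"
    by (rule continuous_open_preimage) auto
  moreover have "unit_disk \<inter> (\<lambda>w. cmod ((w - z) / (1 - cnj z * w))) -` {..<tanh r} = hyperbolic_disk z r"
    unfolding hyperbolic_disk_eq[OF r z] by auto
  ultimately show ?thesis by simp
qed

lemma emeasure_weighted_area_lborel:
  assumes "-1 < \<alpha>" "A \<in> sets borel"
  shows "emeasure (weighted_area \<alpha>) A = ennreal ((1 + \<alpha>) / pi) *
    (\<integral>\<^sup>+w. ennreal (indicator unit_disk w * (1 - (cmod w)\<^sup>2) powr \<alpha>) * indicator A w \<partial>lborel)"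
proof -
  have "A \<in> sets (weighted_area \<alpha>)" using assms by simp
  then have "emeasure (weighted_area \<alpha>) A = (\<integral>\<^sup>+w. indicator A w \<partial>weighted_area \<alpha>)" by simp
  also have "\<dots> = ennreal ((1 + \<alpha>) / pi) *
    (\<integral>\<^sup>+w. ennreal (indicator unit_disk w * (1 - (cmod w)\<^sup>2) powr \<alpha>) * indicator A w \<partial>lborel)"
    by (rule nn_integral_weighted_area) (use assms in auto)
  finally show ?thesis .
qed

text \<open>The disk lies between two Euclidean disks with center \<open>z\<close> and radii of order \<open>1 - |z|\<^sup>2\<close>, and the
  weight on it is of the order of its value at \<open>z\<close>.\<close>

lemma weighted_area_hyperbolic_disk:
  assumes r: "0 < r" and \<alpha>: "-1 < \<alpha>" "\<alpha> < 0"
  shows "\<exists>l u. 0 < l \<and> 0 < u \<and> (\<forall>z\<in>unit_disk.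
     ennreal (l * (1 - (cmod z)\<^sup>2) powr (\<alpha> + 2)) \<le> emeasure (weighted_area \<alpha>) (hyperbolic_disk z r) \<and>
     emeasure (weighted_area \<alpha>) (hyperbolic_disk z r) \<le> ennreal (u * (1 - (cmod z)\<^sup>2) powr (\<alpha> + 2)))"
proof -
  define s Q \<delta> where "s = tanh r" and "Q = 1 - s\<^sup>2" and "\<delta> = s / (2 + s)"
  have s: "0 < s" "s < 1" using r tanh_real_lt_1 by (simp_all add: s_def)
  have Q: "0 < Q" using s by (simp add: Q_def power_less_one_iff)
  have \<delta>: "0 < \<delta>" using s by (simp add: \<delta>_def)
  define l u where "l = (1 + \<alpha>) * (4 / Q) powr \<alpha> * \<delta>\<^sup>2" and "u = (1 + \<alpha>) * (Q / 4) powr \<alpha> * (3 / Q)\<^sup>2"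
  have lu: "0 < l" "0 < u" using \<alpha> Q \<delta> by (simp_all add: l_def u_def)
  have "ennreal (l * (1 - (cmod z)\<^sup>2) powr (\<alpha> + 2)) \<le> emeasure (weighted_area \<alpha>) (hyperbolic_disk z r) \<and>
     emeasure (weighted_area \<alpha>) (hyperbolic_disk z r) \<le> ennreal (u * (1 - (cmod z)\<^sup>2) powr (\<alpha> + 2))"
    if z: "z \<in> unit_disk" for z
  proof -
    define p where "p = 1 - (cmod z)\<^sup>2"
    have p: "0 < p" using one_minus_norm_square_pos[OF z] by (simp add: p_def)
    let ?H = "hyperbolic_disk z r"
    have HD: "?H \<subseteq> unit_disk" by (auto simp: hyperbolic_disk_def)
    note est = hyperbolic_disk_estimates[OF r z, folded s_def, folded Q_def p_def]
    have pw: "p powr \<alpha> * p\<^sup>2 = p powr (\<alpha> + 2)" using p by (simp add: powr_add powr_numeral)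
    have em: "emeasure (weighted_area \<alpha>) ?H = ennreal ((1 + \<alpha>) / pi) *
        (\<integral>\<^sup>+w. ennreal (indicator unit_disk w * (1 - (cmod w)\<^sup>2) powr \<alpha>) * indicator ?H w \<partial>lborel)"
      by (rule emeasure_weighted_area_lborel[OF \<alpha>(1)]) (use open_hyperbolic_disk[OF r z] in auto)
    have lowI: "ennreal ((4 * p / Q) powr \<alpha> * (pi * (\<delta> * p)\<^sup>2)) \<le>
      (\<integral>\<^sup>+w. ennreal (indicator unit_disk w * (1 - (cmod w)\<^sup>2) powr \<alpha>) * indicator ?H w \<partial>lborel)"
    proof -
      have "ennreal ((4 * p / Q) powr \<alpha> * (pi * (\<delta> * p)\<^sup>2)) = ennreal ((4 * p / Q) powr \<alpha>) * emeasure lborel (ball z (\<delta> * p))"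
        using \<delta> p by (simp add: emeasure_complex_ball ennreal_mult)
      also have "\<dots> = (\<integral>\<^sup>+w. ennreal ((4 * p / Q) powr \<alpha>) * indicator (ball z (\<delta> * p)) w \<partial>lborel)"
        by (simp add: nn_integral_cmult)
      also have "\<dots> \<le> (\<integral>\<^sup>+w. ennreal (indicator unit_disk w * (1 - (cmod w)\<^sup>2) powr \<alpha>) * indicator ?H w \<partial>lborel)"
      proof (intro nn_integral_mono)
        fix w
        show "ennreal ((4 * p / Q) powr \<alpha>) * indicator (ball z (\<delta> * p)) w \<le>
          ennreal (indicator unit_disk w * (1 - (cmod w)\<^sup>2) powr \<alpha>) * indicator ?H w"
        proof (cases "w \<in> ball z (\<delta> * p)")
          case True
          then have w: "w \<in> ?H" using ball_subset_hyperbolic_disk[OF r z] by (auto simp: \<delta>_def s_def p_def)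
          then have "(4 * p / Q) powr \<alpha> \<le> (1 - (cmod w)\<^sup>2) powr \<alpha>"
            using \<alpha> est(3)[OF w] one_minus_norm_square_pos[of w] HD by (intro powr_mono2') auto
          then show ?thesis using True w HD by (auto simp: indicator_def intro!: ennreal_leI)
        qed simp
      qed
      finally show ?thesis .
    qed
    have "l * p powr (\<alpha> + 2) = (1 + \<alpha>) / pi * ((4 * p / Q) powr \<alpha> * (pi * (\<delta> * p)\<^sup>2))"
    proof -
      have "(4 * p / Q) powr \<alpha> = (4 / Q) powr \<alpha> * p powr \<alpha>"
        using powr_mult[of "4 / Q" p \<alpha>] by simp
      then show ?thesis unfolding l_def pw[symmetric] by (simp add: power_mult_distrib)
    qed
    then have "ennreal (l * p powr (\<alpha> + 2)) = ennreal ((1 + \<alpha>) / pi) * ennreal ((4 * p / Q) powr \<alpha> * (pi * (\<delta> * p)\<^sup>2))"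
      using \<alpha> by (subst ennreal_mult[symmetric]) auto
    also have "\<dots> \<le> emeasure (weighted_area \<alpha>) ?H" unfolding em by (intro mult_left_mono lowI) simp
    finally have 1: "ennreal (l * p powr (\<alpha> + 2)) \<le> emeasure (weighted_area \<alpha>) ?H" .
    \<comment> \<open>The factor 3 replaces the 2 of the estimate to obtain an open disk.\<close>
    have upI: "(\<integral>\<^sup>+w. ennreal (indicator unit_disk w * (1 - (cmod w)\<^sup>2) powr \<alpha>) * indicator ?H w \<partial>lborel) \<le>
      ennreal ((Q * p / 4) powr \<alpha> * (pi * (3 * p / Q)\<^sup>2))"
    proof -
      have "(\<integral>\<^sup>+w. ennreal (indicator unit_disk w * (1 - (cmod w)\<^sup>2) powr \<alpha>) * indicator ?H w \<partial>lborel) \<le>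
        (\<integral>\<^sup>+w. ennreal ((Q * p / 4) powr \<alpha>) * indicator (ball z (3 * p / Q)) w \<partial>lborel)"
      proof (intro nn_integral_mono)
        fix w
        show "ennreal (indicator unit_disk w * (1 - (cmod w)\<^sup>2) powr \<alpha>) * indicator ?H w \<le>
            ennreal ((Q * p / 4) powr \<alpha>) * indicator (ball z (3 * p / Q)) w"
        proof (cases "w \<in> ?H")
          case True
          have "(1 - (cmod w)\<^sup>2) powr \<alpha> \<le> (Q * p / 4) powr \<alpha>"
            using \<alpha> est(4)[OF True] Q p by (intro powr_mono2') auto
          moreover have "2 * p / Q < 3 * p / Q" using Q p by (simp add: divide_strict_right_mono)
          then have "w \<in> ball z (3 * p / Q)" using est(5)[OF True] by (simp add: dist_norm norm_minus_commute)
          ultimately show ?thesis using True HD by (auto simp: indicator_def intro!: ennreal_leI)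
        qed simp
      qed
      also have "\<dots> = ennreal ((Q * p / 4) powr \<alpha>) * emeasure lborel (ball z (3 * p / Q))"
        by (simp add: nn_integral_cmult)
      also have "\<dots> = ennreal ((Q * p / 4) powr \<alpha> * (pi * (3 * p / Q)\<^sup>2))"
        using Q p by (simp add: emeasure_complex_ball ennreal_mult)
      finally show ?thesis .
    qed
    have "emeasure (weighted_area \<alpha>) ?H \<le> ennreal ((1 + \<alpha>) / pi) * ennreal ((Q * p / 4) powr \<alpha> * (pi * (3 * p / Q)\<^sup>2))"
      unfolding em by (intro mult_left_mono upI) simp
    also have "\<dots> = ennreal ((1 + \<alpha>) / pi * ((Q * p / 4) powr \<alpha> * (pi * (3 * p / Q)\<^sup>2)))"
      using \<alpha> by (subst ennreal_mult[symmetric]) auto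
    also have "(1 + \<alpha>) / pi * ((Q * p / 4) powr \<alpha> * (pi * (3 * p / Q)\<^sup>2)) = u * p powr (\<alpha> + 2)"
    proof -
      have "(Q * p / 4) powr \<alpha> = (Q / 4) powr \<alpha> * p powr \<alpha>"
        using powr_mult[of "Q / 4" p \<alpha>] by simp
      then show ?thesis unfolding u_def pw[symmetric] by (simp add: power_mult_distrib power_divide)
    qed
    finally show ?thesis using 1 by (simp add: p_def)
  qed
  then show ?thesis using lu by blast
qed

section \<open>The averaged counting function of a univalent map\<close>

lemma nevanlinna_counting_univalent:
  assumes h: "\<eta> holomorphic_on unit_disk" and inj: "inj_on \<eta> unit_disk" and u: "u \<in> unit_disk"
    and d: "deriv \<eta> u \<noteq> 0"
  shows "nevanlinna_counting \<eta> \<alpha> (\<eta> u) = ennreal ((1 - (cmod u)\<^sup>2) powr \<alpha>)"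
proof -
  have s: "{z \<in> unit_disk. \<eta> z = \<eta> u} = {u}" using inj u by (auto simp: inj_on_def)
  have "deriv (\<lambda>z. \<eta> z - \<eta> u) u = deriv \<eta> u"
    using holomorphic_disk_has_deriv[OF h u] by (intro DERIV_imp_deriv) (auto intro!: derivative_eq_intros)
  then have "zorder (\<lambda>z. \<eta> z - \<eta> u) u = 1"
    using d u by (intro zorder_zero_eqI[of _ unit_disk]) (auto intro!: holomorphic_intros h)
  then show ?thesis unfolding nevanlinna_counting_def s by simp
qed

text \<open>The substitution \<open>w = \<eta> u\<close> removes the inverse of \<open>\<eta>\<close> from the counting function.\<close>

lemma averaged_counting_integral:
  assumes h: "\<eta> holomorphic_on unit_disk" and inj: "inj_on \<eta> unit_disk"
    and d: "\<And>u. u \<in> unit_disk \<Longrightarrow> deriv \<eta> u \<noteq> 0" and sub: "\<eta> ` unit_disk \<subseteq> unit_disk" and H: "open H"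
  shows "(\<integral>\<^sup>+w\<in>H \<inter> \<eta> ` unit_disk. nevanlinna_counting \<eta> \<alpha> w \<partial>disk_area) =
    ennreal (1 / pi) * (\<integral>\<^sup>+u. ennreal (indicator {u \<in> unit_disk. \<eta> u \<in> H} u *
       ((cmod (deriv \<eta> u))\<^sup>2 * (1 - (cmod u)\<^sup>2) powr \<alpha>)) \<partial>lborel)"
proof -
  obtain g where g: "g holomorphic_on (\<eta> ` unit_disk)" "\<And>z. z \<in> unit_disk \<Longrightarrow> g (\<eta> z) = z"
    using holomorphic_has_inverse[OF h open_ball inj] by metis
  let ?S = "{u \<in> unit_disk. \<eta> u \<in> H}"
  define f where "f w = (1 - (cmod (g w))\<^sup>2) powr \<alpha>" for w
  have img: "\<eta> ` ?S = H \<inter> \<eta> ` unit_disk" by auto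
  have ceta: "continuous_on unit_disk \<eta>" "continuous_on unit_disk (deriv \<eta>)"
    using holomorphic_on_imp_continuous_on[OF h] continuous_on_deriv_disk[OF h] by auto
  have oS: "open ?S"
    using continuous_open_preimage[OF ceta(1) open_ball H] by (simp add: vimage_def Int_def conj_commute)
  have oI: "open (H \<inter> \<eta> ` unit_disk)"
    by (intro open_Int H open_mapping_thm3[OF h open_ball inj])
  have cf: "continuous_on (H \<inter> \<eta> ` unit_disk) f"
    unfolding f_def
  proof (intro continuous_intros ballI)
    show "continuous_on (H \<inter> \<eta> ` unit_disk) g"
      by (rule continuous_on_subset[OF holomorphic_on_imp_continuous_on[OF g(1)]]) auto
    show "1 - (cmod (g w))\<^sup>2 \<noteq> 0" if "w \<in> H \<inter> \<eta> ` unit_disk" for w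
      using that g(2) one_minus_norm_square_pos by fastforce
  qed
  have mf: "(\<lambda>w. indicator (H \<inter> \<eta> ` unit_disk) w * f w) \<in> borel_measurable borel"
    using borel_measurable_continuous_on_indicator[OF _ cf] oI by simp
  have "(\<integral>\<^sup>+w\<in>H \<inter> \<eta> ` unit_disk. nevanlinna_counting \<eta> \<alpha> w \<partial>disk_area) =
      (\<integral>\<^sup>+w. ennreal (indicator (H \<inter> \<eta> ` unit_disk) w * f w) \<partial>disk_area)"
    by (intro nn_integral_cong)
      (auto simp: indicator_def f_def g(2) nevanlinna_counting_univalent[OF h inj _ d])
  also have "\<dots> = ennreal (1 / pi) * (\<integral>\<^sup>+w. ennreal (indicator (H \<inter> \<eta> ` unit_disk) w * f w) * indicator unit_disk w \<partial>lborel)"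
    by (rule nn_integral_disk_area) (use mf in measurable)
  also have "(\<integral>\<^sup>+w. ennreal (indicator (H \<inter> \<eta> ` unit_disk) w * f w) * indicator unit_disk w \<partial>lborel) =
      (\<integral>\<^sup>+w. ennreal (indicator (\<eta> ` ?S) w * f w) \<partial>lborel)"
    unfolding img by (intro nn_integral_cong) (use sub in \<open>auto simp: indicator_def\<close>)
  also have "\<dots> = (\<integral>\<^sup>+u. ennreal (indicator ?S u * ((cmod (deriv \<eta> u))\<^sup>2 * f (\<eta> u))) \<partial>lborel)"
  proof (rule nn_integral_change_of_variables_complex)
    show "?S \<in> sets borel" using oS by simp
    show "(\<eta> has_field_derivative deriv \<eta> z) (at z)" if "z \<in> ?S" for z
      by (rule holomorphic_disk_has_deriv[OF h]) (use that in simp)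
    show "inj_on \<eta> ?S" using inj by (rule inj_on_subset) auto
    show "0 \<le> f z" for z by (simp add: f_def)
    show "(\<lambda>z. indicator (\<eta> ` ?S) z * f z) \<in> borel_measurable borel" unfolding img by (rule mf)
    have "continuous_on ?S (\<lambda>u. (cmod (deriv \<eta> u))\<^sup>2 * f (\<eta> u))"
      by (intro continuous_intros continuous_on_compose2[OF cf]
          continuous_on_subset[OF ceta(1)] continuous_on_subset[OF ceta(2)]) auto
    then have "(\<lambda>u. indicator ?S u *\<^sub>R ((cmod (deriv \<eta> u))\<^sup>2 * f (\<eta> u))) \<in> borel_measurable borel"
      by (intro borel_measurable_continuous_on_indicator) (use oS in auto)
    then show "(\<lambda>u. indicator ?S u * ((cmod (deriv \<eta> u))\<^sup>2 * f (\<eta> u))) \<in> borel_measurable borel" by simp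
  qed
  also have "\<dots> = (\<integral>\<^sup>+u. ennreal (indicator ?S u * ((cmod (deriv \<eta> u))\<^sup>2 * (1 - (cmod u)\<^sup>2) powr \<alpha>)) \<partial>lborel)"
    by (intro nn_integral_cong) (auto simp: indicator_def f_def g(2))
  finally show ?thesis .
qed

lemma eventually_near_circle: "\<forall>\<^sub>F z in filtercomap cmod (at_left 1). cmod z < 1 \<and> b < cmod z" if "b < 1" for b
proof -
  have "\<forall>\<^sub>F t in at_left 1. t < 1 \<and> b < (t::real)"
    using eventually_at_left_field[of "\<lambda>t. t < 1 \<and> b < t" 1] that by auto
  then show ?thesis unfolding eventually_filtercomap by blast
qed

abbreviation counting_integral :: "(complex \<Rightarrow> complex) \<Rightarrow> real \<Rightarrow> real \<Rightarrow> complex \<Rightarrow> ennreal" where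
  "counting_integral \<eta> \<alpha> r z \<equiv>
     (\<integral>\<^sup>+w\<in>hyperbolic_disk z r \<inter> \<eta> ` unit_disk. nevanlinna_counting \<eta> \<alpha> w \<partial>disk_area)"

lemma averaged_counting_limsup_cong:
  assumes eq: "\<And>z. z \<in> unit_disk \<Longrightarrow> f z = g z"
  shows "averaged_counting_limsup f \<alpha> r = averaged_counting_limsup g \<alpha> r"
proof -
  have img: "f ` unit_disk = g ` unit_disk" using eq by (intro image_cong) auto
  have "nevanlinna_counting f \<alpha> w = nevanlinna_counting g \<alpha> w" for w
  proof -
    have "{z \<in> unit_disk. f z = w} = {z \<in> unit_disk. g z = w}" using eq by auto
    moreover have "zorder (\<lambda>u. f u - w) z = zorder (\<lambda>u. g u - w) z" if z: "z \<in> unit_disk" for z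
    proof (rule zorder_cong)
      have "\<forall>\<^sub>F u in at z. u \<in> unit_disk" by (rule eventually_at_in_open'[OF open_ball z])
      then show "\<forall>\<^sub>F u in at z. f u - w = g u - w" by (rule eventually_mono) (simp only: eq)
    qed simp
    ultimately show ?thesis unfolding nevanlinna_counting_def by (auto intro!: infsum_cong)
  qed
  then have "nevanlinna_counting f \<alpha> = nevanlinna_counting g \<alpha>" by (rule ext)
  then show ?thesis unfolding averaged_counting_limsup_def img by simp
qed

lemma ennreal_inverse_antimono: "x \<le> y \<Longrightarrow> inverse y \<le> inverse (x :: ennreal)"
proof (cases "x = 0 \<or> y = top")
  case False
  assume "x \<le> y"
  with False obtain a b where "x = ennreal a" "y = ennreal b" "0 < a" "a \<le> b"
    by (cases x; cases y) (auto simp: top_unique ennreal_eq_0_iff)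
  then show ?thesis by (simp add: inverse_ennreal)
qed auto

lemma ennreal_le_divide:
  assumes "ennreal x \<le> X" "Y \<le> ennreal y" "0 \<le> x" "0 < y"
  shows "ennreal (x / y) \<le> X / Y"
proof -
  have "ennreal (x / y) = ennreal x / ennreal y" using assms by (simp add: divide_ennreal)
  also have "\<dots> \<le> X / Y"
    unfolding divide_ennreal_def using assms by (intro mult_mono ennreal_inverse_antimono) auto
  finally show ?thesis .
qed

lemma ennreal_divide_le:
  assumes "X \<le> ennreal x" "ennreal y \<le> Y" "0 \<le> x" "0 < y"
  shows "X / Y \<le> ennreal (x / y)"
proof -
  have "X / Y \<le> ennreal x / ennreal y"
    unfolding divide_ennreal_def using assms by (intro mult_mono ennreal_inverse_antimono) auto
  also have "\<dots> = ennreal (x / y)" using assms by (simp add: divide_ennreal)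
  finally show ?thesis .
qed

context
  fixes \<alpha> r :: real and \<eta> :: "complex \<Rightarrow> complex" and a b c d :: complex
  assumes \<alpha>: "-1 < \<alpha>" and \<alpha>0: "\<alpha> < 0" and r: "0 < r"
    and lf: "nonconst_lf_self_map a b c d" and \<eta>: "\<eta> = linear_fractional a b c d"
begin

lemma lf_map_univalent:
  shows "\<eta> holomorphic_on unit_disk" "inj_on \<eta> unit_disk" "\<eta> ` unit_disk \<subseteq> unit_disk"
    "\<And>u. u \<in> unit_disk \<Longrightarrow> deriv \<eta> u \<noteq> 0"
proof -
  show "\<eta> holomorphic_on unit_disk" using lf_holomorphic[OF lf] \<eta> by simp
  show "inj_on \<eta> unit_disk" using lf_inj[OF lf] \<eta> by (auto intro: inj_on_subset)
  show "\<eta> ` unit_disk \<subseteq> unit_disk" using lf_maps_disk[OF lf] \<eta> by blast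
  obtain l u where "0 < l" "\<And>z. cmod z \<le> 1 \<Longrightarrow> l \<le> cmod (deriv \<eta> z)" using lf_deriv_bounds[OF lf] \<eta> by blast
  then show "\<And>u. u \<in> unit_disk \<Longrightarrow> deriv \<eta> u \<noteq> 0"
    by (metis less_imp_le mem_ball_0 norm_zero not_le)
qed

lemma averaged_counting_eq:
  assumes "z \<in> unit_disk"
  shows "counting_integral \<eta> \<alpha> r z =
    ennreal (1 / pi) * (\<integral>\<^sup>+u. ennreal (indicator {u \<in> unit_disk. \<eta> u \<in> hyperbolic_disk z r} u *
       ((cmod (deriv \<eta> u))\<^sup>2 * (1 - (cmod u)\<^sup>2) powr \<alpha>)) \<partial>lborel)"
  by (rule averaged_counting_integral[OF lf_map_univalent(1,2,4,3) open_hyperbolic_disk[OF r assms]])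

text \<open>Boundedness of the composition operator, tested on the reproducing kernel at \<open>z\<close>: on the hyperbolic
  disk the kernel is of the order of its largest value.\<close>

lemma averaged_counting_le:
  "\<exists>C>0. \<forall>z\<in>unit_disk. counting_integral \<eta> \<alpha> r z \<le>
     ennreal (C * (1 - (cmod z)\<^sup>2) powr (\<alpha> + 2))"
proof -
  let ?s = "\<alpha> + 2"
  define Q where "Q = 1 - (tanh r)\<^sup>2"
  have Q: "0 < Q" using r tanh_real_lt_1[of r] by (simp add: Q_def power_less_one_iff)
  obtain C where C: "0 < C" "\<And>g. g holomorphic_on unit_disk \<Longrightarrow>
      bergman_energy \<alpha> (\<lambda>z. g (\<eta> z) * deriv \<eta> z) \<le> ennreal C * bergman_energy \<alpha> g"
    using lf_bergman_energy_compose_le[OF \<alpha> lf \<eta>] by blast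
  define C' where "C' = 1 / (1 + \<alpha>) * ((2 / Q) powr ?s)\<^sup>2 * C"
  have C'0: "0 < C'" using \<alpha> Q C by (simp add: C'_def)
  have "counting_integral \<eta> \<alpha> r z \<le> ennreal (C' * (1 - (cmod z)\<^sup>2) powr ?s)"
    if z: "z \<in> unit_disk" for z
  proof -
    define p where "p = 1 - (cmod z)\<^sup>2"
    have p: "0 < p" using one_minus_norm_square_pos[OF z] by (simp add: p_def)
    let ?k = "bergman_kernel \<alpha> z"
    let ?S = "{u \<in> unit_disk. \<eta> u \<in> hyperbolic_disk z r}"
    define B where "B = (2 * p / Q) powr ?s"
    have kh: "?k holomorphic_on unit_disk" by (rule bergman_kernel_holomorphic[OF z])
    let ?h = "\<lambda>u. ?k (\<eta> u) * deriv \<eta> u"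
    have ch: "continuous_on unit_disk ?h"
      by (intro continuous_intros continuous_on_compose2[OF holomorphic_on_imp_continuous_on[OF kh]]
          holomorphic_on_imp_continuous_on[OF lf_map_univalent(1)] continuous_on_deriv_disk[OF lf_map_univalent(1)] lf_map_univalent(3))
    have low: "1 \<le> B\<^sup>2 * (cmod (?k (\<eta> u)))\<^sup>2" if u: "u \<in> ?S" for u
    proof -
      have "cmod (1 - \<eta> u * cnj z) \<le> 2 * p / Q"
        using hyperbolic_disk_estimates(2)[OF r z, of "\<eta> u"] u by (simp add: Q_def p_def mult.commute)
      moreover have "\<eta> u \<in> unit_disk" using u lf_map_univalent(3) by blast
      then have "cmod (\<eta> u * cnj z) < 1" by (rule norm_mult_cnj_less_1[OF _ z])
      then have "0 < cmod (1 - \<eta> u * cnj z)" by auto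
      ultimately have "(2 * p / Q) powr (- ?s) \<le> cmod (?k (\<eta> u))"
        unfolding norm_bergman_kernel using \<alpha> by (intro powr_mono2') auto
      then have "B * (2 * p / Q) powr (- ?s) \<le> B * cmod (?k (\<eta> u))" by (intro mult_left_mono) (simp_all add: B_def)
      moreover have "B * (2 * p / Q) powr (- ?s) = 1" using p Q by (simp add: B_def powr_add[symmetric])
      ultimately have "1\<^sup>2 \<le> (B * cmod (?k (\<eta> u)))\<^sup>2" by (intro power_mono) auto
      then show ?thesis by (simp add: power_mult_distrib)
    qed
    have "(\<integral>\<^sup>+u. ennreal (indicator ?S u * ((cmod (deriv \<eta> u))\<^sup>2 * (1 - (cmod u)\<^sup>2) powr \<alpha>)) \<partial>lborel) \<le>
      (\<integral>\<^sup>+u. ennreal (B\<^sup>2) * ennreal (indicator unit_disk u * ((1 - (cmod u)\<^sup>2) powr \<alpha> * (cmod (?h u))\<^sup>2)) \<partial>lborel)"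
    proof (intro nn_integral_mono)
      fix u
      show "ennreal (indicator ?S u * ((cmod (deriv \<eta> u))\<^sup>2 * (1 - (cmod u)\<^sup>2) powr \<alpha>)) \<le>
        ennreal (B\<^sup>2) * ennreal (indicator unit_disk u * ((1 - (cmod u)\<^sup>2) powr \<alpha> * (cmod (?h u))\<^sup>2))"
      proof (cases "u \<in> ?S")
        case True
        let ?X = "(cmod (deriv \<eta> u))\<^sup>2 * (1 - (cmod u)\<^sup>2) powr \<alpha>"
        have "?X * 1 \<le> ?X * (B\<^sup>2 * (cmod (?k (\<eta> u)))\<^sup>2)" by (intro mult_left_mono low True) simp
        then have "?X \<le> B\<^sup>2 * ((1 - (cmod u)\<^sup>2) powr \<alpha> * (cmod (?h u))\<^sup>2)"
          by (simp add: norm_mult power_mult_distrib mult_ac)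
        then show ?thesis using True by (subst ennreal_mult'[symmetric]) (auto intro!: ennreal_leI)
      qed simp
    qed
    also have "\<dots> = ennreal (B\<^sup>2) * (\<integral>\<^sup>+u. ennreal (indicator unit_disk u * ((1 - (cmod u)\<^sup>2) powr \<alpha> * (cmod (?h u))\<^sup>2)) \<partial>lborel)"
    proof (rule nn_integral_cmult)
      have "(\<lambda>u. indicator unit_disk u *\<^sub>R ((1 - (cmod u)\<^sup>2) powr \<alpha> * (cmod (?h u))\<^sup>2)) \<in> borel_measurable borel"
      proof (rule borel_measurable_continuous_on_indicator)
        show "continuous_on unit_disk (\<lambda>u. (1 - (cmod u)\<^sup>2) powr \<alpha> * (cmod (?h u))\<^sup>2)"
          by (intro continuous_on_mult continuous_on_power continuous_on_norm ch continuous_on_powr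
              continuous_on_diff continuous_on_const continuous_on_id ballI)
            (metis one_minus_norm_square_pos less_irrefl)
      qed simp
      then show "(\<lambda>u. ennreal (indicator unit_disk u * ((1 - (cmod u)\<^sup>2) powr \<alpha> * (cmod (?h u))\<^sup>2))) \<in> borel_measurable lborel"
        by simp
    qed
    finally have I: "(\<integral>\<^sup>+u. ennreal (indicator ?S u * ((cmod (deriv \<eta> u))\<^sup>2 * (1 - (cmod u)\<^sup>2) powr \<alpha>)) \<partial>lborel) \<le>
       ennreal (B\<^sup>2) * (\<integral>\<^sup>+u. ennreal (indicator unit_disk u * ((1 - (cmod u)\<^sup>2) powr \<alpha> * (cmod (?h u))\<^sup>2)) \<partial>lborel)" .
    have "counting_integral \<eta> \<alpha> r z \<le>
       ennreal (1 / pi) * (ennreal (B\<^sup>2) * (\<integral>\<^sup>+u. ennreal (indicator unit_disk u * ((1 - (cmod u)\<^sup>2) powr \<alpha> * (cmod (?h u))\<^sup>2)) \<partial>lborel))"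
      unfolding averaged_counting_eq[OF z] by (intro mult_left_mono I) simp
    also have "\<dots> = ennreal (1 / (1 + \<alpha>) * B\<^sup>2) * bergman_energy \<alpha> ?h"
    proof -
      have e: "ennreal (1 / (1 + \<alpha>) * B\<^sup>2) * ennreal ((1 + \<alpha>) / pi) = ennreal (1 / pi) * ennreal (B\<^sup>2)"
        using \<alpha> by (simp add: ennreal_mult[symmetric])
      then show ?thesis unfolding bergman_energy_lborel[OF ch \<alpha>] by (simp only: mult.assoc[symmetric] e)
    qed
    also have "\<dots> \<le> ennreal (1 / (1 + \<alpha>) * B\<^sup>2) * (ennreal C * bergman_energy \<alpha> ?k)"
      by (intro mult_left_mono C(2) kh) simp
    also have "bergman_energy \<alpha> ?k = ennreal (p powr (- ?s))"
      using set_integrable_square_iff(2)[OF holomorphic_on_imp_continuous_on[OF kh] set_integrable_square_bergman_kernel[OF \<alpha> z]]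
        bergman_kernel_square_integral[OF \<alpha> z] by (simp add: p_def)
    also have "ennreal (1 / (1 + \<alpha>) * B\<^sup>2) * (ennreal C * ennreal (p powr (- ?s))) = ennreal (1 / (1 + \<alpha>) * B\<^sup>2 * (C * p powr (- ?s)))"
    proof -
      have 1: "ennreal C * ennreal (p powr (- ?s)) = ennreal (C * p powr (- ?s))"
        by (rule ennreal_mult[symmetric]) (use C(1) in auto)
      show ?thesis unfolding 1 by (rule ennreal_mult[symmetric]) (use \<alpha> C(1) in auto)
    qed
    also have "1 / (1 + \<alpha>) * B\<^sup>2 * (C * p powr (- ?s)) = C' * p powr ?s"
    proof -
      have "B = (2 / Q) powr ?s * p powr ?s" using powr_mult[of "2 / Q" p ?s] by (simp add: B_def)
      moreover have "p powr ?s * p powr (- ?s) = 1" using p by (simp add: powr_add[symmetric])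
      ultimately show ?thesis by (simp add: C'_def power_mult_distrib power2_eq_square mult_ac)
    qed
    finally show ?thesis by (simp add: p_def)
  qed
  with C'0 show ?thesis by blast
qed

lemma averaged_counting_limsup_finite: "averaged_counting_limsup \<eta> \<alpha> r < \<infinity>"
proof -
  obtain C where C: "0 < C" "\<And>z. z \<in> unit_disk \<Longrightarrow>
      counting_integral \<eta> \<alpha> r z \<le> ennreal (C * (1 - (cmod z)\<^sup>2) powr (\<alpha> + 2))"
    using averaged_counting_le by blast
  obtain l u where l: "0 < l" "\<And>z. z \<in> unit_disk \<Longrightarrow>
      ennreal (l * (1 - (cmod z)\<^sup>2) powr (\<alpha> + 2)) \<le> emeasure (weighted_area \<alpha>) (hyperbolic_disk z r)"
    using weighted_area_hyperbolic_disk[OF r \<alpha> \<alpha>0] by blast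
  have "averaged_counting_limsup \<eta> \<alpha> r \<le> ennreal (C / l)"
    unfolding averaged_counting_limsup_def
  proof (rule Limsup_bounded, rule eventually_mono[OF eventually_near_circle[of 0]])
    fix z :: complex assume "cmod z < 1 \<and> 0 < cmod z"
    then have z: "z \<in> unit_disk" by simp
    have p: "0 < (1 - (cmod z)\<^sup>2) powr (\<alpha> + 2)" using one_minus_norm_square_pos[OF z] by simp
    have "counting_integral \<eta> \<alpha> r z /
        emeasure (weighted_area \<alpha>) (hyperbolic_disk z r) \<le>
        ennreal ((C * (1 - (cmod z)\<^sup>2) powr (\<alpha> + 2)) / (l * (1 - (cmod z)\<^sup>2) powr (\<alpha> + 2)))"
      using C(1) l(1) p by (intro ennreal_divide_le C(2)[OF z] l(2)[OF z]) (auto intro!: mult_pos_pos)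
    then show "counting_integral \<eta> \<alpha> r z /
        emeasure (weighted_area \<alpha>) (hyperbolic_disk z r) \<le> ennreal (C / l)" using p by simp
  qed simp
  then show ?thesis by (auto intro: le_less_trans)
qed

text \<open>If the closure of the image is a compact subset of the disk, the hyperbolic disks near the circle do
  not meet it.\<close>

lemma averaged_counting_limsup_zero:
  assumes inside: "\<And>z. cmod z \<le> 1 \<Longrightarrow> cmod (\<eta> z) \<noteq> 1"
  shows "averaged_counting_limsup \<eta> \<alpha> r = 0"
proof -
  have "continuous_on (cball 0 1) (\<lambda>z. cmod (\<eta> z))" using lf_continuous[OF lf] \<eta> by (auto intro!: continuous_intros)
  then obtain z0 where z0: "z0 \<in> cball 0 1" "\<And>z. z \<in> cball 0 1 \<Longrightarrow> cmod (\<eta> z) \<le> cmod (\<eta> z0)"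
    using continuous_attains_sup[of "cball (0::complex) 1" "\<lambda>z. cmod (\<eta> z)"] by auto
  define s where "s = cmod (\<eta> z0)"
  have s: "s < 1" using lf_norm_le_1[OF lf, of z0] inside[of z0] z0(1) \<eta> by (simp add: s_def)
  define Q where "Q = 1 - (tanh r)\<^sup>2"
  have Q: "0 < Q" using r tanh_real_lt_1[of r] by (simp add: Q_def power_less_one_iff)
  \<comment> \<open>The hyperbolic disk at \<open>z\<close> can contain a point of modulus at most \<open>s\<close> only if
    \<open>(1 - s) Q \<le> 4 (1 - |z|)\<close>.\<close>
  define b where "b = max 0 (1 - (1 - s) * Q / 4)"
  have b: "b < 1" using s Q by (simp add: b_def)
  have "averaged_counting_limsup \<eta> \<alpha> r \<le> 0"
    unfolding averaged_counting_limsup_def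
  proof (rule Limsup_bounded, rule eventually_mono[OF eventually_near_circle[OF b]])
    fix z :: complex assume zb: "cmod z < 1 \<and> b < cmod z"
    then have z: "z \<in> unit_disk" by simp
    have "hyperbolic_disk z r \<inter> \<eta> ` unit_disk = {}"
    proof (rule ccontr)
      assume "hyperbolic_disk z r \<inter> \<eta> ` unit_disk \<noteq> {}"
      then obtain u where u: "u \<in> unit_disk" "\<eta> u \<in> hyperbolic_disk z r" by blast
      have "\<eta> u \<in> unit_disk" using u lf_map_univalent(3) by blast
      have "1 - s \<le> 1 - cmod (\<eta> u)" using z0(2)[of u] u by (simp add: s_def)
      also have "\<dots> \<le> cmod (1 - z * cnj (\<eta> u))" by (rule norm_one_minus_mult_ge[OF z])
      also have "\<dots> = cmod (1 - cnj z * \<eta> u)" by (subst complex_mod_cnj[symmetric]) simp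
      also have "\<dots> \<le> 2 * (1 - (cmod z)\<^sup>2) / Q" unfolding Q_def by (rule hyperbolic_disk_estimates(2)[OF r z u(2)])
      also have "\<dots> \<le> 2 * (2 * (1 - cmod z)) / Q"
        using Q zero_le_power2[of "1 - cmod z"] by (intro divide_right_mono mult_left_mono) (auto simp: power2_eq_square algebra_simps)
      finally have "(1 - s) * Q \<le> 4 * (1 - cmod z)" using Q by (simp add: le_divide_eq)
      then show False using zb by (simp add: b_def)
    qed
    then show "counting_integral \<eta> \<alpha> r z /
        emeasure (weighted_area \<alpha>) (hyperbolic_disk z r) \<le> 0" by simp
  qed
  then show ?thesis by simp
qed

text \<open>The points \<open>\<eta> (t \<zeta>)\<close> approach the circle, and by the Schwarz and Lipschitz estimates their distance
  to it is of the order of \<open>1 - t\<close>. So \<open>\<eta>\<close> maps a disk of radius comparable with \<open>1 - t\<close> around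
  \<open>t \<zeta>\<close> into the hyperbolic disk at \<open>\<eta> (t \<zeta>)\<close>, and both integrals have the order
  \<open>(1 - t) powr (\<alpha> + 2)\<close>.\<close>

lemma averaged_counting_limsup_pos:
  assumes \<zeta>: "cmod \<zeta> = 1" and touch: "cmod (\<eta> \<zeta>) = 1"
  shows "0 < averaged_counting_limsup \<eta> \<alpha> r"
proof -
  let ?s = "\<alpha> + 2"
  let ?q = "\<lambda>z. counting_integral \<eta> \<alpha> r z /
        emeasure (weighted_area \<alpha>) (hyperbolic_disk z r)"
  obtain l' uu where up: "0 < uu" "\<And>z. z \<in> unit_disk \<Longrightarrow>
      emeasure (weighted_area \<alpha>) (hyperbolic_disk z r) \<le> ennreal (uu * (1 - (cmod z)\<^sup>2) powr ?s)"
    using weighted_area_hyperbolic_disk[OF r \<alpha> \<alpha>0] by blast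
  obtain l u where l: "0 < l" "\<And>z. cmod z \<le> 1 \<Longrightarrow> l \<le> cmod (deriv \<eta> z)" using lf_deriv_bounds[OF lf] \<eta> by blast
  obtain L where L: "0 < L" "\<And>x y. cmod x \<le> 1 \<Longrightarrow> cmod y \<le> 1 \<Longrightarrow> cmod (\<eta> x - \<eta> y) \<le> L * cmod (x - y)"
    using lf_Lipschitz[OF lf] \<eta> by blast
  have etaD: "\<And>z. z \<in> unit_disk \<Longrightarrow> \<eta> z \<in> unit_disk" using lf_map_univalent(3) by blast
  obtain K where K: "0 < K" "\<And>z. z \<in> unit_disk \<Longrightarrow> 1 - (cmod z)\<^sup>2 \<le> K * (1 - (cmod (\<eta> z))\<^sup>2)"
    using one_minus_norm_square_le_compose[OF lf_map_univalent(1) etaD] by blast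
  define \<delta> where "\<delta> = tanh r / (2 + tanh r)"
  have \<delta>: "0 < \<delta>" using r by (simp add: \<delta>_def add_pos_pos)
  \<comment> \<open>The bound 1/2 keeps the disk around \<open>t \<zeta>\<close> inside the unit disk; the other one makes its image small
    enough for the inscribed Euclidean disk of the hyperbolic disk.\<close>
  define e where "e = min (1 / 2) (\<delta> / (L * K))"
  have e: "0 < e" "e \<le> 1 / 2" "L * e * K \<le> \<delta>"
  proof -
    show "0 < e" using \<delta> L(1) K(1) by (simp add: e_def)
    show "e \<le> 1 / 2" unfolding e_def by (rule min.cobounded1)
    have "e * (L * K) \<le> \<delta> / (L * K) * (L * K)" using L K by (intro mult_right_mono) (auto simp: e_def)
    then show "L * e * K \<le> \<delta>" using L K by (simp add: mult_ac)
  qed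
  define A where "A = l\<^sup>2 * 3 powr \<alpha> * e\<^sup>2"
  define B where "B = uu * (2 * L) powr ?s"
  have AB: "0 < A" "0 < B" using l e up L by (simp_all add: A_def B_def)
  have quot: "ennreal (A / B) \<le> ?q (\<eta> (complex_of_real t * \<zeta>))" if t: "0 < t" "t < 1" for t
  proof -
    define v where "v = complex_of_real t * \<zeta>"
    have nv: "cmod v = t" using t \<zeta> by (simp add: v_def norm_mult)
    have vD: "v \<in> unit_disk" using nv t by simp
    define z where "z = \<eta> v"
    have z: "z \<in> unit_disk" unfolding z_def by (rule etaD[OF vD])
    define p where "p = 1 - t"
    have p: "0 < p" using t by (simp add: p_def)
    have pK: "p \<le> K * (1 - (cmod z)\<^sup>2)"
    proof -
      have "p \<le> 1 - t\<^sup>2" using t by (simp add: p_def power2_eq_square mult_left_le)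
      then show ?thesis using K(2)[OF vD] by (simp add: nv z_def)
    qed
    have pL: "1 - (cmod z)\<^sup>2 \<le> 2 * L * p"
    proof -
      have "\<zeta> - v = complex_of_real p * \<zeta>" by (simp add: v_def p_def algebra_simps)
      then have "cmod (\<zeta> - v) = p" using p \<zeta> by (simp add: norm_mult)
      then have "cmod (\<eta> \<zeta> - z) \<le> L * p" using L(2)[of \<zeta> v] \<zeta> nv t by (simp add: z_def)
      then have "1 - cmod z \<le> L * p" using norm_triangle_ineq2[of "\<eta> \<zeta>" z] touch by simp
      then have "2 * (1 - cmod z) \<le> 2 * (L * p)" by simp
      moreover have "1 - (cmod z)\<^sup>2 \<le> 2 * (1 - cmod z)"
        by (rule one_minus_norm_square_le)
      ultimately have "1 - (cmod z)\<^sup>2 \<le> 2 * (L * p)" by (rule order_trans[rotated])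
      then show ?thesis by simp
    qed
    have sub: "x \<in> unit_disk \<and> \<eta> x \<in> hyperbolic_disk z r \<and> 1 - (cmod x)\<^sup>2 \<le> 3 * p" if x: "x \<in> ball v (e * p)" for x
    proof -
      have d: "cmod (x - v) < e * p" using x by (simp add: dist_norm norm_minus_commute)
      have ep: "e * p \<le> p / 2" using e p mult_right_mono[of e "1/2" p] by simp
      have d2: "cmod (x - v) < p / 2" using d ep by (rule less_le_trans)
      have "cmod x \<le> t + cmod (x - v)" using norm_triangle_sub[of x v] nv by simp
      then have x1: "cmod x < 1" using d2 p by (simp add: p_def)
      have "t \<le> cmod x + cmod (x - v)" using norm_triangle_sub[of v x] nv by (simp add: norm_minus_commute)
      then have "1 - cmod x \<le> 3 / 2 * p" using d2 by (simp add: p_def)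
      then have "2 * (1 - cmod x) \<le> 3 * p" by simp
      moreover have "1 - (cmod x)\<^sup>2 \<le> 2 * (1 - cmod x)"
        by (rule one_minus_norm_square_le)
      ultimately have 3: "1 - (cmod x)\<^sup>2 \<le> 3 * p" by (rule order_trans[rotated])
      have "cmod (\<eta> x - z) \<le> L * cmod (x - v)" using L(2)[of x v] x1 nv t by (simp add: z_def)
      also have "\<dots> < L * (e * p)" using d L by simp
      also have "\<dots> \<le> L * e * (K * (1 - (cmod z)\<^sup>2))"
        using pK L e by (subst mult.assoc[symmetric]) (intro mult_left_mono, auto)
      also have "\<dots> \<le> \<delta> * (1 - (cmod z)\<^sup>2)"
        using e(3) one_minus_norm_square_pos[OF z] by (subst mult.assoc[symmetric]) (intro mult_right_mono, auto)
      finally have "\<eta> x \<in> ball z (\<delta> * (1 - (cmod z)\<^sup>2))" by (simp add: dist_norm norm_minus_commute)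
      then have "\<eta> x \<in> hyperbolic_disk z r" using ball_subset_hyperbolic_disk[OF r z] unfolding \<delta>_def by blast
      with x1 3 show ?thesis by simp
    qed
    have I: "ennreal (l\<^sup>2 * (3 * p) powr \<alpha> * (pi * (e * p)\<^sup>2)) \<le>
      (\<integral>\<^sup>+u. ennreal (indicator {u \<in> unit_disk. \<eta> u \<in> hyperbolic_disk z r} u * ((cmod (deriv \<eta> u))\<^sup>2 * (1 - (cmod u)\<^sup>2) powr \<alpha>)) \<partial>lborel)"
    proof -
      have "ennreal (l\<^sup>2 * (3 * p) powr \<alpha> * (pi * (e * p)\<^sup>2)) = ennreal (l\<^sup>2 * (3 * p) powr \<alpha>) * emeasure lborel (ball v (e * p))"
        using e p by (simp add: emeasure_complex_ball ennreal_mult)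
      also have "\<dots> = (\<integral>\<^sup>+x. ennreal (l\<^sup>2 * (3 * p) powr \<alpha>) * indicator (ball v (e * p)) x \<partial>lborel)"
        by (simp add: nn_integral_cmult)
      also have "\<dots> \<le> (\<integral>\<^sup>+u. ennreal (indicator {u \<in> unit_disk. \<eta> u \<in> hyperbolic_disk z r} u * ((cmod (deriv \<eta> u))\<^sup>2 * (1 - (cmod u)\<^sup>2) powr \<alpha>)) \<partial>lborel)"
      proof (intro nn_integral_mono)
        fix x
        show "ennreal (l\<^sup>2 * (3 * p) powr \<alpha>) * indicator (ball v (e * p)) x \<le>
          ennreal (indicator {u \<in> unit_disk. \<eta> u \<in> hyperbolic_disk z r} x * ((cmod (deriv \<eta> x))\<^sup>2 * (1 - (cmod x)\<^sup>2) powr \<alpha>))"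
        proof (cases "x \<in> ball v (e * p)")
          case True
          note x = sub[OF True]
          have "(3 * p) powr \<alpha> \<le> (1 - (cmod x)\<^sup>2) powr \<alpha>"
            using x \<alpha>0 one_minus_norm_square_pos[of x] by (intro powr_mono2') auto
          moreover have "l\<^sup>2 \<le> (cmod (deriv \<eta> x))\<^sup>2" using l x by (intro power_mono l(2)) auto
          ultimately have "l\<^sup>2 * (3 * p) powr \<alpha> \<le> (cmod (deriv \<eta> x))\<^sup>2 * (1 - (cmod x)\<^sup>2) powr \<alpha>"
            by (intro mult_mono) auto
          then show ?thesis using True x by (auto intro!: ennreal_leI)
        qed simp
      qed
      finally show ?thesis .
    qed
    have "ennreal (A * p powr ?s) = ennreal (1 / pi) * ennreal (l\<^sup>2 * (3 * p) powr \<alpha> * (pi * (e * p)\<^sup>2))"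
    proof -
      have "(3 * p) powr \<alpha> = 3 powr \<alpha> * p powr \<alpha>" by (rule powr_mult)
      moreover have "p powr ?s = p powr \<alpha> * p\<^sup>2" using p by (simp add: powr_add powr_numeral)
      ultimately have "A * p powr ?s = 1 / pi * (l\<^sup>2 * (3 * p) powr \<alpha> * (pi * (e * p)\<^sup>2))"
        by (simp add: A_def power_mult_distrib)
      then show ?thesis by (subst ennreal_mult[symmetric]) auto
    qed
    also have "\<dots> \<le> counting_integral \<eta> \<alpha> r z"
      unfolding averaged_counting_eq[OF z] by (intro mult_left_mono I) simp
    finally have num: "ennreal (A * p powr ?s) \<le> counting_integral \<eta> \<alpha> r z" .
    have "uu * (1 - (cmod z)\<^sup>2) powr ?s \<le> B * p powr ?s"
    proof -
      have "(1 - (cmod z)\<^sup>2) powr ?s \<le> (2 * L * p) powr ?s"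
        using pL \<alpha> one_minus_norm_square_pos[OF z] by (intro powr_mono2) auto
      also have "\<dots> = (2 * L) powr ?s * p powr ?s" by (rule powr_mult)
      finally show ?thesis using up(1) by (simp add: B_def mult.assoc)
    qed
    then have den: "emeasure (weighted_area \<alpha>) (hyperbolic_disk z r) \<le> ennreal (B * p powr ?s)"
      using up(2)[OF z] by (auto intro: order_trans ennreal_leI)
    have "ennreal (A * p powr ?s / (B * p powr ?s)) \<le> ?q z"
      by (rule ennreal_le_divide[OF num den]) (use AB p in auto)
    then show ?thesis using p by (simp add: z_def v_def)
  qed
  have "ennreal (A / B) \<le> averaged_counting_limsup \<eta> \<alpha> r"
    unfolding averaged_counting_limsup_def Limsup_def
  proof (rule INF_greatest)
    fix P assume "P \<in> {P. eventually P (filtercomap cmod (at_left 1))}"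
    then obtain R where R: "eventually R (at_left (1::real))" "\<And>z. R (cmod z) \<Longrightarrow> P z"
      unfolding eventually_filtercomap by auto
    obtain b where b: "b < 1" "\<And>t. b < t \<Longrightarrow> t < 1 \<Longrightarrow> R t"
      using R(1) unfolding eventually_at_left_field by blast
    have "((\<lambda>t. cmod (\<eta> (complex_of_real t * \<zeta>))) \<longlongrightarrow> 1) (at_left 1)"
    proof (rule tendsto_sandwich[of "\<lambda>t. 1 - L * (1 - t)" _ _ "\<lambda>_. 1"])
      show "((\<lambda>t. 1 - L * (1 - t)) \<longlongrightarrow> 1) (at_left 1)" by (auto intro!: tendsto_eq_intros)
      have ev: "\<forall>\<^sub>F t in at_left 1. 0 < t \<and> t < (1::real)"
        unfolding eventually_at_left_field by (intro exI[of _ 0]) auto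
      show "\<forall>\<^sub>F t in at_left 1. 1 - L * (1 - t) \<le> cmod (\<eta> (complex_of_real t * \<zeta>))"
      proof (rule eventually_mono[OF ev])
        fix t :: real assume t: "0 < t \<and> t < 1"
        have "\<zeta> - complex_of_real t * \<zeta> = complex_of_real (1 - t) * \<zeta>" by (simp add: algebra_simps)
        then have "cmod (\<zeta> - complex_of_real t * \<zeta>) = 1 - t" using t \<zeta> by (simp add: norm_mult del: of_real_diff)
        then have "cmod (\<eta> \<zeta> - \<eta> (complex_of_real t * \<zeta>)) \<le> L * (1 - t)"
          using L(2)[of \<zeta> "complex_of_real t * \<zeta>"] t \<zeta> by (simp add: norm_mult)
        then show "1 - L * (1 - t) \<le> cmod (\<eta> (complex_of_real t * \<zeta>))"
          using norm_triangle_ineq2[of "\<eta> \<zeta>" "\<eta> (complex_of_real t * \<zeta>)"] touch by simp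
      qed
      show "\<forall>\<^sub>F t in at_left 1. cmod (\<eta> (complex_of_real t * \<zeta>)) \<le> 1"
        by (rule eventually_mono[OF ev]) (use etaD \<zeta> in \<open>auto simp: norm_mult intro!: less_imp_le\<close>)
    qed simp
    then have "\<forall>\<^sub>F t in at_left 1. b < cmod (\<eta> (complex_of_real t * \<zeta>))" using b(1) by (rule order_tendstoD(1))
    moreover have "\<forall>\<^sub>F t in at_left 1. 0 < t \<and> t < (1::real)"
      unfolding eventually_at_left_field by (intro exI[of _ 0]) auto
    ultimately have "\<forall>\<^sub>F t in at_left 1. b < cmod (\<eta> (complex_of_real t * \<zeta>)) \<and> 0 < t \<and> t < 1"
      by (rule eventually_conj)
    then obtain t where t: "b < cmod (\<eta> (complex_of_real t * \<zeta>))" "0 < t" "t < 1"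
      using eventually_happens[of _ "at_left (1::real)"] trivial_limit_at_left_real by blast
    have "\<eta> (complex_of_real t * \<zeta>) \<in> unit_disk" by (rule etaD) (use t \<zeta> in \<open>simp add: norm_mult\<close>)
    then have "P (\<eta> (complex_of_real t * \<zeta>))" by (intro R(2) b(2) t) simp
    then have "?q (\<eta> (complex_of_real t * \<zeta>)) \<le> (SUP x\<in>Collect P. ?q x)" by (intro SUP_upper) simp
    with quot[OF t(2,3)] show "ennreal (A / B) \<le> (SUP x\<in>Collect P. ?q x)" by (rule order_trans)
  qed
  moreover have "0 < ennreal (A / B)" using AB by simp
  ultimately show ?thesis by (rule less_le_trans[rotated])
qed

end

section \<open>The comparison\<close>

theorem theorem5p13:
  fixes \<alpha> r :: real
    and \<phi> \<psi> \<tau> :: "complex \<Rightarrow> complex"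
    and a b c d a' b' c' d' :: complex
  assumes "- 1 < \<alpha>" and "\<alpha> < 0"
    and "nonconst_lf_self_map a' b' c' d'" and "\<phi> = linear_fractional a' b' c' d'"
    and "nonconst_lf_self_map a b c d" and "\<psi> = linear_fractional a b c d"
    and "\<tau> = krein_adjoint a b c d"
    and "r > 0"
  shows "\<exists>m M :: real. m > 0 \<and> M > 0 \<and>
    ennreal m * averaged_counting_limsup (\<tau> \<circ> \<phi>) \<alpha> r
      \<le> ennreal ((essential_norm \<alpha>
            (composition_operator \<phi> \<circ> hilbert_adjoint \<alpha> (composition_operator \<psi>)))\<^sup>2) \<and>
    ennreal ((essential_norm \<alpha>
            (composition_operator \<phi> \<circ> hilbert_adjoint \<alpha> (composition_operator \<psi>)))\<^sup>2)
      \<le> ennreal M * averaged_counting_limsup (\<tau> \<circ> \<phi>) \<alpha> r"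
proof -
  let ?T = "composition_operator \<phi> \<circ> hilbert_adjoint \<alpha> (composition_operator \<psi>)"
  let ?E = "essential_norm \<alpha> ?T" and ?L = "averaged_counting_limsup (\<tau> \<circ> \<phi>) \<alpha> r"
  note \<phi> = assms(3,4) and \<psi> = assms(5,6)
  have \<tau>: "nonconst_lf_self_map (cnj a) (- cnj c) (- cnj b) (cnj d)" "\<tau> = linear_fractional (cnj a) (- cnj c) (- cnj b) (cnj d)"
    using krein_adjoint_lf_self_map[OF \<psi>(1)] assms(7) by (simp_all add: krein_adjoint_def)
  obtain p q s t where \<eta>: "nonconst_lf_self_map p q s t"
    and e: "\<And>z. cmod z \<le> 1 \<Longrightarrow> \<tau> (\<phi> z) = linear_fractional p q s t z"
    using lf_compose[OF \<tau>(1) \<phi>(1)] \<tau>(2) \<phi>(2) by blast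
  define \<eta> where "\<eta> = linear_fractional p q s t"
  have L: "?L = averaged_counting_limsup \<eta> \<alpha> r"
    by (rule averaged_counting_limsup_cong) (use e in \<open>simp add: \<eta>_def\<close>)
  have \<tau>\<phi>: "\<tau> (\<phi> z) = \<eta> z" if "cmod z \<le> 1" for z using e[OF that] by (simp add: \<eta>_def)
  show ?thesis
  proof (cases "\<exists>\<zeta>. cmod \<zeta> \<le> 1 \<and> cmod (\<eta> \<zeta>) = 1")
    case True
    then obtain \<zeta> where \<zeta>: "cmod \<zeta> \<le> 1" "cmod (\<eta> \<zeta>) = 1" by blast
    have z1: "cmod \<zeta> = 1"
    proof (rule ccontr)
      assume "cmod \<zeta> \<noteq> 1"
      then have "\<zeta> \<in> unit_disk" using \<zeta>(1) by simp
      then have "\<eta> \<zeta> \<in> unit_disk" unfolding \<eta>_def by (rule lf_maps_disk[OF \<eta>])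
      then show False using \<zeta>(2) by simp
    qed
    define \<xi> where "\<xi> = \<phi> \<zeta>"
    have "cmod \<xi> \<le> 1" using lf_norm_le_1[OF \<phi>(1) \<zeta>(1)] \<phi>(2) by (simp add: \<xi>_def)
    moreover have \<tau>\<xi>: "\<tau> \<xi> = \<eta> \<zeta>" unfolding \<xi>_def by (rule \<tau>\<phi>[OF \<zeta>(1)])
    moreover have "cmod (\<tau> \<xi>) < 1" if "cmod \<xi> < 1"
      using lf_maps_disk[OF \<tau>(1), of \<xi>] \<tau>(2) that by simp
    ultimately have \<xi>1: "cmod \<xi> = 1" using \<zeta>(2) by fastforce
    have "\<tau> \<xi> * cnj (\<eta> \<zeta>) = 1" unfolding \<tau>\<xi> using \<zeta>(2) by (simp add: complex_norm_square[symmetric])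
    then have "\<psi> (\<eta> \<zeta>) = \<xi>"
      using krein_adjoint_circle[OF \<psi>(1) _ \<xi>1, of "\<eta> \<zeta>"] \<zeta>(2) \<psi>(2) assms(7) by simp
    then have E: "0 < ?E"
      using essential_norm_pos[OF assms(1,2) \<phi> \<psi> z1 \<zeta>(2)] \<xi>1 by (simp add: \<xi>_def)
    have "0 < ?L" unfolding L by (rule averaged_counting_limsup_pos[OF assms(1,2,8) \<eta> \<eta>_def z1 \<zeta>(2)])
    moreover have "?L < \<infinity>" unfolding L by (rule averaged_counting_limsup_finite[OF assms(1,2,8) \<eta> \<eta>_def])
    ultimately obtain x where x: "0 < x" "?L = ennreal x" by (cases ?L) auto
    have "ennreal (?E\<^sup>2 / x) * ?L = ennreal (?E\<^sup>2)"
      unfolding x(2) using x(1) by (subst ennreal_mult[symmetric]) auto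
    moreover have "0 < ?E\<^sup>2 / x" using E x by simp
    ultimately show ?thesis by (intro exI[of _ "?E\<^sup>2 / x"]) simp
  next
    case False
    then have inside: "cmod (\<eta> z) \<noteq> 1" if "cmod z \<le> 1" for z using that by blast
    have "\<psi> w * cnj (\<phi> z) \<noteq> 1" if z: "cmod z \<le> 1" and w: "cmod w \<le> 1" for z w
    proof
      assume 1: "\<psi> w * cnj (\<phi> z) = 1"
      have le: "cmod (\<phi> z) \<le> 1" "cmod (\<psi> w) \<le> 1"
        using lf_norm_le_1[OF \<phi>(1) z] lf_norm_le_1[OF \<psi>(1) w] \<phi>(2) \<psi>(2) by simp_all
      have "cmod (\<psi> w) * cmod (\<phi> z) = 1" using arg_cong[OF 1, of cmod] by (simp add: norm_mult)
      moreover have "cmod (\<psi> w) * cmod (\<phi> z) \<le> 1 * cmod (\<phi> z)" using le by (intro mult_right_mono) auto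
      ultimately have n1: "cmod (\<phi> z) = 1" using le by linarith
      then have "\<phi> z * cnj (\<phi> z) = 1" by (simp add: complex_norm_square[symmetric])
      then have "\<psi> w * cnj (\<phi> z) = \<phi> z * cnj (\<phi> z)" using 1 by simp
      then have "\<psi> w = \<phi> z" using n1 by auto
      then have "\<tau> (\<phi> z) * cnj w = 1"
        using krein_adjoint_circle[OF \<psi>(1) w n1] \<psi>(2) assms(7) by simp
      then have "\<eta> z * cnj w = 1" using \<tau>\<phi>[OF z] by simp
      then have p1: "cmod (\<eta> z) * cmod w = 1" using norm_mult[of "\<eta> z" "cnj w"] by simp
      have "cmod (\<eta> z) \<le> 1" using lf_norm_le_1[OF \<eta> z] by (simp add: \<eta>_def)
      moreover have "cmod (\<eta> z) * cmod w \<le> cmod (\<eta> z) * 1" using w by (intro mult_left_mono) auto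
      ultimately have "cmod (\<eta> z) = 1" using p1 by linarith
      then show False using inside[OF z] by simp
    qed
    then have "compact_operator \<alpha> ?T" by (intro product_compact[OF assms(1,2) \<phi> \<psi>])
    then have "?E = 0" by (rule essential_norm_compact[OF assms(1) product_bounded[OF assms(1,2) \<phi> \<psi>]])
    moreover have "?L = 0" unfolding L by (rule averaged_counting_limsup_zero[OF assms(1,2,8) \<eta> \<eta>_def inside])
    ultimately show ?thesis by (intro exI[of _ 1]) simp
  qed
qed

end
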